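(* Let $\mathcal{H}$ be an infinite-dimensional complex separable Hilbert space and let $N\in\mathcal{B}(\mathcal{H})$ be normal. The following are equivalent: (a) $\sigma(N)$ is a Lavrentieff set; (b) whenever $A\in\mathcal{B}(\mathcal{H})$ satisfies $\|p(A)\|=\|p(N)\|$ (operator norm) for every complex polynomial $p$, then $A$ is normal.
   Context: A compact set $K\subseteq\mathbb{C}$ is a Lavrentieff set if $\mathbb{C}\setminus K$ is connected and $K$ has empty interior. $\mathcal{B}(\mathcal{H})$ is the algebra of bounded linear operators on $\mathcal{H}$ with the operator norm. *)

theory Defs
  imports "HOL-Analysis.Analysis" "HOL-Computational_Algebra.Polynomial"
begin

class scaleC = scaleR +
  fixes scaleC :: "complex \<Rightarrow> 'a \<Rightarrow> 'a" (infixr \<open>*\<^sub>C\<close> 75)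
  assumes scaleR_scaleC: "scaleR r = scaleC (complex_of_real r)"

class complex_vector = scaleC + real_vector +
  assumes scaleC_add_right: "a *\<^sub>C (x + y) = a *\<^sub>C x + a *\<^sub>C y"
    and scaleC_add_left: "(a + b) *\<^sub>C x = a *\<^sub>C x + b *\<^sub>C x"
    and scaleC_scaleC: "a *\<^sub>C (b *\<^sub>C x) = (a * b) *\<^sub>C x"
    and scaleC_one: "1 *\<^sub>C x = x"

class complex_normed_vector = complex_vector + real_normed_vector +
  assumes norm_scaleC: "norm (a *\<^sub>C x) = cmod a * norm x"

class complex_inner = complex_normed_vector +
  fixes cinner :: "'a \<Rightarrow> 'a \<Rightarrow> complex"
  assumes cinner_commute: "cinner x y = cnj (cinner y x)"
    and cinner_add_left: "cinner (x + y) z = cinner x z + cinner y z"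
    and cinner_scaleC_left: "cinner (a *\<^sub>C x) y = cnj a * cinner x y"
    and cinner_self_real_nonneg: "Im (cinner x x) = 0 \<and> Re (cinner x x) \<ge> 0"
    and cinner_eq_zero_iff: "cinner x x = 0 \<longleftrightarrow> x = 0"
    and norm_eq_sqrt_cinner: "norm x = sqrt (Re (cinner x x))"

class chilbert_space = complex_inner + complete_space

definition separable :: "'a::topological_space set \<Rightarrow> bool" where
  "separable S \<longleftrightarrow> (\<exists>D. countable D \<and> D \<subseteq> S \<and> S \<subseteq> closure D)"

definition cspan :: "'a::complex_vector set \<Rightarrow> 'a set" where
  "cspan S = {\<Sum>x\<in>T. c x *\<^sub>C x | T c. finite T \<and> T \<subseteq> S}"

definition infinite_dimensional :: "'a::complex_vector itself \<Rightarrow> bool" where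
  "infinite_dimensional _ \<longleftrightarrow> \<not> (\<exists>S::'a set. finite S \<and> cspan S = UNIV)"

definition bounded_clinear :: "('a::complex_normed_vector \<Rightarrow> 'b::complex_normed_vector) \<Rightarrow> bool" where
  "bounded_clinear f \<longleftrightarrow>
     (\<forall>x y. f (x + y) = f x + f y) \<and> (\<forall>c x. f (c *\<^sub>C x) = c *\<^sub>C f x) \<and>
     (\<exists>K. \<forall>x. norm (f x) \<le> norm x * K)"

definition cadjoint :: "('a::complex_inner \<Rightarrow> 'a) \<Rightarrow> 'a \<Rightarrow> 'a" where
  "cadjoint A = (THE B. \<forall>x y. cinner (A x) y = cinner x (B y))"

definition normal_op :: "('a::complex_inner \<Rightarrow> 'a) \<Rightarrow> bool" where
  "normal_op A \<longleftrightarrow> A \<circ> cadjoint A = cadjoint A \<circ> A"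

definition op_spectrum :: "('a::complex_normed_vector \<Rightarrow> 'a) \<Rightarrow> complex set" where
  "op_spectrum A = {z. \<not> (\<exists>B. bounded_clinear B \<and>
       B \<circ> (\<lambda>x. A x - z *\<^sub>C x) = id \<and> (\<lambda>x. A x - z *\<^sub>C x) \<circ> B = id)}"

definition poly_op :: "complex poly \<Rightarrow> ('a::complex_vector \<Rightarrow> 'a) \<Rightarrow> 'a \<Rightarrow> 'a" where
  "poly_op p A = (\<lambda>x. \<Sum>i\<le>degree p. coeff p i *\<^sub>C (A ^^ i) x)"

definition lavrentieff :: "complex set \<Rightarrow> bool" where
  "lavrentieff K \<longleftrightarrow> compact K \<and> connected (- K) \<and> interior K = {}"

end

theory Submission
  imports Defs "HOL-Complex_Analysis.Complex_Analysis" "HOL-Real_Asymp.Real_Asymp" "HOL-Computational_Algebra.Fundamental_Theorem_Algebra"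
begin

text \<open>
  If the spectrum \<open>K\<close> is a Lavrentieff set, then \<open>cnj\<close> is a uniform limit on \<open>K\<close> of polynomials
  \<open>p\<^sub>n\<close>. Since \<open>\<parallel>p(A)\<parallel> = \<parallel>p(N)\<parallel> = sup\<^sub>K |p|\<close>, the operators \<open>p\<^sub>n(A)\<close> converge to some \<open>B\<close> commuting with
  \<open>A\<close>, and applying the norm equality to \<open>1 + \<i>t(c z + cnj c p\<^sub>n)\<close> for small real \<open>t\<close> shows that the
  quadratic form of \<open>c A + cnj c B\<close> is real; hence \<open>B\<close> is the adjoint of \<open>A\<close>.

  For the approximation of \<open>cnj\<close>, divide a large square into squares \<open>S\<close> of side \<open>d\<close> and centre \<open>c\<close>.
  Up to a holomorphic term, \<open>2\<pi>\<i> cnj z\<close> is minus the sum of the integrals of the bounded function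
  \<open>cnj (w - z) / (w - z)\<close> over the boundaries of the \<open>S\<close>, and each of these is close to
  \<open>-2\<i>d\<^sup>2 / (z - c)\<close>. The pole is then replaced by a function that is holomorphic off a connected
  subset of the complement of \<open>K\<close> of diameter about \<open>d\<close> near \<open>c\<close>, has size \<open>O(1/d)\<close> and differs
  from \<open>1 / (z - c)\<close> by \<open>O(d / |z - c|\<^sup>2)\<close>. The total error is \<open>O(d (ln d)\<^sup>2)\<close>.

  If \<open>K\<close> is not a Lavrentieff set, then some disc of centre \<open>a\<close> and radius \<open>r\<close> lies in \<open>K\<close> or in a hole
  of \<open>K\<close>, so every polynomial is bounded there by \<open>sup\<^sub>K |p|\<close>. By the Schwarz-Pick lemma the direct sum
  of \<open>N\<close> and the Jordan block with eigenvalue \<open>a\<close> and off-diagonal entry \<open>r\<close> satisfies all norm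
  equalities without being normal; a shift isometry of codimension two realises it on the
  given space.
\<close>

section \<open>Uniform approximation by polynomials\<close>

text \<open>Sizes shape the approximation. There are about \<open>1 / d^2\<close> squares, each of
  weight about \<open>d^2\<close>, so replacing every pole with an error as large as the pole itself
  would leave a total error that does not tend to 0. The replacement therefore has to match
  \<open>1 / (z - c)\<close> to first order at infinity: one distant square then costs
  \<open>O(d^3 / |z - c|^2)\<close>, and the sum over the grid is small. For the squares near
  \<open>z\<close> a contribution \<open>O(d)\<close> suffices, and it follows from crude bounds.
  Both halves of the Lavrentieff condition enter the kernel: empty interior gives a point off
  \<open>K\<close> near every centre, connectedness gives a connected set off \<open>K\<close> of
  diameter comparable to \<open>d\<close> and lets poles escape to infinity.

  That the norm of \<open>p(N)\<close> is the maximum of \<open>|p|\<close> on the spectrum comes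
  from comparing two growth rates of powers: Cauchy's estimate bounds them from above, normality
  from below.

  The off-diagonal entry \<open>r\<close> is the largest that Schwarz-Pick permits: \<open>p\<close>
  of the block has the entry \<open>r * p'(a)\<close>, which is what that lemma controls.\<close>

definition papprox :: "complex set \<Rightarrow> (complex \<Rightarrow> complex) \<Rightarrow> bool" where
  "papprox K f \<longleftrightarrow> (\<forall>e>0. \<exists>p. \<forall>z\<in>K. cmod (f z - poly p z) < e)"

lemma papproxD: "papprox K f \<Longrightarrow> e > 0 \<Longrightarrow> \<exists>p. \<forall>z\<in>K. cmod (f z - poly p z) < e"
  by (simp add: papprox_def)

lemma papprox_poly: "papprox K (poly p)"
  by (auto simp: papprox_def intro!: exI[of _ p])

lemma papprox_const: "papprox K (\<lambda>z. c)"
  by (auto simp: papprox_def intro!: exI[of _ "[:c:]"])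

lemma papprox_ident: "papprox K (\<lambda>z. z)"
  by (auto simp: papprox_def intro!: exI[of _ "[:0, 1:]"])

lemma papprox_cong:
  assumes "papprox K f" "\<And>z. z \<in> K \<Longrightarrow> f z = g z"
  shows "papprox K g"
  using assms by (simp add: papprox_def)

lemma papprox_limit:
  assumes "\<And>e. e > 0 \<Longrightarrow> \<exists>g. papprox K g \<and> (\<forall>z\<in>K. cmod (f z - g z) < e)"
  shows "papprox K f"
  unfolding papprox_def
proof (intro allI impI)
  fix e :: real assume e: "e > 0"
  obtain g where g: "papprox K g" "\<forall>z\<in>K. cmod (f z - g z) < e/2"
    using assms[of "e/2"] e by auto
  obtain p where p: "\<forall>z\<in>K. cmod (g z - poly p z) < e/2"
    using papproxD[OF g(1), of "e/2"] e by auto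
  have "cmod (f z - poly p z) < e" if "z \<in> K" for z
    using norm_triangle_ineq[of "f z - g z" "g z - poly p z"] g(2) p that by force
  then show "\<exists>p. \<forall>z\<in>K. cmod (f z - poly p z) < e" by blast
qed

lemma papprox_add:
  assumes "papprox K f" "papprox K g"
  shows "papprox K (\<lambda>z. f z + g z)"
  unfolding papprox_def
proof (intro allI impI)
  fix e :: real assume e: "e > 0"
  obtain p where p: "\<forall>z\<in>K. cmod (f z - poly p z) < e/2"
    using papproxD[OF assms(1), of "e/2"] e by auto
  obtain q where q: "\<forall>z\<in>K. cmod (g z - poly q z) < e/2"
    using papproxD[OF assms(2), of "e/2"] e by auto
  have "cmod (f z + g z - poly (p + q) z) < e" if "z \<in> K" for z
    using norm_triangle_ineq[of "f z - poly p z" "g z - poly q z"] p q that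
    by (force simp: algebra_simps)
  then show "\<exists>p. \<forall>z\<in>K. cmod (f z + g z - poly p z) < e" by blast
qed

lemma papprox_bounded:
  assumes "compact K" "papprox K f"
  shows "\<exists>B>0. \<forall>z\<in>K. cmod (f z) \<le> B"
proof -
  obtain p where p: "\<forall>z\<in>K. cmod (f z - poly p z) < 1"
    using papproxD[OF assms(2), of 1] by auto
  have "bounded (poly p ` K)"
    by (intro compact_imp_bounded compact_continuous_image assms continuous_intros)
  then obtain B where B: "B > 0" "\<And>z. z \<in> K \<Longrightarrow> cmod (poly p z) \<le> B"
    by (auto simp: bounded_pos)
  have "cmod (f z) \<le> B + 1" if "z \<in> K" for z
    using norm_triangle_ineq[of "f z - poly p z" "poly p z"] p B(2)[OF that] that by force
  moreover have "B + 1 > 0" using B(1) by simp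
  ultimately show ?thesis by blast
qed

lemma papprox_mult:
  assumes K: "compact K" and f: "papprox K f" and g: "papprox K g"
  shows "papprox K (\<lambda>z. f z * g z)"
  unfolding papprox_def
proof (intro allI impI)
  fix e :: real assume e: "e > 0"
  obtain A where A: "A > 0" "\<And>z. z \<in> K \<Longrightarrow> cmod (f z) \<le> A" using papprox_bounded[OF K f] by blast
  \<comment> \<open>\<open>q\<close> is fixed before \<open>p\<close>: the tolerance for
    \<open>p\<close> depends on a bound for the polynomial \<open>q\<close>.\<close>
  obtain q where q: "\<forall>z\<in>K. cmod (g z - poly q z) < e / (2 * A)"
    using papproxD[OF g, of "e / (2*A)"] e A by auto
  obtain B where B: "B > 0" "\<And>z. z \<in> K \<Longrightarrow> cmod (poly q z) \<le> B"
    using papprox_bounded[OF K papprox_poly] by blast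
  obtain p where p: "\<forall>z\<in>K. cmod (f z - poly p z) < e / (2 * B)"
    using papproxD[OF f, of "e / (2*B)"] e B by auto
  have "cmod (f z * g z - poly (p * q) z) < e" if z: "z \<in> K" for z
  proof -
    have "cmod (f z * g z - poly (p * q) z)
        = cmod (f z * (g z - poly q z) + (f z - poly p z) * poly q z)"
      by (simp add: algebra_simps)
    also have "\<dots> \<le> cmod (f z) * cmod (g z - poly q z) + cmod (f z - poly p z) * cmod (poly q z)"
      by (metis norm_triangle_ineq norm_mult)
    also have "\<dots> \<le> A * cmod (g z - poly q z) + cmod (f z - poly p z) * B"
      by (intro add_mono mult_right_mono mult_left_mono A B z) auto
    also have "\<dots> < A * (e / (2*A)) + e / (2*B) * B"
      by (intro add_strict_mono mult_strict_left_mono mult_strict_right_mono) (use p q z A B in auto)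
    also have "\<dots> = e" using A B by simp
    finally show ?thesis .
  qed
  then show "\<exists>p. \<forall>z\<in>K. cmod (f z * g z - poly p z) < e" by blast
qed

lemma papprox_cmult: "compact K \<Longrightarrow> papprox K f \<Longrightarrow> papprox K (\<lambda>z. c * f z)"
  by (intro papprox_mult papprox_const)

lemma papprox_diff:
  assumes "compact K" "papprox K f" "papprox K g"
  shows "papprox K (\<lambda>z. f z - g z)"
  using papprox_add[OF assms(2) papprox_cmult[OF assms(1) assms(3), of "-1"]] by simp

lemma papprox_power:
  assumes "compact K" "papprox K f"
  shows "papprox K (\<lambda>z. f z ^ n)"
proof (induction n)
  case 0
  then show ?case using papprox_const[of K 1] by simp
next
  case (Suc n)
  then show ?case using papprox_mult[OF assms Suc] by simp
qed

lemma papprox_sum: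
  assumes "\<And>i. i \<in> I \<Longrightarrow> papprox K (f i)"
  shows "papprox K (\<lambda>z. \<Sum>i\<in>I. f i z)"
  using assms
proof (induction I rule: infinite_finite_induct)
  case (insert i I)
  then show ?case using papprox_add[of K "f i" "\<lambda>z. \<Sum>i\<in>I. f i z"] by simp
qed (use papprox_const[of K 0] in auto)

text \<open>The Taylor polynomials of \<open>F\<close> at 0 converge uniformly on the closed disc of
  radius \<open>r < R\<close>, and a polynomial in \<open>f\<close> is again approximable. Serves
  geometric series and, through \<open>csqrt\<close>, local square roots.\<close>

lemma papprox_compose_holomorphic:
  assumes K: "compact K" and f: "papprox K f" and F: "F holomorphic_on ball 0 R"
    and r: "r < R" and fr: "\<And>z. z \<in> K \<Longrightarrow> cmod (f z) \<le> r"
  shows "papprox K (\<lambda>z. F (f z))"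
proof (rule papprox_limit)
  fix e :: real assume e: "e > 0"
  define a where "a n = (deriv ^^ n) F 0 / fact n" for n
  have sums: "(\<lambda>n. a n * w ^ n) sums F w" if "w \<in> ball 0 R" for w
    using holomorphic_power_series[OF F that] by (simp add: a_def)
  show "\<exists>g. papprox K g \<and> (\<forall>z\<in>K. cmod (F (f z) - g z) < e)"
  proof (cases "0 \<le> r")
    case False
    then have "K = {}" using fr norm_ge_zero order_trans by (metis equals0I)
    then show ?thesis using papprox_const by auto
  next
    case True
    \<comment> \<open>A radius strictly between \<open>r\<close> and \<open>R\<close>: convergence
      at \<open>t\<close> puts \<open>r\<close> strictly inside the disc of convergence.\<close>
    define t where "t = (r + R) / 2"
    have "summable (\<lambda>n. a n * of_real t ^ n)"
    proof -
      have "cmod (of_real t) < R" unfolding norm_of_real t_def using True r by auto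
      then show ?thesis using sums_summable[OF sums[of "of_real t"]] by simp
    qed
    then have "ereal (norm (of_real t :: complex)) \<le> conv_radius a"
      by (rule conv_radius_geI)
    moreover have "ereal r < ereal (norm (of_real t :: complex))"
      unfolding norm_of_real t_def using True r by simp
    ultimately have cr: "ereal r < conv_radius a" by (rule less_le_trans[rotated])
    have "uniform_limit (cball 0 r) (\<lambda>n x. \<Sum>i<n. a i * x ^ i) (\<lambda>x. suminf (\<lambda>i. a i * x ^ i)) sequentially"
      using powser_uniform_limit[OF cr, of 0] by simp
    then have "\<forall>\<^sub>F n in sequentially. \<forall>x\<in>cball 0 r. dist (\<Sum>i<n. a i * x ^ i) (suminf (\<lambda>i. a i * x ^ i)) < e"
      using e by (simp add: uniform_limit_iff)
    then obtain n where n: "\<And>x. x \<in> cball 0 r \<Longrightarrow> dist (\<Sum>i<n. a i * x ^ i) (suminf (\<lambda>i. a i * x ^ i)) < e"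
      unfolding eventually_sequentially by blast
    show ?thesis
    proof (intro exI conjI ballI)
      show "papprox K (\<lambda>z. \<Sum>i<n. a i * f z ^ i)"
        by (intro papprox_sum papprox_cmult papprox_power K f)
      fix z assume z: "z \<in> K"
      then have "f z \<in> cball 0 r" "f z \<in> ball 0 R" using fr[OF z] r by auto
      then show "cmod (F (f z) - (\<Sum>i<n. a i * f z ^ i)) < e"
        using n[of "f z"] sums[of "f z"] by (simp add: sums_iff dist_norm norm_minus_commute)
    qed
  qed
qed

section \<open>Poles, square roots and the replacement kernel off \<open>K\<close>\<close>

text \<open>Geometric series: \<open>1 / (z - q)\<close> is \<open>1 / (z - p)\<close> times
  \<open>1 / (1 - f z)\<close> with \<open>f z = (q - p) / (z - p)\<close>, and the factor 2 in the
  hypothesis keeps \<open>f\<close> in the disc of radius 1/2.\<close>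

lemma papprox_pole_near:
  assumes K: "compact K" and p: "papprox K (\<lambda>z. 1 / (z - p))"
    and d: "\<And>z. z \<in> K \<Longrightarrow> 2 * cmod (q - p) \<le> cmod (z - p)" and pK: "p \<notin> K"
  shows "papprox K (\<lambda>z. 1 / (z - q))"
proof -
  define f where "f = (\<lambda>z. (q - p) * (1 / (z - p)))"
  have hol: "(\<lambda>w. 1 / (1 - w)) holomorphic_on ball 0 1"
    by (intro holomorphic_intros) auto
  have fb: "cmod (f z) \<le> 1/2" if "z \<in> K" for z
  proof -
    have "cmod (z - p) > 0" using that pK by auto
    then show ?thesis using d[OF that] by (simp add: f_def norm_mult norm_divide field_simps)
  qed
  have f: "papprox K f" unfolding f_def by (rule papprox_cmult[OF K p])
  have "papprox K (\<lambda>z. 1 / (1 - f z))"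
    by (rule papprox_compose_holomorphic[OF K f hol _ fb]) auto
  from papprox_mult[OF K p this] show ?thesis
  proof (rule papprox_cong)
    fix z assume z: "z \<in> K"
    then have "z - p \<noteq> 0" using pK by auto
    then have "(z - p) * f z = q - p" by (simp add: f_def)
    then have "(z - p) * (1 - f z) = z - q" by (simp only: right_diff_distrib) simp
    then show "1 / (z - p) * (1 / (1 - f z)) = 1 / (z - q)"
      by simp
  qed
qed

text \<open>Runge's pole pushing. Approximability is unchanged by small moves of the pole, hence
  constant along the connected set \<open>- K\<close>, and it holds for a pole far out, where the
  Taylor series at 0 converges uniformly on \<open>K\<close>.\<close>

lemma papprox_pole:
  assumes K: "compact K" and conn: "connected (- K)" and p: "p \<notin> K"
  shows "papprox K (\<lambda>z. 1 / (z - p))"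
proof -
  obtain B where B: "B > 0" "\<And>z. z \<in> K \<Longrightarrow> cmod z \<le> B"
    using compact_imp_bounded[OF K] by (auto simp: bounded_pos)
  \<comment> \<open>Twice the radius of \<open>K\<close>, so that \<open>z / b\<close> stays in the
    disc of radius 1/2.\<close>
  define b where "b = complex_of_real (2 * B)"
  have nb: "cmod b = 2 * B" using B by (simp add: b_def)
  have bK: "b \<notin> K" using B(2)[of b] B(1) nb by auto
  have hol: "(\<lambda>w. (- 1 / b) * (1 / (1 - w))) holomorphic_on ball 0 1"
    by (intro holomorphic_intros) auto
  have "papprox K (\<lambda>z. (- 1 / b) * (1 / (1 - (1/b) * z)))"
  proof (rule papprox_compose_holomorphic[OF K _ hol, where r = "1/2"])
    show "papprox K (\<lambda>z. (1/b) * z)" by (rule papprox_cmult[OF K papprox_ident])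
    show "cmod ((1/b) * z) \<le> 1/2" if "z \<in> K" for z
      using B(2)[OF that] B(1) by (simp add: norm_mult norm_divide nb field_simps)
  qed auto
  then have base: "papprox K (\<lambda>z. 1 / (z - b))"
  proof (rule papprox_cong)
    fix z assume z: "z \<in> K"
    then have "z \<noteq> b" "b \<noteq> 0" using bK nb B by auto
    then show "(- 1 / b) * (1 / (1 - (1/b) * z)) = 1 / (z - b)"
      by (simp add: divide_simps)
  qed
  have "papprox K (\<lambda>z. 1 / (z - b)) \<longleftrightarrow> papprox K (\<lambda>z. 1 / (z - p))"
  proof (rule connected_equivalence_relation[OF conn,
        where R = "\<lambda>x y. papprox K (\<lambda>z. 1 / (z - x)) \<longleftrightarrow> papprox K (\<lambda>z. 1 / (z - y))"])
    show "b \<in> - K" "p \<in> - K" using bK p by auto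
    fix a assume a: "a \<in> - K"
    have "open (- K)" using K by (simp add: compact_imp_closed open_Compl)
    then obtain d where d: "d > 0" "ball a d \<subseteq> - K" using a openE by blast
    have ad: "d \<le> cmod (z - a)" if "z \<in> K" for z
      using d(2) that by (force simp: dist_norm norm_minus_commute)
    show "\<exists>T. openin (top_of_set (- K)) T \<and> a \<in> T \<and>
          (\<forall>x\<in>T. papprox K (\<lambda>z. 1 / (z - a)) = papprox K (\<lambda>z. 1 / (z - x)))"
    proof (intro exI conjI ballI)
      \<comment> \<open>The radius \<open>d / 3\<close> permits moves in both directions: points of
        \<open>K\<close> are at least \<open>d\<close> from \<open>a\<close>, hence more than
        \<open>2 * d / 3\<close> from \<open>x\<close>, which is over twice the distance from
        \<open>x\<close> to \<open>a\<close>.\<close>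
      show "openin (top_of_set (- K)) (ball a (d/3))"
      proof (rule open_subset)
        have "ball a (d/3) \<subseteq> ball a d" using d(1) by (intro subset_ball) simp
        then show "ball a (d/3) \<subseteq> - K" using d(2) by blast
      qed simp
      show "a \<in> ball a (d/3)" using d by auto
      fix x assume x: "x \<in> ball a (d/3)"
      then have xa: "cmod (x - a) < d/3" by (simp add: dist_norm norm_minus_commute)
      have xK: "x \<notin> K" using ad[of x] xa d(1) by auto
      have xd: "2 * cmod (a - x) \<le> cmod (z - x)" if "z \<in> K" for z
        using ad[OF that] xa norm_triangle_ineq[of "z - x" "x - a"]
        by (simp add: norm_minus_commute)
      have ad': "2 * cmod (x - a) \<le> cmod (z - a)" if "z \<in> K" for z
        using ad[OF that] xa zero_le_dist[of z a] d(1) by argo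
      show "papprox K (\<lambda>z. 1 / (z - a)) = papprox K (\<lambda>z. 1 / (z - x))"
      proof
        assume "papprox K (\<lambda>z. 1 / (z - a))"
        then show "papprox K (\<lambda>z. 1 / (z - x))"
          using a by (intro papprox_pole_near[OF K _ ad']) auto
      next
        assume "papprox K (\<lambda>z. 1 / (z - x))"
        then show "papprox K (\<lambda>z. 1 / (z - a))"
          by (intro papprox_pole_near[OF K _ xd xK])
      qed
    qed
  qed auto
  with base show ?thesis by blast
qed

text \<open>Away from the disc the quotient has positive real part, and positivity of \<^term>\<open>Re (s z)\<close>
  selects its principal root. Principal roots with positive real part multiply correctly, which makes
  the relation between \<^term>\<open>p\<close> and \<^term>\<open>q\<close> transitive.\<close>

lemma papprox_sqrt_quotient:
  assumes K: "compact K" and conn: "connected (- K)"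
    and W: "connected W" "W \<subseteq> ball c d" "W \<inter> K = {}" and pq: "p \<in> W" "q \<in> W"
  shows "\<exists>s. papprox K s \<and> (\<forall>z\<in>K. (s z)\<^sup>2 = (z - q) / (z - p)) \<and>
             (\<forall>z\<in>K. 4 * d \<le> cmod (z - c) \<longrightarrow> 0 < Re (s z))"
proof -
  define R where "R p q \<longleftrightarrow> (\<exists>s. papprox K s \<and> (\<forall>z\<in>K. (s z)\<^sup>2 = (z - q) / (z - p)) \<and>
             (\<forall>z\<in>K. 4 * d \<le> cmod (z - c) \<longrightarrow> 0 < Re (s z)))" for p q
  have RI: "R p q" if "papprox K s" "\<And>z. z \<in> K \<Longrightarrow> (s z)\<^sup>2 = (z - q) / (z - p)"
      "\<And>z. z \<in> K \<Longrightarrow> 4 * d \<le> cmod (z - c) \<Longrightarrow> 0 < Re (s z)" for s p q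
    using that unfolding R_def by blast
  have RE: "\<exists>s. papprox K s \<and> (\<forall>z\<in>K. (s z)\<^sup>2 = (z - q) / (z - p)) \<and>
             (\<forall>z\<in>K. 4 * d \<le> cmod (z - c) \<longrightarrow> 0 < Re (s z))" if "R p q" for p q
    using that unfolding R_def by blast
  have nK: "z - x \<noteq> 0" if "x \<in> W" "z \<in> K" for x z using that W(3) by auto
  have "R p q"
  proof (rule connected_equivalence_relation[OF W(1) pq])
    fix x y assume xy: "R x y" "x \<in> W" "y \<in> W"
    obtain s where s: "papprox K s" "\<And>z. z \<in> K \<Longrightarrow> (s z)\<^sup>2 = (z - y) / (z - x)"
        "\<And>z. z \<in> K \<Longrightarrow> 4 * d \<le> cmod (z - c) \<Longrightarrow> 0 < Re (s z)"
      using RE[OF xy(1)] by blast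
    \<comment> \<open>The reciprocal of the root is reached through products: it equals the root
      times \<open>(z - x) / (z - y)\<close>, and the pole at \<open>y\<close> is
      approximable.\<close>
    have inv: "s z * ((z - x) * (1 / (z - y))) = inverse (s z)" if "z \<in> K" for z
    proof -
      have n: "z - x \<noteq> 0" "z - y \<noteq> 0" using nK xy that by auto
      then have "s z \<noteq> 0" using s(2)[OF that] by (metis divide_eq_0_iff zero_power2)
      moreover have "s z * s z * ((z - x) * (1 / (z - y))) = 1"
        using s(2)[OF that] n by (simp add: power2_eq_square)
      ultimately show ?thesis by (metis inverse_unique mult.assoc)
    qed
    show "R y x"
    proof (rule RI)
      have xy': "x \<notin> K" "y \<notin> K" using xy W(3) by auto
      have "papprox K (\<lambda>z. z - x)" using papprox_diff[OF K papprox_ident papprox_const] .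
      from papprox_mult[OF K s(1) papprox_mult[OF K this papprox_pole[OF K conn xy'(2)]]]
      show "papprox K (\<lambda>z. inverse (s z))" by (rule papprox_cong) (rule inv)
      show "(inverse (s z))\<^sup>2 = (z - x) / (z - y)" if "z \<in> K" for z
        using s(2)[OF that] by (simp add: power_inverse)
      show "0 < Re (inverse (s z))" if "z \<in> K" "4 * d \<le> cmod (z - c)" for z
      proof -
        have "0 < Re (s z)" using s(3) that by blast
        then show ?thesis by (simp add: divide_pos_pos add_pos_nonneg)
      qed
    qed
  next
    fix x y u assume xy: "R x y" "R y u" "x \<in> W" "y \<in> W" "u \<in> W"
    obtain s where s: "papprox K s" "\<And>z. z \<in> K \<Longrightarrow> (s z)\<^sup>2 = (z - y) / (z - x)"
        "\<And>z. z \<in> K \<Longrightarrow> 4 * d \<le> cmod (z - c) \<Longrightarrow> 0 < Re (s z)"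
      using RE[OF xy(1)] by blast
    obtain t where t: "papprox K t" "\<And>z. z \<in> K \<Longrightarrow> (t z)\<^sup>2 = (z - u) / (z - y)"
        "\<And>z. z \<in> K \<Longrightarrow> 4 * d \<le> cmod (z - c) \<Longrightarrow> 0 < Re (t z)"
      using RE[OF xy(2)] by blast
    \<comment> \<open>Away from the disc the quotient is 1 plus a term of modulus below 1, so
      \<open>w\<^sup>2\<close> has positive real part. A root \<open>w\<close> with positive real
      part then has argument below \<open>pi / 4\<close> in modulus, and a product of two such roots
      keeps positive real part.\<close>
    have pos: "\<bar>Im w\<bar> < Re w" if "0 < Re w" "w\<^sup>2 = (z - b) / (z - a)" "a \<in> W" "b \<in> W"
        "4 * d \<le> cmod (z - c)" for w z a b
    proof -
      have ab: "cmod (a - c) < d" "cmod (b - c) < d"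
        using that W(2) by (auto simp: dist_norm norm_minus_commute subset_iff)
      have za: "cmod (z - a) \<ge> 3 * d"
        using norm_triangle_ineq[of "z - a" "a - c"] ab that by simp
      have ba: "cmod (a - b) < 2 * d"
        using norm_triangle_ineq4[of "a - c" "b - c"] ab by simp
      have d: "d > 0" using ab norm_ge_zero order_le_less_trans by blast
      then have n: "z - a \<noteq> 0" using za by auto
      have "w\<^sup>2 = 1 + (a - b) / (z - a)" using that(2) n by (simp add: field_simps)
      moreover have "cmod ((a - b) / (z - a)) < 1"
      proof -
        have "cmod (a - b) < cmod (z - a)" using za ba d by linarith
        then show ?thesis by (simp add: norm_divide divide_less_eq)
      qed
      ultimately have "Re (w\<^sup>2) > 0"
        using abs_Re_le_cmod[of "(a - b) / (z - a)"] by auto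
      then have "(Im w)\<^sup>2 < (Re w)\<^sup>2" by (simp add: power2_eq_square)
      then show ?thesis using that(1) by (metis abs_le_square_iff abs_of_pos linorder_not_le)
    qed
    show "R x u"
    proof (rule RI)
      show "papprox K (\<lambda>z. s z * t z)" by (rule papprox_mult[OF K s(1) t(1)])
      show "(s z * t z)\<^sup>2 = (z - u) / (z - x)" if "z \<in> K" for z
        using s(2) t(2) nK[OF xy(4)] that by (simp add: power_mult_distrib)
      show "0 < Re (s z * t z)" if z: "z \<in> K" "4 * d \<le> cmod (z - c)" for z
      proof -
        have "\<bar>Im (s z)\<bar> * \<bar>Im (t z)\<bar> < Re (s z) * Re (t z)"
          by (rule mult_strict_mono') (use pos s t z xy in auto)
        then show ?thesis using abs_ge_self[of "Im (s z) * Im (t z)"] by (simp add: abs_mult)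
      qed
    qed
  next
    fix a assume a: "a \<in> W"
    have "open (- K)" using K by (simp add: compact_imp_closed open_Compl)
    moreover have "a \<in> - K" using a W by auto
    ultimately obtain r where r: "r > 0" "ball a r \<subseteq> - K" using openE by blast
    have ar: "r \<le> cmod (z - a)" if "z \<in> K" for z
      using r(2) that by (force simp: dist_norm norm_minus_commute)
    have hol: "(\<lambda>w. csqrt (1 + w)) holomorphic_on ball 0 1"
    proof (intro holomorphic_intros)
      fix z :: complex assume z: "z \<in> ball 0 1"
      then have "Re (1 + z) > 0" using abs_Re_le_cmod[of z] by auto
      then show "1 + z \<notin> \<real>\<^sub>\<le>\<^sub>0" using complex_nonpos_Reals_iff by auto
    qed
    \<comment> \<open>For \<open>x\<close> near \<open>a\<close> the quotient is
      \<open>1 + f z\<close> with \<open>f\<close> in the disc of radius 1/2, where the principal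
      root is holomorphic.\<close>
    have "R a x" if x: "x \<in> ball a (r/2)" for x
    proof (rule RI)
      define f where "f = (\<lambda>z. (a - x) * (1 / (z - a)))"
      have f: "papprox K f" unfolding f_def
        by (rule papprox_cmult[OF K papprox_pole[OF K conn]]) (use \<open>a \<in> - K\<close> in auto)
      have fb: "cmod (f z) \<le> 1/2" if "z \<in> K" for z
      proof -
        have "cmod (a - x) < r/2" using x by (simp add: dist_norm)
        then show ?thesis using ar[OF that] r(1) by (simp add: f_def norm_mult norm_divide divide_le_eq)
      qed
      show "papprox K (\<lambda>z. csqrt (1 + f z))"
        by (rule papprox_compose_holomorphic[OF K f hol _ fb]) auto
      show "(csqrt (1 + f z))\<^sup>2 = (z - x) / (z - a)" if "z \<in> K" for z
        using nK[OF a that] by (simp add: f_def field_simps)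
      show "0 < Re (csqrt (1 + f z))" if "z \<in> K" for z
      proof -
        have "Re (1 + f z) > 0" using fb[OF that] abs_Re_le_cmod[of "f z"] by auto
        then show ?thesis by (simp add: Re_csqrt less_le csqrt_principal) (smt (verit) Re_csqrt abs_Re_le_cmod real_sqrt_gt_zero)
      qed
    qed
    then show "\<exists>T. openin (top_of_set W) T \<and> a \<in> T \<and> (\<forall>x\<in>T. R a x)"
      using r(1) a by (intro exI[of _ "W \<inter> ball a (r/2)"]) auto
  qed
  then show ?thesis by (rule RE)
qed

text \<open>\<open>K\<close> contains no disc, so some \<open>p\<close> off \<open>K\<close> is
  within \<open>d / 4\<close> of \<open>c\<close>. A path off \<open>K\<close> from \<open>p\<close>
  to a far point, cut on the circle of radius \<open>d / 2\<close>, ends at \<open>q\<close>. The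
  two radii keep \<open>p\<close> and \<open>q\<close> at least \<open>d / 4\<close> apart, which
  later bounds the kernel by \<open>O(1/d)\<close>.\<close>

lemma exists_escaping_connected_set:
  assumes K: "compact K" and conn: "connected (- K)" and int: "interior K = {}" and d: "d > 0"
  shows "\<exists>W p q. connected W \<and> W \<subseteq> ball c d \<and> W \<inter> K = {} \<and> p \<in> W \<and> q \<in> W \<and>
           cmod (p - c) < d / 4 \<and> cmod (q - c) = d / 2"
proof -
  have "\<not> ball c (d/4) \<subseteq> K"
    using int d interior_maximal[of "ball c (d/4)" K] by auto
  then obtain p where p: "p \<in> ball c (d/4)" "p \<notin> K" by blast
  obtain B where B: "B > 0" "\<And>z. z \<in> K \<Longrightarrow> cmod z \<le> B"
    using compact_imp_bounded[OF K] by (auto simp: bounded_pos)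
  define b where "b = complex_of_real (B + cmod c + d)"
  have nb: "cmod b = B + cmod c + d" unfolding b_def norm_of_real using B(1) d by simp
  have bK: "b \<notin> K" using B(2)[of b] nb d norm_ge_zero[of c] by argo
  have bS: "b \<notin> cball c (d/2)"
  proof -
    have "cmod (b - c) \<ge> cmod b - cmod c" by (rule norm_triangle_ineq2)
    then show ?thesis using nb B(1) d by (simp add: dist_norm norm_minus_commute)
  qed
  have "open (- K)" using K by (simp add: compact_imp_closed open_Compl)
  then have "path_connected (- K)" using conn connected_open_path_connected by blast
  then obtain g where g: "path g" "path_image g \<subseteq> - K" "pathstart g = p" "pathfinish g = b"
    using p bK unfolding path_connected_def by (metis ComplI)
  have pS: "p \<in> cball c (d/2)" using p d by auto
  obtain h where h: "path h" "pathstart h = pathstart g" "path_image h \<subseteq> path_image g \<inter> cball c (d/2)"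
      "pathfinish h \<in> frontier (cball c (d/2))"
    using exists_path_subpath_to_frontier_closed[OF closed_cball g(1), of c "d/2"] g pS bS by metis
  have "cball c (d/2) \<subseteq> ball c d" using d by auto
  moreover have "pathfinish h \<in> sphere c (d/2)" using h(4) d by (simp add: frontier_cball)
  moreover have "p \<in> path_image h" using h(2) g(3) pathstart_in_path_image by metis
  moreover have "pathfinish h \<in> path_image h" by (rule pathfinish_in_path_image)
  moreover have "connected (path_image h)" using h(1) by (rule connected_path_image)
  moreover have "path_image h \<subseteq> cball c (d/2)" "path_image h \<inter> K = {}" using h(3) g(2) by blast+
  moreover have "cmod (p - c) < d / 4" using p(1) by (simp add: dist_norm norm_minus_commute)
  ultimately have "connected (path_image h) \<and> path_image h \<subseteq> ball c d \<and> path_image h \<inter> K = {} \<and>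
      p \<in> path_image h \<and> pathfinish h \<in> path_image h \<and> cmod (p - c) < d / 4 \<and> cmod (pathfinish h - c) = d / 2"
    by (auto simp: dist_norm norm_minus_commute)
  then show ?thesis by blast
qed

text \<open>With \<open>m\<close> and \<open>h\<close> the midpoint and half the difference of \<open>p\<close> and \<open>q\<close>, and \<open>w = z - m\<close>, the
  function \<open>w - sqrt (w\<^sup>2 - h\<^sup>2)\<close> is \<open>h\<^sup>2 / (2 w) + O(w\<^sup>-\<^sup>3)\<close> at infinity. It plays the part of the
  Riemann map of the complement of the connected set joining \<open>p\<close> and \<open>q\<close>.\<close>

lemma exists_kernel:
  assumes K: "compact K" and conn: "connected (- K)" and int: "interior K = {}" and d: "d > 0"
  shows "\<exists>g. papprox K g \<and>
           (\<forall>z\<in>K. cmod (z - c) < 8 * d \<longrightarrow> cmod (g z) \<le> 2432 / d) \<and>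
           (\<forall>z\<in>K. 8 * d \<le> cmod (z - c) \<longrightarrow> cmod (g z - 1 / (z - c)) \<le> 2 * d / (cmod (z - c))\<^sup>2)"
proof -
  obtain W p q where W: "connected W" "W \<subseteq> ball c d" "W \<inter> K = {}" "p \<in> W" "q \<in> W"
    and pc: "cmod (p - c) < d / 4" and qc: "cmod (q - c) = d / 2"
    using exists_escaping_connected_set[OF assms] by blast
  obtain s where s: "papprox K s" "\<And>z. z \<in> K \<Longrightarrow> (s z)\<^sup>2 = (z - q) / (z - p)"
      "\<And>z. z \<in> K \<Longrightarrow> 4 * d \<le> cmod (z - c) \<Longrightarrow> 0 < Re (s z)"
    using papprox_sqrt_quotient[OF K conn W] by blast
  define h where "h = (p - q) / 2"
  define m where "m = (p + q) / 2"
  have pm: "p = m + h" and qm: "q = m - h" by (simp_all add: h_def m_def field_simps)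
  have h1: "cmod h \<ge> d / 8" and h2: "cmod h \<le> 3 * d / 8" 
    using norm_triangle_ineq2[of "q - c" "p - c"] norm_triangle_ineq4[of "p - c" "q - c"] pc qc
    by (simp_all add: h_def norm_divide norm_minus_commute)
  have "m - c = ((p - c) + (q - c)) / 2" by (simp add: m_def field_simps)
  then have mc: "cmod (m - c) \<le> 3 * d / 8"
    using norm_triangle_ineq[of "p - c" "q - c"] pc qc by (simp only: norm_divide) simp
  have h0: "h \<noteq> 0" using h1 d by auto
  \<comment> \<open>\<open>t\<close> is the branch of the root of \<open>(z - p) * (z - q)\<close>
    that behaves like \<open>z\<close> far away. The factor in \<open>g\<close> turns the leading
    term \<open>h\<^sup>2 / (2 * w)\<close> into \<open>1 / w\<close>.\<close>
  define t where "t = (\<lambda>z. (z - p) * s z)"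
  define g where "g = (\<lambda>z. (2 / h\<^sup>2) * ((z - m) - t z))"
  have t2: "(t z)\<^sup>2 = (z - m)\<^sup>2 - h\<^sup>2" if "z \<in> K" for z
  proof -
    have "z - p \<noteq> 0" using that W by auto
    then have "(t z)\<^sup>2 = (z - p) * (z - q)"
      unfolding t_def power_mult_distrib s(2)[OF that] by (simp add: power2_eq_square)
    then show ?thesis by (simp add: pm qm power2_eq_square algebra_simps)
  qed
  have "papprox K g" unfolding g_def t_def
    by (rule papprox_cmult[OF K papprox_diff[OF K papprox_diff[OF K papprox_ident papprox_const]
          papprox_mult[OF K papprox_diff[OF K papprox_ident papprox_const] s(1)]]])
  moreover have "cmod (g z) \<le> 2432 / d" if z: "z \<in> K" and near: "cmod (z - c) < 8 * d" for z
  proof -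
    have w: "cmod (z - m) \<le> 9 * d"
      using norm_triangle_ineq4[of "z - c" "m - c"] near mc d by simp
    have "(cmod (t z))\<^sup>2 = cmod ((z - m)\<^sup>2 - h\<^sup>2)" using t2[OF z] by (metis norm_power)
    also have "\<dots> \<le> (cmod (z - m))\<^sup>2 + (cmod h)\<^sup>2"
      by (metis norm_power norm_triangle_ineq4)
    also have "\<dots> \<le> (9 * d)\<^sup>2 + (3 * d / 8)\<^sup>2"
      by (intro add_mono power_mono w h2) auto
    also have "\<dots> \<le> (10 * d)\<^sup>2" by (simp add: power2_eq_square)
    finally have t: "cmod (t z) \<le> 10 * d" by (rule power2_le_imp_le) (use d in simp)
    have "cmod (g z) = 2 / (cmod h)\<^sup>2 * cmod ((z - m) - t z)"
      unfolding g_def norm_mult norm_divide norm_power by simp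
    \<comment> \<open>With \<open>d / 8\<close> below \<open>cmod h\<close> and the bounds
      \<open>9 * d\<close> and \<open>10 * d\<close> for the two terms, the constant is
      \<open>2 * 64 * 19 = 2432\<close>.\<close>
    also have "\<dots> \<le> 2 / (d/8)\<^sup>2 * (9 * d + 10 * d)"
    proof (rule mult_mono)
      show "2 / (cmod h)\<^sup>2 \<le> 2 / (d/8)\<^sup>2"
        using d power_mono[OF h1, of 2] by (intro frac_le) simp_all
      show "cmod ((z - m) - t z) \<le> 9 * d + 10 * d"
        using norm_triangle_ineq4[of "z - m" "t z"] w t by linarith
    qed simp_all
    also have "\<dots> = 2432 / d" using d by (simp add: power2_eq_square field_simps)
    finally show ?thesis .
  qed
  moreover have "cmod (g z - 1 / (z - c)) \<le> 2 * d / (cmod (z - c))\<^sup>2"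
    if z: "z \<in> K" and far: "8 * d \<le> cmod (z - c)" for z
  proof -
    define w where "w = z - m"
    define D where "D = cmod (z - c)"
    have D: "D \<ge> 8 * d" "D > 0" using far d by (auto simp: D_def)
    have wD: "cmod w \<ge> D / 2" and w7: "cmod w \<ge> 7 * d"
      using norm_triangle_ineq2[of "z - c" "m - c"] D mc d by (simp_all add: w_def D_def)
    have w0: "w \<noteq> 0" using w7 d by auto
    have zc0: "z - c \<noteq> 0" using D by (auto simp: D_def)
    have zp0: "z - p \<noteq> 0" using z W by auto
    define \<eta> where "\<eta> = - h / w"
    have eta: "cmod \<eta> \<le> 1/4"
    proof -
      have "cmod h \<le> cmod w / 4" using h2 w7 d by linarith
      then show ?thesis using w0 by (simp add: \<eta>_def norm_divide divide_simps)
    qed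
    have tw: "t z / w = s z * (1 + \<eta>)"
      using w0 by (simp add: t_def \<eta>_def w_def pm field_simps)
    have sre: "0 < Re (s z)" using s(3)[OF z] far d by auto
    have sim: "\<bar>Im (s z)\<bar> < Re (s z)"
    proof -
      have zp: "cmod (z - p) \<ge> 7 * d" 
        using norm_triangle_ineq2[of "z - c" "p - c"] far pc d by simp
      have "(s z)\<^sup>2 = 1 + 2 * h / (z - p)" using s(2)[OF z] zp0 by (simp add: pm qm field_simps)
      moreover have "cmod (2 * h / (z - p)) < 1"
      proof -
        have "cmod (2 * h) < cmod (z - p)" unfolding norm_mult using h2 zp d by simp
        then show ?thesis using zp0 by (simp only: norm_divide) (simp add: divide_less_eq)
      qed
      ultimately have "Re ((s z)\<^sup>2) > 0"
        using abs_Re_le_cmod[of "2 * h / (z - p)"] by auto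
      then have "(Im (s z))\<^sup>2 < (Re (s z))\<^sup>2" by (simp add: power2_eq_square)
      then show ?thesis using sre by (metis abs_le_square_iff abs_of_pos linorder_not_le)
    qed
    \<comment> \<open>Selects the branch: \<open>t z\<close> lies on the side of \<open>w\<close>
      and not of \<open>- w\<close>. Then \<open>w + t z\<close> is at least as long as
      \<open>w\<close>, and \<open>w - t z = h\<^sup>2 / (w + t z)\<close> is small.\<close>
    have "Re (t z / w) > 0"
    proof -
      have "\<bar>Re \<eta>\<bar> \<le> 1/4" "\<bar>Im \<eta>\<bar> \<le> 1/4"
        using eta abs_Re_le_cmod[of \<eta>] abs_Im_le_cmod[of \<eta>] by linarith+
      have "\<bar>Im (s z) * Im \<eta>\<bar> \<le> Re (s z) * (1/4)"
        unfolding abs_mult by (intro mult_mono) (use sim sre \<open>\<bar>Im \<eta>\<bar> \<le> 1/4\<close> in auto)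
      moreover have "Re (s z) * (1 + Re \<eta>) \<ge> Re (s z) * (3/4)"
        by (intro mult_left_mono) (use sre \<open>\<bar>Re \<eta>\<bar> \<le> 1/4\<close> in auto)
      moreover have "Re (t z / w) = Re (s z) * (1 + Re \<eta>) - Im (s z) * Im \<eta>" by (simp add: tw)
      ultimately show ?thesis using sre by linarith
    qed
    then have "1 \<le> cmod (1 + t z / w)"
      using complex_Re_le_cmod[of "1 + t z / w"] by simp
    then have "cmod w * 1 \<le> cmod w * cmod (1 + t z / w)"
      by (intro mult_left_mono) auto
    also have "\<dots> = cmod (w + t z)"
      using w0 by (simp add: norm_mult[symmetric] distrib_left)
    finally have wt: "cmod w \<le> cmod (w + t z)" by simp
    have prod: "(w - t z) * (w + t z) = h\<^sup>2"
      using t2[OF z] by (simp add: w_def power2_eq_square algebra_simps)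
    have wmt: "cmod (w - t z) \<le> (cmod h)\<^sup>2 / cmod w"
    proof -
      have "cmod (w - t z) * cmod w \<le> cmod (w - t z) * cmod (w + t z)"
        by (intro mult_left_mono wt) auto
      also have "\<dots> = (cmod h)\<^sup>2" by (metis prod norm_mult norm_power)
      finally show ?thesis using w0 by (simp add: field_simps)
    qed
    \<comment> \<open>Because \<open>h\<^sup>2 = (w - t z) * (w + t z)\<close>, removing the main
      term leaves the square of the small difference, hence an error of order
      \<open>h\<^sup>2 / w ^ 3\<close>.\<close>
    have "g z - 1 / w = (w - t z)\<^sup>2 / (w * h\<^sup>2)"
    proof -
      have "(g z - 1 / w) * (w * h\<^sup>2) = 2 * w * (w - t z) - h\<^sup>2"
      proof -
        have "g z * h\<^sup>2 = 2 * (w - t z)" using h0 by (simp add: g_def w_def)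
        then have "g z * h\<^sup>2 * w = 2 * w * (w - t z)" by simp
        moreover have "1 / w * (w * h\<^sup>2) = h\<^sup>2" using w0 by simp
        ultimately show ?thesis by (simp only: left_diff_distrib mult.commute[of w] mult.assoc[symmetric])
      qed
      also have "\<dots> = (w - t z)\<^sup>2" unfolding prod[symmetric] by (simp add: power2_eq_square algebra_simps)
      finally show ?thesis using w0 h0 by (simp add: eq_divide_eq)
    qed
    then have "cmod (g z - 1 / w) = (cmod (w - t z))\<^sup>2 / (cmod w * (cmod h)\<^sup>2)"
      by (simp add: norm_divide norm_mult norm_power)
    also have "\<dots> \<le> ((cmod h)\<^sup>2 / cmod w)\<^sup>2 / (cmod w * (cmod h)\<^sup>2)"
      by (intro divide_right_mono power_mono wmt) auto
    also have "\<dots> = (cmod h)\<^sup>2 / (cmod w) ^ 3"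
      using w0 h0 by (simp add: power2_eq_square power3_eq_cube)
    also have "\<dots> \<le> (3 * d / 8)\<^sup>2 / (D / 2) ^ 3"
      by (intro frac_le power_mono h2 wD) (use D in auto)
    also have "\<dots> = (9 / 8) * d * d / D / D\<^sup>2" by (simp add: power2_eq_square power3_eq_cube)
    also have "\<dots> \<le> (9/8) * d * (1/8) / D\<^sup>2"
    proof -
      have "d / D \<le> 1/8" using D by (simp add: field_simps)
      then have "(9/8) * d * (d / D) \<le> (9/8) * d * (1/8)" using d by (intro mult_left_mono) auto
      then show ?thesis by (intro divide_right_mono) auto
    qed
    also have "\<dots> \<le> d / D\<^sup>2" using d by (intro divide_right_mono) auto
    finally have A: "cmod (g z - 1 / w) \<le> d / D\<^sup>2" .
    \<comment> \<open>Moving the centre from the midpoint \<open>m\<close> to \<open>c\<close> costs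
      another term of order \<open>d / D\<^sup>2\<close>.\<close>
    have "1 / w - 1 / (z - c) = (m - c) / (w * (z - c))"
      using w0 zc0 by (simp add: w_def divide_simps)
    then have "cmod (1 / w - 1 / (z - c)) = cmod (m - c) / (cmod w * D)"
      by (simp add: norm_divide norm_mult D_def)
    also have "\<dots> \<le> (3 * d / 8) / (D / 2 * D)"
      by (intro frac_le mult_mono mc wD) (use D d in auto)
    also have "\<dots> \<le> d / D\<^sup>2" using d D by (simp add: power2_eq_square field_simps)
    finally have B: "cmod (1 / w - 1 / (z - c)) \<le> d / D\<^sup>2" .
    have "cmod (g z - 1 / (z - c)) \<le> d / D\<^sup>2 + d / D\<^sup>2"
      using norm_triangle_ineq[of "g z - 1 / w" "1 / w - 1 / (z - c)"] A B by simp
    then show ?thesis by (simp add: D_def)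
  qed
  ultimately show ?thesis by blast
qed

section \<open>Lavrentieff's theorem\<close>

text \<open>Every edge runs rightwards or upwards and the orientation sits in the signs. An edge
  shared by two squares then contributes literally the same term twice with opposite signs, and
  cancels whether or not the integrand is integrable on it.\<close>

definition rect_integral :: "(complex \<Rightarrow> complex) \<Rightarrow> complex \<Rightarrow> complex \<Rightarrow> complex" where
  "rect_integral f a b =
     contour_integral (linepath a (Complex (Re b) (Im a))) f
     + contour_integral (linepath (Complex (Re b) (Im a)) b) f
     - contour_integral (linepath (Complex (Re a) (Im b)) b) f
     - contour_integral (linepath a (Complex (Re a) (Im b))) f"

lemma path_image_rectpath_segments:
  "path_image (rectpath a b) =
     closed_segment a (Complex (Re b) (Im a)) \<union> closed_segment (Complex (Re b) (Im a)) b \<union>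
     closed_segment (Complex (Re a) (Im b)) b \<union> closed_segment a (Complex (Re a) (Im b))"
  by (auto simp: rectpath_def Let_def path_image_join closed_segment_commute)

lemma has_contour_integral_rectpath:
  assumes "continuous_on (path_image (rectpath a b)) f"
  shows "(f has_contour_integral rect_integral f a b) (rectpath a b)"
proof -
  define p where "p = Complex (Re b) (Im a)"
  define q where "q = Complex (Re a) (Im b)"
  have c: "continuous_on (closed_segment a p) f" "continuous_on (closed_segment p b) f"
      "continuous_on (closed_segment b q) f" "continuous_on (closed_segment q a) f"
    using assms unfolding path_image_rectpath_segments p_def q_def
    by (auto intro: continuous_on_subset simp: closed_segment_commute)
  have "(f has_contour_integral (contour_integral (linepath a p) f + (contour_integral (linepath p b) f +
      (contour_integral (linepath b q) f + contour_integral (linepath q a) f)))) (rectpath a b)"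
    unfolding rectpath_def Let_def p_def[symmetric] q_def[symmetric]
    by (intro has_contour_integral_join has_contour_integral_integral contour_integrable_continuous_linepath c) auto
  moreover have "contour_integral (linepath b q) f = - contour_integral (linepath q b) f"
    "contour_integral (linepath q a) f = - contour_integral (linepath a q) f"
    using contour_integral_reverse_linepath c(3,4) by blast+
  ultimately show ?thesis
    by (simp add: rect_integral_def p_def[symmetric] q_def[symmetric] algebra_simps)
qed

lemma contour_integral_linepath_bound:
  assumes "0 \<le> B" "\<And>x. x \<in> closed_segment a b \<Longrightarrow> cmod (f x) \<le> B"
  shows "cmod (contour_integral (linepath a b) f) \<le> B * cmod (b - a)"
proof (cases "f contour_integrable_on linepath a b")
  case True
  then show ?thesis using contour_integral_bound_linepath assms by blast
next
  case False
  then show ?thesis using assms(1) by (simp add: not_integrable_contour_integral)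
qed

text \<open>A non-integrable edge contributes the junk value 0, so the bound also covers squares whose
  boundary passes through a singularity of \<^term>\<open>f\<close>.\<close>

lemma rect_integral_bound:
  assumes "0 \<le> B" "\<And>x. x \<in> path_image (rectpath a b) \<Longrightarrow> cmod (f x) \<le> B"
    and ab: "Re b - Re a = d" "Im b - Im a = d" "0 \<le> d"
  shows "cmod (rect_integral f a b) \<le> B * (4 * d)"
proof -
  define p where "p = Complex (Re b) (Im a)"
  define q where "q = Complex (Re a) (Im b)"
  have n: "cmod (p - a) = d" "cmod (b - p) = d" "cmod (b - q) = d" "cmod (q - a) = d"
    using ab by (simp_all add: p_def q_def cmod_def)
  have i: "cmod (contour_integral (linepath a p) f) \<le> B * cmod (p - a)"
    "cmod (contour_integral (linepath p b) f) \<le> B * cmod (b - p)"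
    "cmod (contour_integral (linepath q b) f) \<le> B * cmod (b - q)"
    "cmod (contour_integral (linepath a q) f) \<le> B * cmod (q - a)"
    using assms(2) unfolding path_image_rectpath_segments p_def[symmetric] q_def[symmetric]
    by (auto intro!: contour_integral_linepath_bound assms(1))
  have "cmod (rect_integral f a b) \<le> cmod (contour_integral (linepath a p) f) + cmod (contour_integral (linepath p b) f)
     + cmod (contour_integral (linepath q b) f) + cmod (contour_integral (linepath a q) f)"
    unfolding rect_integral_def p_def[symmetric] q_def[symmetric]
    by (smt (verit) norm_triangle_ineq norm_triangle_ineq4)
  then show ?thesis using i unfolding n by (simp add: algebra_simps)
qed

text \<open>The integrand is affine along the segment, so its mean is its value at the
  midpoint.\<close>

lemma has_contour_integral_cnj_linepath:
  "(cnj has_contour_integral ((b - a) * cnj ((a + b) / 2))) (linepath a b)"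
proof -
  define F where "F = (\<lambda>x. (b - a) * (of_real x * cnj a + (of_real x)\<^sup>2 / 2 * cnj (b - a)))"
  have "((\<lambda>x. cnj (linepath a b x) * (b - a)) has_integral (F 1 - F 0)) {0..1}"
  proof (rule fundamental_theorem_of_calculus)
    fix x :: real
    show "(F has_vector_derivative cnj (linepath a b x) * (b - a)) (at x within {0..1})"
      unfolding F_def linepath_def
      by (rule has_vector_derivative_real_field derivative_eq_intros refl | simp)+
         (simp add: scaleR_conv_of_real algebra_simps)
  qed simp
  moreover have "F 1 - F 0 = (b - a) * cnj ((a + b) / 2)"
    by (simp add: F_def field_simps)
  ultimately show ?thesis by (simp add: has_contour_integral_linepath)
qed

text \<open>An instance of Green's formula; the area of a square becomes the weight of its
  pole.\<close>

lemma rect_integral_cnj: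
  assumes ab: "Re b - Re a = d" "Im b - Im a = d"
  shows "rect_integral cnj a b = 2 * \<i> * (of_real d)\<^sup>2"
proof -
  have b: "b = a + Complex d d" using ab by (simp add: complex_eq_iff)
  show ?thesis
    unfolding rect_integral_def contour_integral_unique[OF has_contour_integral_cnj_linepath]
    by (simp add: b complex_eq_iff power2_eq_square field_simps)
qed

lemma sum_contour_integral_linepath:
  assumes "continuous_on (closed_segment a (a + of_nat n * e)) f"
  shows "(\<Sum>j<n. contour_integral (linepath (a + of_nat j * e) (a + of_nat (Suc j) * e)) f)
           = contour_integral (linepath a (a + of_nat n * e)) f"
  using assms
proof (induction n)
  case (Suc n)
  define c where "c = a + of_nat n * e"
  define b where "b = a + of_nat (Suc n) * e"
  have k: "c - a = (real n / real (Suc n)) *\<^sub>R (b - a)"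
  proof -
    have "(of_nat (Suc n) :: complex) \<noteq> 0" by (rule of_nat_neq_0)
    then show ?thesis by (simp add: c_def b_def scaleR_conv_of_real del: of_nat_Suc)
  qed
  have "c \<in> closed_segment a b"
    unfolding in_segment using k
    by (intro exI[of _ "real n / real (Suc n)"]) (simp add: algebra_simps)
  then have "closed_segment a c \<subseteq> closed_segment a b" by (simp add: subset_closed_segment)
  then have IH: "(\<Sum>j<n. contour_integral (linepath (a + of_nat j * e) (a + of_nat (Suc j) * e)) f)
           = contour_integral (linepath a c) f"
    using Suc continuous_on_subset unfolding b_def c_def by blast
  have "contour_integral (linepath a b) f = contour_integral (linepath a c) f + contour_integral (linepath c b) f"
    by (rule contour_integral_split[OF _ _ _ k]) (use Suc in \<open>auto simp: b_def\<close>)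
  then show ?case using IH by (simp add: b_def c_def)
qed simp

text \<open>Inner edges cancel as formal terms, so continuity is asked on the outer boundary only
  and a singularity of \<open>f\<close> may lie on an inner edge.\<close>

lemma rect_integral_grid:
  fixes a :: complex and d :: real
  defines "v \<equiv> \<lambda>j k. a + Complex (real j * d) (real k * d)"
  assumes f: "continuous_on (path_image (rectpath a (v n n))) f"
  shows "(\<Sum>j<n. \<Sum>k<n. rect_integral f (v j k) (v (Suc j) (Suc k))) = rect_integral f a (v n n)"
proof -
  define H where "H j k = contour_integral (linepath (v j k) (v (Suc j) k)) f" for j k
  define V where "V j k = contour_integral (linepath (v j k) (v j (Suc k))) f" for j k
  have corner: "Complex (Re (v j k)) (Im (v j' k')) = v j k'" for j k j' k'
    by (simp add: v_def complex_eq_iff)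
  have v0: "v 0 0 = a" by (simp add: v_def complex_eq_iff)
  \<comment> \<open>Prepared for telescoping: the horizontal part in \<open>k\<close>, the vertical
    part in \<open>j\<close>.\<close>
  have R: "rect_integral f (v j k) (v (Suc j) (Suc k)) = (H j k - H j (Suc k)) + (V (Suc j) k - V j k)" for j k
    unfolding rect_integral_def corner H_def V_def by simp
  have "(\<Sum>j<n. \<Sum>k<n. rect_integral f (v j k) (v (Suc j) (Suc k)))
      = (\<Sum>j<n. \<Sum>k<n. H j k - H j (Suc k)) + (\<Sum>j<n. \<Sum>k<n. V (Suc j) k - V j k)"
    unfolding R by (simp add: sum.distrib)
  also have "(\<Sum>j<n. \<Sum>k<n. H j k - H j (Suc k)) = (\<Sum>j<n. H j 0 - H j n)"
    by (simp add: sum_lessThan_telescope')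
  also have "(\<Sum>j<n. \<Sum>k<n. V (Suc j) k - V j k) = (\<Sum>k<n. \<Sum>j<n. V (Suc j) k - V j k)"
    by (rule sum.swap)
  also have "\<dots> = (\<Sum>k<n. V n k - V 0 k)"
    by (intro sum.cong refl) (rule sum_lessThan_telescope[of "\<lambda>j. V j k" for k])
  finally have *: "(\<Sum>j<n. \<Sum>k<n. rect_integral f (v j k) (v (Suc j) (Suc k)))
      = (\<Sum>j<n. H j 0) - (\<Sum>j<n. H j n) + ((\<Sum>k<n. V n k) - (\<Sum>k<n. V 0 k))"
    by (simp add: sum_subtractf)
  have segs: "continuous_on (closed_segment (v 0 0) (v n 0)) f" "continuous_on (closed_segment (v n 0) (v n n)) f"
    "continuous_on (closed_segment (v 0 n) (v n n)) f" "continuous_on (closed_segment (v 0 0) (v 0 n)) f"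
    using f unfolding v0[symmetric] path_image_rectpath_segments corner
    by (auto intro: continuous_on_subset)
  have vh: "v j k = v 0 k + of_nat j * of_real d" for j k by (simp add: v_def complex_eq_iff)
  have vv: "v j k = v j 0 + of_nat k * (\<i> * of_real d)" for j k by (simp add: v_def complex_eq_iff)
  have Hs: "(\<Sum>j<n. H j k) = contour_integral (linepath (v 0 k) (v n k)) f"
    if "continuous_on (closed_segment (v 0 k) (v n k)) f" for k
    using sum_contour_integral_linepath[of "v 0 k" n "of_real d" f] that
    unfolding H_def vh[symmetric] by blast
  have Vs: "(\<Sum>k<n. V j k) = contour_integral (linepath (v j 0) (v j n)) f"
    if "continuous_on (closed_segment (v j 0) (v j n)) f" for j
    using sum_contour_integral_linepath[of "v j 0" n "\<i> * of_real d" f] that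
    unfolding V_def vv[symmetric] by blast
  show ?thesis
    unfolding * Hs[OF segs(1)] Hs[OF segs(3)] Vs[OF segs(2)] Vs[OF segs(4)]
    unfolding v0[symmetric] rect_integral_def corner by simp
qed

section \<open>Error estimates and their summation over the grid\<close>

lemma sum_inverse_Suc_le_ln: "n \<ge> 1 \<Longrightarrow> (\<Sum>k<n. 1 / real (Suc k)) \<le> 1 + ln (real n)"
proof (induction n rule: nat_induct_at_least)
  case (Suc n)
  have "ln (real n) - ln (real (Suc n)) \<le> (real n - real (Suc n)) / real (Suc n)"
    by (rule ln_diff_le) (use Suc in auto)
  then show ?case using Suc by simp
qed simp

text \<open>If \<open>x\<close> lies in cell \<open>i\<close>, the term of cell \<open>j\<close> is
  at most \<open>4 / (1 + |i - j|)\<close>, so each side of \<open>x\<close> contributes at most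
  four times a harmonic sum. The maximum with 1 tames the cells next to \<open>x\<close>.\<close>

lemma sum_inverse_dist_le:
  fixes x :: real
  assumes x: "0 \<le> x" "x < real n"
  shows "(\<Sum>j<n. 1 / max 1 \<bar>x - real j - 1/2\<bar>) \<le> 8 * (1 + ln (real n))"
proof -
  define i where "i = nat \<lfloor>x\<rfloor>"
  have i: "real i \<le> x" "x < real i + 1" and "i < n" using x unfolding i_def by linarith+
  define h where "h k = 4 / real (Suc k)" for k :: nat
  have h0: "h k \<ge> 0" for k by (simp add: h_def)
  have key: "1 / max 1 \<bar>x - real j - 1/2\<bar> \<le> h k" if "real k \<le> \<bar>real i - real j\<bar>" for j k :: nat
  proof -
    have k: "real k - 1 \<le> \<bar>x - real j - 1/2\<bar>" using that i by linarith
    define u where "u = max 1 \<bar>x - real j - 1/2\<bar>"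
    have u: "1 \<le> u" "\<bar>x - real j - 1/2\<bar> \<le> u" by (simp_all add: u_def)
    have "real (Suc k) \<le> 4 * u" using k u by linarith
    then show ?thesis using u(1) unfolding u_def[symmetric] by (simp add: h_def divide_simps)
  qed
  have "(\<Sum>j<n. 1 / max 1 \<bar>x - real j - 1/2\<bar>)
      \<le> (\<Sum>j<n. (if j \<le> i then h (i - j) else 0) + (if i \<le> j then h (j - i) else 0))"
  proof (rule sum_mono)
    fix j
    show "1 / max 1 \<bar>x - real j - 1/2\<bar> \<le> (if j \<le> i then h (i - j) else 0) + (if i \<le> j then h (j - i) else 0)"
    proof (cases "j \<le> i")
      case True
      then have "1 / max 1 \<bar>x - real j - 1/2\<bar> \<le> h (i - j)" by (intro key) auto
      then show ?thesis using True h0[of "j - i"] by auto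
    next
      case False
      then have "1 / max 1 \<bar>x - real j - 1/2\<bar> \<le> h (j - i)" by (intro key) auto
      then show ?thesis using False by auto
    qed
  qed
  also have "\<dots> = (\<Sum>j\<in>{..i}. h (i - j)) + (\<Sum>j\<in>{i..<n}. h (j - i))"
  proof -
    have "(\<Sum>j<n. if j \<le> i then h (i - j) else 0) = (\<Sum>j\<in>{..i}. h (i - j))"
      by (rule sum.mono_neutral_cong_right) (use \<open>i < n\<close> in auto)
    moreover have "(\<Sum>j<n. if i \<le> j then h (j - i) else 0) = (\<Sum>j\<in>{i..<n}. h (j - i))"
      by (rule sum.mono_neutral_cong_right) auto
    ultimately show ?thesis by (simp add: sum.distrib)
  qed
  also have "(\<Sum>j\<in>{..i}. h (i - j)) = (\<Sum>k\<in>{..i}. h k)"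
    by (rule sum.reindex_bij_witness[of _ "\<lambda>k. i - k" "\<lambda>k. i - k"]) auto
  also have "(\<Sum>j\<in>{i..<n}. h (j - i)) = (\<Sum>k<n - i. h k)"
    by (rule sum.reindex_bij_witness[of _ "\<lambda>k. k + i" "\<lambda>k. k - i"]) auto
  also have "(\<Sum>k\<in>{..i}. h k) + (\<Sum>k<n - i. h k) \<le> (\<Sum>k<n. h k) + (\<Sum>k<n. h k)"
    by (intro add_mono sum_mono2) (use \<open>i < n\<close> h0 in auto)
  also have "\<dots> = 8 * (\<Sum>k<n. 1 / real (Suc k))" by (simp add: h_def sum_distrib_left)
  also have "\<dots> \<le> 8 * (1 + ln (real n))"
    using sum_inverse_Suc_le_ln[of n] \<open>i < n\<close> by simp
  finally show ?thesis .
qed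

text \<open>Differentiation under the integral sign for a Cauchy integral. It is applied to the
  sides of the outer square, which stay away from \<open>K\<close>.\<close>

lemma holomorphic_contour_integral_linepath:
  assumes f: "continuous_on (closed_segment a b) f"
  shows "(\<lambda>z. contour_integral (linepath a b) (\<lambda>u. f u / (u - z))) holomorphic_on - closed_segment a b"
proof -
  have "(\<lambda>u. f u / (u - w) ^ 1) contour_integrable_on linepath a b" if "w \<in> - closed_segment a b" for w
    by (rule contour_integrable_continuous_linepath) (use that in \<open>auto intro!: continuous_intros f\<close>)
  then have *: "((\<lambda>u. f u / (u - w) ^ 1) has_contour_integral contour_integral (linepath a b) (\<lambda>u. f u / (u - w))) (linepath a b)"
    if "w \<in> UNIV - path_image (linepath a b)" for w
    using that has_contour_integral_integral by fastforce
  show ?thesis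
    unfolding holomorphic_on_open[OF open_Compl[OF closed_segment]]
  proof
    fix z assume "z \<in> - closed_segment a b"
    then have "z \<in> UNIV - path_image (linepath a b)" by simp
    from Cauchy_next_derivative(2)[where S = UNIV and k = 1 and B = "cmod (b - a)" and f' = f
        and \<gamma> = "linepath a b" and f = "\<lambda>z. contour_integral (linepath a b) (\<lambda>u. f u / (u - z))",
        OF _ _ * _ _ _ this]
    show "\<exists>D. ((\<lambda>z. contour_integral (linepath a b) (\<lambda>u. f u / (u - z))) has_field_derivative D) (at z)"
      using f by fastforce
  qed
qed

lemma rect_boundary_sup_norm:
  assumes "w \<in> path_image (rectpath (c - Complex r r) (c + Complex r r))" "0 \<le> r"
  shows "\<bar>Re w - Re c\<bar> \<le> r" "\<bar>Im w - Im c\<bar> \<le> r" "\<bar>Re w - Re c\<bar> = r \<or> \<bar>Im w - Im c\<bar> = r"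
  using assms by (auto simp: path_image_rectpath)

text \<open>Split \<open>cnj (w - z)\<close> as \<open>cnj (w - c) + cnj (c - z)\<close>. The second
  part over \<open>w - z\<close> is holomorphic on a disc containing the square and integrates to 0.
  In the first, replacing \<open>1 / (w - z)\<close> by \<open>1 / (c - z)\<close> yields the area
  term and leaves the remainder \<open>E\<close>, at most \<open>2 * d\<^sup>2 / D\<^sup>2\<close>
  on a boundary of length \<open>4 * d\<close>.\<close>

lemma square_integral_far:
  assumes d: "0 < d" and far: "8 * d \<le> cmod (z - c)"
  shows "cmod (rect_integral (\<lambda>w. cnj (w - z) / (w - z)) (c - Complex (d/2) (d/2)) (c + Complex (d/2) (d/2))
            + 2 * \<i> * (of_real d)\<^sup>2 * (1 / (z - c))) \<le> 8 * d ^ 3 / (cmod (z - c))\<^sup>2"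
proof -
  define a where "a = c - Complex (d/2) (d/2)"
  define b where "b = c + Complex (d/2) (d/2)"
  define D where "D = cmod (z - c)"
  have D: "D \<ge> 8 * d" "D > 0" using far d by (auto simp: D_def)
  let ?P = "path_image (rectpath a b)"
  have ab: "Re b - Re a = d" "Im b - Im a = d" by (auto simp: a_def b_def)
  have wc: "cmod (w - c) \<le> d" if "w \<in> ?P" for w
    using rect_boundary_sup_norm[of w c "d/2"] that d cmod_le[of "w - c"] by (simp add: a_def b_def)
  have wz: "cmod (w - z) \<ge> D / 2" "w \<noteq> z" if "w \<in> ?P" for w
  proof -
    show "cmod (w - z) \<ge> D / 2"
      using norm_triangle_ineq[of "z - w" "w - c"] wc[OF that] D d by (simp add: D_def norm_minus_commute)
    then show "w \<noteq> z" using D by auto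
  qed
  have zc: "z \<noteq> c" using D by (auto simp: D_def)
  define E where "E = (\<lambda>w. cnj (w - c) * (1 / (w - z) - 1 / (c - z)))"
  have E: "(E has_contour_integral rect_integral E a b) (rectpath a b)"
    unfolding E_def using wz zc
    by (intro has_contour_integral_rectpath continuous_intros) auto
  have "continuous_on ?P cnj" by (intro continuous_intros)
  from has_contour_integral_rectpath[OF this]
  have 1: "(cnj has_contour_integral 2 * \<i> * (of_real d)\<^sup>2) (rectpath a b)"
    unfolding rect_integral_cnj[OF ab] .
  have const: "((\<lambda>w. k) has_contour_integral 0) (rectpath a b)" for k
    by (rule Cauchy_theorem_convex_simple[where S = UNIV]) auto
  have inv: "((\<lambda>w. 1 / (w - z)) has_contour_integral 0) (rectpath a b)"
  proof (rule Cauchy_theorem_convex_simple[where S = "ball c D"])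
    show "(\<lambda>w. 1 / (w - z)) holomorphic_on ball c D"
      by (intro holomorphic_intros) (auto simp: D_def dist_norm norm_minus_commute)
    show "?P \<subseteq> ball c D"
      using wc d D by (force simp: dist_norm norm_minus_commute)
  qed auto
  have "((\<lambda>w. E w + (1 / (c - z)) * (cnj w - cnj c) + cnj (c - z) * (1 / (w - z)))
      has_contour_integral rect_integral E a b + (1 / (c - z)) * (2 * \<i> * (of_real d)\<^sup>2 - 0) + cnj (c - z) * 0) (rectpath a b)"
    by (intro has_contour_integral_add has_contour_integral_lmul has_contour_integral_diff E 1 const inv)
  moreover have "E w + (1 / (c - z)) * (cnj w - cnj c) + cnj (c - z) * (1 / (w - z)) = cnj (w - z) / (w - z)"
    if "w \<in> ?P" for w
  proof -
    have "E w = cnj (w - c) / (w - z) - (1 / (c - z)) * (cnj w - cnj c)"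
      by (simp add: E_def right_diff_distrib diff_divide_distrib)
    then have "E w + (1 / (c - z)) * (cnj w - cnj c) + cnj (c - z) * (1 / (w - z))
        = (cnj (w - c) + cnj (c - z)) / (w - z)"
      by (simp add: diff_divide_distrib)
    also have "cnj (w - c) + cnj (c - z) = cnj (w - z)" by simp
    finally show ?thesis .
  qed
  ultimately have "((\<lambda>w. cnj (w - z) / (w - z)) has_contour_integral
      (rect_integral E a b + (1 / (c - z)) * (2 * \<i> * (of_real d)\<^sup>2))) (rectpath a b)"
    by (auto intro: has_contour_integral_eq)
  moreover have "((\<lambda>w. cnj (w - z) / (w - z)) has_contour_integral rect_integral (\<lambda>w. cnj (w - z) / (w - z)) a b) (rectpath a b)"
    using wz by (intro has_contour_integral_rectpath continuous_intros) auto
  ultimately have "rect_integral (\<lambda>w. cnj (w - z) / (w - z)) a b = rect_integral E a b + (1 / (c - z)) * (2 * \<i> * (of_real d)\<^sup>2)"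
    using contour_integral_unique by metis
  moreover have "1 / (c - z) = - (1 / (z - c))"
    by (metis minus_diff_eq minus_divide_right)
  ultimately have eq: "rect_integral (\<lambda>w. cnj (w - z) / (w - z)) a b + 2 * \<i> * (of_real d)\<^sup>2 * (1 / (z - c)) = rect_integral E a b"
    by simp
  have "cmod (rect_integral E a b) \<le> (2 * d\<^sup>2 / D\<^sup>2) * (4 * d)"
  proof (rule rect_integral_bound[OF _ _ ab])
    fix w assume w: "w \<in> ?P"
    have "1 / (w - z) - 1 / (c - z) = (c - w) / ((w - z) * (c - z))"
      using wz(2)[OF w] zc by (simp add: divide_simps)
    then have "cmod (E w) = cmod (w - c) * (cmod (w - c) / (cmod (w - z) * D))"
      unfolding E_def norm_mult by (simp add: norm_divide norm_mult D_def norm_minus_commute flip: complex_cnj_diff)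
    also have "\<dots> \<le> d * (d / (D / 2 * D))"
      by (intro mult_mono frac_le wc wz w) (use d D in auto)
    also have "\<dots> = 2 * d\<^sup>2 / D\<^sup>2" by (simp add: power2_eq_square)
    finally show "cmod (E w) \<le> 2 * d\<^sup>2 / D\<^sup>2" .
  qed (use d in auto)
  also have "\<dots> = 8 * d ^ 3 / D\<^sup>2" by (simp add: power2_eq_square power3_eq_cube)
  finally show ?thesis unfolding eq[symmetric] unfolding a_def b_def D_def .
qed

text \<open>The decay in \<open>|z - c|\<close> is weakened to a factor in the real part times a
  factor in the imaginary part, so that the sum over the grid splits into two one-dimensional sums.
  This is where a squared logarithm enters.\<close>

lemma square_error_bound:
  assumes K: "compact K" and conn: "connected (- K)" and int: "interior K = {}" and d: "d > 0"
  shows "\<exists>g. papprox K g \<and> (\<forall>z\<in>K.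
     cmod (rect_integral (\<lambda>w. cnj (w - z) / (w - z)) (c - Complex (d/2) (d/2)) (c + Complex (d/2) (d/2))
            + 2 * \<i> * (of_real d)\<^sup>2 * g z)
       \<le> 400000 * d * (1 / max 1 \<bar>(Re z - Re c) / d\<bar> * (1 / max 1 \<bar>(Im z - Im c) / d\<bar>)))"
proof -
  obtain g where g: "papprox K g"
    "\<And>z. z \<in> K \<Longrightarrow> cmod (z - c) < 8 * d \<Longrightarrow> cmod (g z) \<le> 2432 / d"
    "\<And>z. z \<in> K \<Longrightarrow> 8 * d \<le> cmod (z - c) \<Longrightarrow> cmod (g z - 1 / (z - c)) \<le> 2 * d / (cmod (z - c))\<^sup>2"
    using exists_kernel[OF assms, of c] by blast
  have "cmod (rect_integral (\<lambda>w. cnj (w - z) / (w - z)) (c - Complex (d/2) (d/2)) (c + Complex (d/2) (d/2))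
            + 2 * \<i> * (of_real d)\<^sup>2 * g z)
       \<le> 400000 * d * (1 / max 1 \<bar>(Re z - Re c) / d\<bar> * (1 / max 1 \<bar>(Im z - Im c) / d\<bar>))" if z: "z \<in> K" for z
  proof -
    define J where "J = rect_integral (\<lambda>w. cnj (w - z) / (w - z)) (c - Complex (d/2) (d/2)) (c + Complex (d/2) (d/2))"
    define A where "A = max 1 \<bar>(Re z - Re c) / d\<bar>"
    define B where "B = max 1 \<bar>(Im z - Im c) / d\<bar>"
    have A1: "A \<ge> 1" and B1: "B \<ge> 1" by (auto simp: A_def B_def)
    have AB: "A * B > 0" using A1 B1 by simp
    have "cmod (J + 2 * \<i> * (of_real d)\<^sup>2 * g z) \<le> 400000 * d / (A * B)"
    proof (cases "cmod (z - c) < 8 * d")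
      case True
      have "\<bar>Re z - Re c\<bar> \<le> 8 * d" "\<bar>Im z - Im c\<bar> \<le> 8 * d"
        using True abs_Re_le_cmod[of "z - c"] abs_Im_le_cmod[of "z - c"] by auto
      \<comment> \<open>Near squares fix the constant: the integral gives at most
        \<open>4 * d\<close>, the kernel \<open>4864 * d\<close>, and \<open>A * B\<close> is at
        most 64; \<open>64 * 4868\<close> is below 400000.\<close>
      then have "A \<le> 8" "B \<le> 8" using d by (auto simp: A_def B_def abs_divide divide_le_eq)
      then have "A * B \<le> 8 * 8" using A1 B1 by (intro mult_mono) auto
      then have AB64: "400000 * d / 64 \<le> 400000 * d / (A * B)"
        using AB d by (intro divide_left_mono) auto
      have "cmod J \<le> 1 * (4 * d)" unfolding J_def
        by (rule rect_integral_bound)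
           (use d in \<open>auto simp: norm_divide divide_le_eq simp flip: complex_cnj_diff\<close>)
      moreover have "cmod (2 * \<i> * (of_real d)\<^sup>2 * g z) \<le> 2 * d\<^sup>2 * (2432 / d)"
        using mult_left_mono[OF g(2)[OF z True], of "2 * d\<^sup>2"] by (simp add: norm_mult norm_power)
      moreover have "2 * d\<^sup>2 * (2432 / d) = 4864 * d" using d by (simp add: power2_eq_square)
      ultimately have "cmod (J + 2 * \<i> * (of_real d)\<^sup>2 * g z) \<le> 4868 * d"
        using norm_triangle_ineq[of J "2 * \<i> * (of_real d)\<^sup>2 * g z"] by linarith
      then show ?thesis using AB64 d by linarith
    next
      case False
      then have far: "8 * d \<le> cmod (z - c)" by simp
      define D where "D = cmod (z - c)"
      have D: "D > 0" using far d unfolding D_def by linarith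
      have "cmod (J + 2 * \<i> * (of_real d)\<^sup>2 * (1 / (z - c))) \<le> 8 * d ^ 3 / D\<^sup>2"
        unfolding J_def D_def by (rule square_integral_far[OF d far])
      moreover have "cmod (2 * \<i> * (of_real d)\<^sup>2 * (g z - 1 / (z - c))) \<le> 2 * d\<^sup>2 * (2 * d / D\<^sup>2)"
        using mult_left_mono[OF g(3)[OF z far], of "2 * d\<^sup>2"] by (simp add: norm_mult norm_power D_def)
      moreover have "2 * d\<^sup>2 * (2 * d / D\<^sup>2) = 4 * d ^ 3 / D\<^sup>2" by (simp add: power2_eq_square power3_eq_cube)
      moreover have "J + 2 * \<i> * (of_real d)\<^sup>2 * g z = (J + 2 * \<i> * (of_real d)\<^sup>2 * (1 / (z - c)))
          + 2 * \<i> * (of_real d)\<^sup>2 * (g z - 1 / (z - c))" by (simp add: algebra_simps)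
      ultimately have "cmod (J + 2 * \<i> * (of_real d)\<^sup>2 * g z) \<le> 8 * d ^ 3 / D\<^sup>2 + 4 * d ^ 3 / D\<^sup>2"
        by (metis norm_triangle_le add_mono)
      also have "\<dots> = 12 * d * (d * d / (D * D))" by (simp add: power2_eq_square power3_eq_cube)
      also have "\<dots> \<le> 12 * d * (1 / (A * B))"
      proof (rule mult_left_mono)
        have 1: "A * B \<le> (D / d) * (D / d)"
        proof (intro mult_mono)
          have "1 \<le> D / d" using far d by (simp add: D_def)
          moreover have "\<bar>(Re z - Re c) / d\<bar> \<le> D / d" "\<bar>(Im z - Im c) / d\<bar> \<le> D / d"
            using abs_Re_le_cmod[of "z - c"] abs_Im_le_cmod[of "z - c"] d
            by (auto simp: D_def abs_divide divide_right_mono)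
          ultimately show "A \<le> D / d" "B \<le> D / d" by (auto simp: A_def B_def)
        qed (use A1 B1 D d in auto)
        have "1 / ((D / d) * (D / d)) \<le> 1 / (A * B)"
          by (rule divide_left_mono[OF 1]) (use AB D d in auto)
        then show "d * d / (D * D) \<le> 1 / (A * B)" by simp
      qed (use d in auto)
      also have "\<dots> \<le> 400000 * d * (1 / (A * B))"
        using d AB by (intro mult_right_mono) auto
      finally show ?thesis by simp
    qed
    then show ?thesis by (simp add: J_def A_def B_def)
  qed
  then show ?thesis using g(1) by blast
qed

theorem lavrentieff_papprox_cnj:
  assumes "lavrentieff K"
  shows "papprox K cnj"
proof (rule papprox_limit)
  fix e :: real assume e: "e > 0"
  have K: "compact K" and conn: "connected (- K)" and int: "interior K = {}"
    using assms by (auto simp: lavrentieff_def)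
  obtain M where M: "M > 0" "\<And>z. z \<in> K \<Longrightarrow> cmod z \<le> M"
    using compact_imp_bounded[OF K] by (auto simp: bounded_pos)
  \<comment> \<open>\<open>K\<close> lies in the disc of radius \<open>L / 2\<close>, while the
    boundary of the large square has distance at least \<open>L\<close> from 0.\<close>
  define L where "L = 2 * M"
  have L: "L > 0" using M by (simp add: L_def)
  \<comment> \<open>The total error for \<open>n\<close> squares per side; one logarithm comes from
    each of the two harmonic sums.\<close>
  have "(\<lambda>n. 400000 * (2 * L / real n) * (8 * (1 + ln (real n)))\<^sup>2) \<longlonglongrightarrow> 0"
  proof -
    have "(\<lambda>n. (1 + ln (real n))\<^sup>2 / real n) \<longlonglongrightarrow> 0" by real_asymp
    from tendsto_mult_right_zero[OF this, of "400000 * (2 * L) * 64"]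
    moreover have "400000 * (2 * L / real n) * (8 * u)\<^sup>2 = 400000 * (2 * L) * 64 * (u\<^sup>2 / real n)" for n u
      by (simp add: power2_eq_square)
    ultimately show ?thesis by (simp only:)
  qed
  then have "\<forall>\<^sub>F n in sequentially. 400000 * (2 * L / real n) * (8 * (1 + ln (real n)))\<^sup>2 < e"
    using e by (rule order_tendstoD)
  then have "\<forall>\<^sub>F n in sequentially. n > 0 \<and> 400000 * (2 * L / real n) * (8 * (1 + ln (real n)))\<^sup>2 < e"
    using eventually_gt_at_top[of 0] by eventually_elim auto
  then obtain n where n: "n > 0" and ne: "400000 * (2 * L / real n) * (8 * (1 + ln (real n)))\<^sup>2 < e"
    using eventually_happens'[OF sequentially_bot] by blast
  define d where "d = 2 * L / real n"
  have d: "d > 0" using L n by (simp add: d_def)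
  have nd: "real n * d = 2 * L" using n by (simp add: d_def)
  define a where "a = Complex (- L) (- L)"
  define b where "b = Complex L L"
  define v where "v j k = a + Complex (real j * d) (real k * d)" for j k
  define c where "c j k = v j k + Complex (d/2) (d/2)" for j k
  have vn: "v n n = b" by (simp add: v_def a_def b_def nd complex_eq_iff)
  have sq: "c j k - Complex (d/2) (d/2) = v j k" "c j k + Complex (d/2) (d/2) = v (Suc j) (Suc k)" for j k
    by (simp_all add: c_def v_def complex_eq_iff algebra_simps)
  define J where "J z j k = rect_integral (\<lambda>w. cnj (w - z) / (w - z)) (v j k) (v (Suc j) (Suc k))" for z j k
  have "\<exists>g. papprox K g \<and> (\<forall>z\<in>K. cmod (J z j k + 2 * \<i> * (of_real d)\<^sup>2 * g z)
       \<le> 400000 * d * (1 / max 1 \<bar>(Re z - Re (c j k)) / d\<bar> * (1 / max 1 \<bar>(Im z - Im (c j k)) / d\<bar>)))" for j k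
    using square_error_bound[OF K conn int d, of "c j k"] unfolding sq J_def .
  then obtain g where g: "\<And>j k. papprox K (g j k)" and gJ: "\<And>j k z. z \<in> K \<Longrightarrow>
      cmod (J z j k + 2 * \<i> * (of_real d)\<^sup>2 * g j k z)
       \<le> 400000 * d * (1 / max 1 \<bar>(Re z - Re (c j k)) / d\<bar> * (1 / max 1 \<bar>(Im z - Im (c j k)) / d\<bar>))"
    by metis
  \<comment> \<open>The holomorphic term: its singularities lie on the outer boundary, so its Taylor
    series at 0 converges uniformly on \<open>K\<close>.\<close>
  define \<Phi> where "\<Phi> z = rect_integral (\<lambda>w. cnj w / (w - z)) a b" for z
  have bd: "w \<in> path_image (rectpath a b) \<Longrightarrow> cmod w \<ge> L" for w
    using rect_boundary_sup_norm(3)[of w 0 L] L abs_Re_le_cmod[of w] abs_Im_le_cmod[of w]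
    by (auto simp: a_def b_def minus_complex.ctr)
  have zL: "cmod z \<le> L / 2" if "z \<in> K" for z using M(2)[OF that] by (simp add: L_def)
  have znot: "w \<noteq> z" if "z \<in> K" "w \<in> path_image (rectpath a b)" for w z
    using bd[OF that(2)] zL[OF that(1)] L by auto
  have "\<Phi> holomorphic_on ball 0 L"
  proof -
    have seg: "ball 0 L \<subseteq> - closed_segment p q"
      if "closed_segment p q \<subseteq> path_image (rectpath a b)" for p q
      using that bd by force
    show ?thesis unfolding \<Phi>_def rect_integral_def
      by (intro holomorphic_on_add holomorphic_on_diff
            holomorphic_on_subset[OF holomorphic_contour_integral_linepath seg] continuous_intros)
         (auto simp: path_image_rectpath_segments)
  qed
  then have \<Phi>: "papprox K \<Phi>"
    using papprox_compose_holomorphic[OF K papprox_ident _ _ zL] L by auto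
  \<comment> \<open>The integrand is \<open>cnj w / (w - z)\<close> minus
    \<open>cnj z / (w - z)\<close>, and over the outer boundary, which winds once around
    \<open>z\<close>, the latter integrates to \<open>2 * pi * \<i> * cnj z\<close>.\<close>
  have ident: "(\<Sum>j<n. \<Sum>k<n. J z j k) = \<Phi> z - 2 * pi * \<i> * cnj z" if z: "z \<in> K" for z
  proof -
    have "continuous_on (path_image (rectpath a (v n n))) (\<lambda>w. cnj (w - z) / (w - z))"
      unfolding vn using znot[OF z] by (intro continuous_intros) auto
    from rect_integral_grid[OF this[unfolded v_def], folded v_def]
    have 1: "(\<Sum>j<n. \<Sum>k<n. J z j k) = rect_integral (\<lambda>w. cnj (w - z) / (w - z)) a b"
      unfolding J_def vn .
    have 2: "((\<lambda>w. cnj (w - z) / (w - z)) has_contour_integral rect_integral (\<lambda>w. cnj (w - z) / (w - z)) a b) (rectpath a b)"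
      using znot[OF z] by (intro has_contour_integral_rectpath continuous_intros) auto
    have 3: "((\<lambda>w. cnj w / (w - z)) has_contour_integral \<Phi> z) (rectpath a b)"
      unfolding \<Phi>_def using znot[OF z] by (intro has_contour_integral_rectpath continuous_intros) auto
    have "z \<in> box a b"
      using zL[OF z] L abs_Re_le_cmod[of z] abs_Im_le_cmod[of z] by (auto simp: a_def b_def in_box_complex_iff)
    then have "winding_number (rectpath a b) z = 1" by (rule winding_number_rectpath)
    then have 4: "((\<lambda>w. 1 / (w - z)) has_contour_integral (2 * pi * \<i>)) (rectpath a b)"
      using has_contour_integral_winding_number[of "rectpath a b" z] znot[OF z] by auto
    have "((\<lambda>w. cnj w / (w - z) - cnj z * (1 / (w - z))) has_contour_integral (\<Phi> z - cnj z * (2 * pi * \<i>))) (rectpath a b)"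
      by (intro has_contour_integral_diff has_contour_integral_lmul 3 4)
    then have "((\<lambda>w. cnj (w - z) / (w - z)) has_contour_integral (\<Phi> z - cnj z * (2 * pi * \<i>))) (rectpath a b)"
      by (simp add: diff_divide_distrib)
    then show ?thesis using 1 2 contour_integral_unique by (metis mult.commute)
  qed
  define \<Psi> where "\<Psi> z = \<Phi> z + (\<Sum>j<n. \<Sum>k<n. (2 * \<i> * (of_real d)\<^sup>2) * g j k z)" for z
  have \<Psi>: "papprox K (\<lambda>z. (1 / (2 * pi * \<i>)) * \<Psi> z)"
    unfolding \<Psi>_def
    by (intro papprox_cmult[OF K] papprox_add[OF \<Phi>] papprox_sum g)
  show "\<exists>f. papprox K f \<and> (\<forall>z\<in>K. cmod (cnj z - f z) < e)"
  proof (intro exI[of _ "\<lambda>z. (1 / (2 * pi * \<i>)) * \<Psi> z"] conjI ballI \<Psi>)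
    fix z assume z: "z \<in> K"
    have "\<Psi> z - 2 * pi * \<i> * cnj z = (\<Sum>j<n. \<Sum>k<n. J z j k + (2 * \<i> * (of_real d)\<^sup>2) * g j k z)"
      unfolding \<Psi>_def sum.distrib ident[OF z] by simp
    then have "cmod (\<Psi> z - 2 * pi * \<i> * cnj z)
        \<le> (\<Sum>j<n. \<Sum>k<n. cmod (J z j k + (2 * \<i> * (of_real d)\<^sup>2) * g j k z))"
      by (simp only:) (intro order_trans[OF norm_sum] sum_mono norm_sum)
    also have "\<dots> \<le> (\<Sum>j<n. \<Sum>k<n. 400000 * d * (1 / max 1 \<bar>(Re z + L) / d - real j - 1/2\<bar>
        * (1 / max 1 \<bar>(Im z + L) / d - real k - 1/2\<bar>)))"
    proof (intro sum_mono)
      fix j k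
      \<comment> \<open>The 1/2 is the offset of a centre from the lower left corner of its
        cell.\<close>
      have "(Re z - Re (c j k)) / d = (Re z + L) / d - real j - 1/2"
        "(Im z - Im (c j k)) / d = (Im z + L) / d - real k - 1/2"
        using d by (simp_all add: c_def v_def a_def field_simps)
      then show "cmod (J z j k + (2 * \<i> * (of_real d)\<^sup>2) * g j k z) \<le> 400000 * d * (1 / max 1 \<bar>(Re z + L) / d - real j - 1/2\<bar>
        * (1 / max 1 \<bar>(Im z + L) / d - real k - 1/2\<bar>))"
        using gJ[OF z, of j k] by simp
    qed
    also have "\<dots> = 400000 * d * ((\<Sum>j<n. 1 / max 1 \<bar>(Re z + L) / d - real j - 1/2\<bar>)
        * (\<Sum>k<n. 1 / max 1 \<bar>(Im z + L) / d - real k - 1/2\<bar>))"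
      unfolding sum_product by (simp only: sum_distrib_left)
    also have "\<dots> \<le> 400000 * d * ((8 * (1 + ln (real n))) * (8 * (1 + ln (real n))))"
    proof (intro mult_left_mono mult_mono)
      have bnd: "0 \<le> (x + L) / d \<and> (x + L) / d < real n" if "\<bar>x\<bar> \<le> cmod z" for x
      proof -
        have "\<bar>x\<bar> \<le> L / 2" using that zL[OF z] by simp
        then have "0 \<le> x + L" "x + L < real n * d" using L unfolding nd by auto
        then show ?thesis using d by (simp add: pos_divide_less_eq)
      qed
      show "(\<Sum>j<n. 1 / max 1 \<bar>(Re z + L) / d - real j - 1/2\<bar>) \<le> 8 * (1 + ln (real n))"
        using sum_inverse_dist_le bnd[OF abs_Re_le_cmod] by blast
      show "(\<Sum>j<n. 1 / max 1 \<bar>(Im z + L) / d - real j - 1/2\<bar>) \<le> 8 * (1 + ln (real n))"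
        using sum_inverse_dist_le bnd[OF abs_Im_le_cmod] by blast
    qed (use d n in \<open>auto intro!: sum_nonneg\<close>)
    also have "\<dots> < e" using ne by (simp add: d_def power2_eq_square)
    finally have "cmod (\<Psi> z - 2 * pi * \<i> * cnj z) < e" .
    moreover have "cnj z - (1 / (2 * pi * \<i>)) * \<Psi> z = - (1 / (2 * pi * \<i>)) * (\<Psi> z - 2 * pi * \<i> * cnj z)"
      by (simp add: field_simps)
    then have "cmod (cnj z - (1 / (2 * pi * \<i>)) * \<Psi> z) = (1 / (2 * pi)) * cmod (\<Psi> z - 2 * pi * \<i> * cnj z)"
      by (simp only: norm_mult norm_minus_cancel norm_divide) simp
    moreover have "1 / (2 * pi) \<le> 1" using pi_gt3 by simp
    ultimately show "cmod (cnj z - (1 / (2 * pi * \<i>)) * \<Psi> z) < e"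
      by (smt (verit) mult_left_le_one_le norm_ge_zero divide_nonneg_nonneg pi_ge_zero)
  qed
qed

section \<open>Bounded operators on a complex Hilbert space\<close>

instance chilbert_space \<subseteq> banach ..

section \<open>Inner products and bounded operators\<close>

lemma scaleC_zero_left [simp]: "0 *\<^sub>C (x :: 'a::complex_vector) = 0"
  using scaleR_scaleC[of 0] by (metis of_real_0 scaleR_zero_left)

lemma scaleC_zero_right [simp]: "c *\<^sub>C (0 :: 'a::complex_vector) = 0"
  using scaleC_add_right[of c 0 0] by simp

lemma scaleC_minus_left [simp]: "(- c) *\<^sub>C (x :: 'a::complex_vector) = - (c *\<^sub>C x)"
  using scaleC_add_left[of c "- c" x] by (simp add: eq_neg_iff_add_eq_0 add.commute)

lemma scaleC_minus_right [simp]: "c *\<^sub>C (- x :: 'a::complex_vector) = - (c *\<^sub>C x)"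
  using scaleC_add_right[of c x "- x"] by (simp add: eq_neg_iff_add_eq_0 add.commute)

lemma scaleC_diff_left: "(a - b) *\<^sub>C (x :: 'a::complex_vector) = a *\<^sub>C x - b *\<^sub>C x"
  using scaleC_add_left[of a "- b" x] by simp

lemma scaleC_diff_right: "c *\<^sub>C (x - y :: 'a::complex_vector) = c *\<^sub>C x - c *\<^sub>C y"
  using scaleC_add_right[of c x "- y"] by simp

lemmas scaleC_simps = scaleC_add_left scaleC_add_right scaleC_diff_left scaleC_diff_right scaleC_scaleC

lemma scaleC_scaleR_commute: "c *\<^sub>C (r *\<^sub>R x) = r *\<^sub>R (c *\<^sub>C (x :: 'a::complex_vector))"
  by (simp add: scaleR_scaleC scaleC_scaleC mult.commute)

lemma bounded_bilinear_scaleC: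
  "bounded_bilinear (scaleC :: complex \<Rightarrow> 'a \<Rightarrow> 'a::complex_normed_vector)"
proof
  show "\<exists>K. \<forall>a (b :: 'a). norm (a *\<^sub>C b) \<le> norm a * norm b * K"
    by (intro exI[of _ 1]) (simp add: norm_scaleC)
  show "(r *\<^sub>R a) *\<^sub>C b = r *\<^sub>R (a *\<^sub>C b)" for r a and b :: 'a
    by (simp add: scaleR_scaleC scaleC_scaleC scaleR_conv_of_real)
qed (simp_all add: scaleC_simps scaleC_scaleR_commute)

lemmas tendsto_scaleC = bounded_bilinear.tendsto[OF bounded_bilinear_scaleC]

lemma cinner_add_right: "cinner (x :: 'a::complex_inner) (y + z) = cinner x y + cinner x z"
  by (metis cinner_add_left cinner_commute complex_cnj_add)

lemma cinner_scaleC_right: "cinner (x :: 'a::complex_inner) (a *\<^sub>C y) = a * cinner x y"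
proof -
  have "cinner x (a *\<^sub>C y) = cnj (cnj a * cinner y x)"
    by (metis cinner_commute cinner_scaleC_left)
  then show ?thesis by (simp add: cinner_commute[of x y])
qed

lemma cinner_scaleR_left: "cinner (r *\<^sub>R (x :: 'a::complex_inner)) y = of_real r * cinner x y"
  by (simp add: scaleR_scaleC cinner_scaleC_left)

lemma cinner_scaleR_right: "cinner (x :: 'a::complex_inner) (r *\<^sub>R y) = of_real r * cinner x y"
  by (simp add: scaleR_scaleC cinner_scaleC_right)

lemma cinner_minus_left [simp]: "cinner (- (x :: 'a::complex_inner)) y = - cinner x y"
  using cinner_scaleR_left[of "-1" x y] by simp

lemma cinner_minus_right [simp]: "cinner (x :: 'a::complex_inner) (- y) = - cinner x y"
  using cinner_scaleR_right[of x "-1" y] by simp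

lemma cinner_zero_left [simp]: "cinner (0 :: 'a::complex_inner) y = 0"
  using cinner_scaleR_left[of 0 0 y] by simp

lemma cinner_zero_right [simp]: "cinner (x :: 'a::complex_inner) 0 = 0"
  using cinner_scaleR_right[of x 0 0] by simp

lemma cinner_diff_left: "cinner (x - y :: 'a::complex_inner) z = cinner x z - cinner y z"
  using cinner_add_left[of x "- y" z] by simp

lemma cinner_diff_right: "cinner (x :: 'a::complex_inner) (y - z) = cinner x y - cinner x z"
  using cinner_add_right[of x y "- z"] by simp

lemmas cinner_simps = cinner_add_left cinner_add_right cinner_diff_left cinner_diff_right
  cinner_scaleC_left cinner_scaleC_right

lemma cinner_self: "cinner x x = of_real ((norm (x :: 'a::complex_inner))\<^sup>2)"
  using cinner_self_real_nonneg[of x] by (simp add: norm_eq_sqrt_cinner complex_eq_iff)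

lemma norm_add_sq:
  "(norm (x + y :: 'a::complex_inner))\<^sup>2 = (norm x)\<^sup>2 + 2 * Re (cinner x y) + (norm y)\<^sup>2"
proof -
  have "cinner (x + y) (x + y) = cinner x x + cinner x y + cnj (cinner x y) + cinner y y"
    by (simp add: cinner_add_left cinner_add_right cinner_commute[of y x])
  then have "Re (cinner (x + y) (x + y)) = Re (cinner x x + cinner x y + cnj (cinner x y) + cinner y y)"
    by simp
  then show ?thesis unfolding cinner_self by simp
qed

lemma norm_diff_sq:
  "(norm (x - y :: 'a::complex_inner))\<^sup>2 = (norm x)\<^sup>2 - 2 * Re (cinner x y) + (norm y)\<^sup>2"
  using norm_add_sq[of x "- y"] by simp

lemma norm_add_sq_orthogonal:
  "cinner x y = 0 \<Longrightarrow> (norm (x + y :: 'a::complex_inner))\<^sup>2 = (norm x)\<^sup>2 + (norm y)\<^sup>2"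
  by (simp add: norm_add_sq)

text \<open>Cauchy-Schwarz, from the squared length of \<open>x\<close> minus its projection along
  \<open>y\<close>, all multiplied by \<open>n = (norm y)\<^sup>2\<close> to avoid a
  division.\<close>

lemma cmod_cinner_le: "cmod (cinner x y) \<le> norm (x :: 'a::complex_inner) * norm y"
proof (cases "y = 0")
  case False
  define n where "n = (norm y)\<^sup>2"
  define c where "c = cinner y x"
  have n: "n > 0" using False by (simp add: n_def)
  have "cinner (n *\<^sub>R x) (c *\<^sub>C y) = of_real (n * (cmod c)\<^sup>2)"
    unfolding cinner_scaleR_left cinner_scaleC_right
    by (simp add: c_def cinner_commute[of x y] complex_norm_square mult.assoc del: of_real_power)
  then have "(norm (n *\<^sub>R x - c *\<^sub>C y))\<^sup>2 = n\<^sup>2 * (norm x)\<^sup>2 - 2 * (n * (cmod c)\<^sup>2) + (cmod c)\<^sup>2 * n"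
    unfolding norm_diff_sq by (simp add: norm_scaleC power_mult_distrib n_def)
  then have "0 \<le> n\<^sup>2 * (norm x)\<^sup>2 - n * (cmod c)\<^sup>2"
    using zero_le_power2[of "norm (n *\<^sub>R x - c *\<^sub>C y)"] by simp
  also have "\<dots> = n * ((norm x)\<^sup>2 * n - (cmod c)\<^sup>2)" by (simp add: power2_eq_square algebra_simps)
  finally have "(cmod c)\<^sup>2 \<le> (norm x)\<^sup>2 * n" using n by (simp add: zero_le_mult_iff)
  then have "(cmod c)\<^sup>2 \<le> (norm x * norm y)\<^sup>2" by (simp add: n_def power_mult_distrib)
  then have "cmod c \<le> norm x * norm y" by (rule power2_le_imp_le) simp
  then show ?thesis unfolding c_def by (metis cinner_commute complex_mod_cnj)
qed simp

lemma bounded_bilinear_cinner: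
  "bounded_bilinear (cinner :: 'a::complex_inner \<Rightarrow> 'a \<Rightarrow> complex)"
proof
  show "\<exists>K. \<forall>(a :: 'a) b. norm (cinner a b) \<le> norm a * norm b * K"
    by (intro exI[of _ 1]) (simp add: cmod_cinner_le)
qed (simp_all add: cinner_simps cinner_scaleR_left cinner_scaleR_right scaleR_conv_of_real)

lemmas tendsto_cinner = bounded_bilinear.tendsto[OF bounded_bilinear_cinner]

lemma cinner_eqI: "(\<And>x. cinner x y = cinner x z) \<Longrightarrow> y = (z :: 'a::complex_inner)"
  using cinner_eq_zero_iff[of "y - z"] by (simp add: cinner_diff_right)

text \<open>First-order condition at a minimum. At \<open>t = - b / (a + 1)\<close> the right-hand
  side is \<open>- (b / (a + 1))\<^sup>2\<close>; the added 1 covers \<open>a = 0\<close>.\<close>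

lemma linear_term_zero:
  fixes a b :: real
  assumes "\<And>t. 0 \<le> t * b + t\<^sup>2 * a" and "a \<ge> 0"
  shows "b = 0"
proof (rule ccontr)
  assume "b \<noteq> 0"
  have "(- b / (a + 1)) * b + (- b / (a + 1))\<^sup>2 * a = - (b / (a + 1))\<^sup>2"
    using \<open>a \<ge> 0\<close> by (simp add: power2_eq_square divide_simps) (simp add: algebra_simps)
  moreover have "(b / (a + 1))\<^sup>2 > 0" using \<open>b \<noteq> 0\<close> \<open>a \<ge> 0\<close> by simp
  ultimately show False using assms(1)[of "- b / (a + 1)"] by linarith
qed

lemma bounded_clinearI:
  assumes "\<And>x y. f (x + y) = f x + f y" "\<And>c x. f (c *\<^sub>C x) = c *\<^sub>C f x"
    "\<And>x. norm (f x) \<le> K * norm x"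
  shows "bounded_clinear f"
  unfolding bounded_clinear_def using assms by (metis mult.commute)

lemma bounded_clinear_bounded_linear: "bounded_clinear f \<Longrightarrow> bounded_linear f"
  unfolding bounded_clinear_def
  by (auto intro!: bounded_linear_intro simp: scaleR_scaleC)

lemma bounded_clinear_add: "bounded_clinear f \<Longrightarrow> f (x + y) = f x + f y"
  and bounded_clinear_scaleC: "bounded_clinear f \<Longrightarrow> f (c *\<^sub>C x) = c *\<^sub>C f x"
  by (simp_all add: bounded_clinear_def)

lemma bounded_clinear_zero: "bounded_clinear f \<Longrightarrow> f 0 = 0"
  using bounded_clinear_scaleC[of f 0 0] by simp

lemma bounded_clinear_diff: "bounded_clinear f \<Longrightarrow> f (x - y) = f x - f y"
  using bounded_clinear_bounded_linear bounded_linear.linear linear_diff by blast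

lemma bounded_clinear_bound:
  assumes "bounded_clinear f"
  shows "\<exists>K>0. \<forall>x. norm (f x) \<le> K * norm x"
  using bounded_linear.pos_bounded[OF bounded_clinear_bounded_linear[OF assms]]
  by (metis mult.commute)

lemma norm_le_onorm: "bounded_clinear f \<Longrightarrow> norm (f x) \<le> onorm f * norm x"
  by (rule onorm[OF bounded_clinear_bounded_linear])

lemma bounded_clinear_id: "bounded_clinear (\<lambda>x. x)"
  by (rule bounded_clinearI[where K = 1]) auto

lemma bounded_clinear_const_zero: "bounded_clinear (\<lambda>x. 0)"
  by (rule bounded_clinearI[where K = 1]) auto

lemma bounded_clinear_compose:
  assumes f: "bounded_clinear f" and g: "bounded_clinear g"
  shows "bounded_clinear (\<lambda>x. f (g x))"
proof -
  obtain K L where K: "K > 0" "\<And>x. norm (f x) \<le> K * norm x" and L: "\<And>x. norm (g x) \<le> L * norm x"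
    using bounded_clinear_bound f g by meson
  have "norm (f (g x)) \<le> (K * L) * norm x" for x
    unfolding mult.assoc using K(2)[of "g x"] mult_left_mono[OF L[of x], of K] K(1) by linarith
  then show ?thesis
    using f g by (intro bounded_clinearI) (auto simp: bounded_clinear_add bounded_clinear_scaleC)
qed

lemma bounded_clinear_plus:
  assumes f: "bounded_clinear f" and g: "bounded_clinear g"
  shows "bounded_clinear (\<lambda>x. f x + g x)"
proof -
  obtain K L where K: "\<And>x. norm (f x) \<le> K * norm x" and L: "\<And>x. norm (g x) \<le> L * norm x"
    using bounded_clinear_bound f g by meson
  have "norm (f x + g x) \<le> (K + L) * norm x" for x
    using norm_triangle_ineq[of "f x" "g x"] K[of x] L[of x] by (simp add: distrib_right)
  then show ?thesis
    using f g by (intro bounded_clinearI) (auto simp: bounded_clinear_add bounded_clinear_scaleC scaleC_simps)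
qed

lemma bounded_clinear_scaled:
  assumes "bounded_clinear f"
  shows "bounded_clinear (\<lambda>x. a *\<^sub>C f x)"
proof -
  obtain K where "\<And>x. norm (f x) \<le> K * norm x" using bounded_clinear_bound[OF assms] by blast
  then have "norm (a *\<^sub>C f x) \<le> (cmod a * K) * norm x" for x
    by (simp add: norm_scaleC mult.assoc mult_left_mono)
  then show ?thesis
    using assms by (intro bounded_clinearI[where K = "cmod a * K"])
      (auto simp: bounded_clinear_add bounded_clinear_scaleC scaleC_simps mult.commute)
qed

lemma bounded_clinear_minus:
  assumes "bounded_clinear f" "bounded_clinear g"
  shows "bounded_clinear (\<lambda>x. f x - g x)"
  using bounded_clinear_plus[OF assms(1) bounded_clinear_scaled[OF assms(2), of "-1"]]
  by (simp add: scaleC_one)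

section \<open>The Riesz theorem and adjoints\<close>

text \<open>If \<open>y\<close> represents \<open>f\<close>, then \<open>\<phi> x\<close> is
  \<open>(norm (x - y))\<^sup>2 - (norm y)\<^sup>2\<close>, so \<open>y\<close> has to minimise
  \<open>\<phi>\<close>. Minimising sequences are Cauchy by the parallelogram identity, and the
  first variation at the limit identifies the real parts; applying this to
  \<open>\<i> *\<^sub>C x\<close> gives the imaginary parts.\<close>

lemma riesz_representation:
  fixes f :: "'a::chilbert_space \<Rightarrow> complex"
  assumes add: "\<And>x y. f (x + y) = f x + f y" and scale: "\<And>c x. f (c *\<^sub>C x) = c * f x"
    and bound: "\<And>x. cmod (f x) \<le> K * norm x"
  shows "\<exists>y. \<forall>x. f x = cinner y x"
proof -
  define \<phi> where "\<phi> x = (norm x)\<^sup>2 - 2 * Re (f x)" for x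
  have scaleR: "f (r *\<^sub>R x) = of_real r * f x" for r x by (simp add: scaleR_scaleC scale)
  have "- (K\<^sup>2) \<le> \<phi> x" for x
  proof -
    have "Re (f x) \<le> K * norm x" using complex_Re_le_cmod[of "f x"] bound[of x] by linarith
    then have "\<phi> x \<ge> (norm x - K)\<^sup>2 - K\<^sup>2"
      by (simp add: \<phi>_def power2_eq_square algebra_simps)
    then show ?thesis using zero_le_power2[of "norm x - K"] by linarith
  qed
  then have bdd: "bdd_below (range \<phi>)" by (intro bdd_belowI2)
  define m where "m = Inf (range \<phi>)"
  have m: "m \<le> \<phi> x" for x unfolding m_def by (rule cINF_lower[OF bdd]) simp
  have "\<exists>x. \<phi> x < m + 1 / real (Suc n)" for n
    using cInf_lessD[of "range \<phi>" "m + 1 / real (Suc n)"] by (auto simp: m_def)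
  then obtain X where X: "\<And>n. \<phi> (X n) < m + 1 / real (Suc n)" by metis
  have par: "(norm (x - y))\<^sup>2 \<le> 2 * (\<phi> x - m) + 2 * (\<phi> y - m)" for x y
  proof -
    have "(norm ((1/2) *\<^sub>R (x + y)))\<^sup>2 = (norm (x + y))\<^sup>2 / 4" by (simp add: power_divide)
    moreover have "Re (f ((1/2) *\<^sub>R (x + y))) = (Re (f x) + Re (f y)) / 2"
      unfolding scaleR add by simp
    ultimately have "4 * \<phi> ((1/2) *\<^sub>R (x + y)) = (norm (x + y))\<^sup>2 - 4 * Re (f x) - 4 * Re (f y)"
      unfolding \<phi>_def by simp
    moreover have "4 * m \<le> 4 * \<phi> ((1/2) *\<^sub>R (x + y))" using m by simp
    ultimately show ?thesis by (simp add: \<phi>_def norm_add_sq norm_diff_sq)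
  qed
  have "Cauchy X"
  proof (rule metric_CauchyI)
    fix e :: real assume e: "e > 0"
    have "(\<lambda>n. 4 / real (Suc n)) \<longlonglongrightarrow> 0"
      using tendsto_mult_right_zero[OF LIMSEQ_inverse_real_of_nat, of 4] by (simp add: divide_inverse)
    then have "\<forall>\<^sub>F n in sequentially. 4 / real (Suc n) < e\<^sup>2"
      using e by (intro order_tendstoD) auto
    then obtain M where M: "4 / real (Suc M) < e\<^sup>2"
      using eventually_happens'[OF sequentially_bot] by blast
    show "\<exists>M. \<forall>i\<ge>M. \<forall>j\<ge>M. dist (X i) (X j) < e"
    proof (intro exI allI impI)
      fix i j assume ij: "M \<le> i" "M \<le> j"
      have "1 / real (Suc i) \<le> 1 / real (Suc M)" "1 / real (Suc j) \<le> 1 / real (Suc M)"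
        using ij by (auto intro!: divide_left_mono)
      moreover have "(norm (X i - X j))\<^sup>2 \<le> 2 * (\<phi> (X i) - m) + 2 * (\<phi> (X j) - m)" by (rule par)
      ultimately have "(norm (X i - X j))\<^sup>2 < e\<^sup>2"
        using X[of i] X[of j] M by simp
      then show "dist (X i) (X j) < e" using e by (simp add: dist_norm power2_less_imp_less)
    qed
  qed
  then obtain y where y: "X \<longlonglongrightarrow> y" using Cauchy_convergent_iff convergent_def by blast
  have "bounded_linear f"
    by (rule bounded_linear_intro[where K = K]) (simp_all add: add scaleR scaleR_conv_of_real bound mult.commute)
  then have "(\<lambda>n. \<phi> (X n)) \<longlonglongrightarrow> \<phi> y"
    unfolding \<phi>_def by (intro tendsto_intros y bounded_linear.tendsto[OF _ y])
  moreover have "(\<lambda>n. m + 1 / real (Suc n)) \<longlonglongrightarrow> m"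
    using tendsto_add[OF tendsto_const LIMSEQ_inverse_real_of_nat, of m] by (simp add: divide_inverse)
  ultimately have "\<phi> y \<le> m"
    by (rule LIMSEQ_le) (use X less_imp_le in blast)
  then have min: "\<phi> y \<le> \<phi> x" for x using m order_trans by blast
  have re: "Re (f x) = Re (cinner y x)" for x
  proof -
    have "0 \<le> t * (2 * (Re (cinner y x) - Re (f x))) + t\<^sup>2 * (norm x)\<^sup>2" for t
      using min[of "y + t *\<^sub>R x"]
      by (simp add: \<phi>_def norm_add_sq add scaleR cinner_scaleR_right power_mult_distrib algebra_simps)
    then have "2 * (Re (cinner y x) - Re (f x)) = 0" by (rule linear_term_zero) simp
    then show ?thesis by simp
  qed
  have "f x = cinner y x" for x
    using re[of x] re[of "\<i> *\<^sub>C x"] by (simp add: scale cinner_scaleC_right complex_eq_iff)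
  then show ?thesis by blast
qed

text \<open>Adjointness as a relation separates existence, uniqueness and boundedness of the
  adjoint, and lets a limit operator be recognised as an adjoint before \<open>cadjoint\<close> is
  evaluated.\<close>

definition adjoint_pair :: "('a::complex_inner \<Rightarrow> 'a) \<Rightarrow> ('a \<Rightarrow> 'a) \<Rightarrow> bool" where
  "adjoint_pair A B \<longleftrightarrow> (\<forall>x y. cinner (A x) y = cinner x (B y))"

lemma adjoint_pairD: "adjoint_pair A B \<Longrightarrow> cinner (A x) y = cinner x (B y)"
  by (simp add: adjoint_pair_def)

lemma adjoint_pair_sym: "adjoint_pair A B \<Longrightarrow> adjoint_pair B A"
  unfolding adjoint_pair_def by (metis cinner_commute)

lemma cadjoint_eq:
  assumes "adjoint_pair A B"
  shows "cadjoint A = B"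
  unfolding cadjoint_def
proof (rule the_equality)
  show "\<forall>x y. cinner (A x) y = cinner x (B y)" using assms by (simp add: adjoint_pair_def)
  fix C assume "\<forall>x y. cinner (A x) y = cinner x (C y)"
  then show "C = B" using assms by (intro ext cinner_eqI) (metis adjoint_pairD)
qed

lemma exists_adjoint:
  fixes A :: "'a::chilbert_space \<Rightarrow> 'a"
  assumes A: "bounded_clinear A"
  shows "\<exists>B. adjoint_pair A B"
proof -
  obtain K where K: "K > 0" "\<And>x. norm (A x) \<le> K * norm x" using bounded_clinear_bound[OF A] by blast
  have "\<exists>b. \<forall>x. cinner y (A x) = cinner b x" for y
  proof (rule riesz_representation)
    show "cmod (cinner y (A x)) \<le> (norm y * K) * norm x" for x
      using cmod_cinner_le[of y "A x"] mult_left_mono[OF K(2)[of x], of "norm y"] by (simp add: mult.assoc)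
  qed (simp_all add: bounded_clinear_add[OF A] bounded_clinear_scaleC[OF A] cinner_simps)
  then obtain B where "\<And>y x. cinner y (A x) = cinner (B y) x" by metis
  then have "adjoint_pair A B" unfolding adjoint_pair_def by (metis cinner_commute)
  then show ?thesis by blast
qed

lemma bounded_clinear_adjoint:
  assumes AB: "adjoint_pair A B" and A: "bounded_clinear A"
  shows "bounded_clinear B"
proof -
  obtain K where K: "K > 0" "\<And>x. norm (A x) \<le> K * norm x" using bounded_clinear_bound[OF A] by blast
  have "norm (B x) \<le> K * norm x" for x
  proof (cases "B x = 0")
    case False
    have "(norm (B x))\<^sup>2 = cmod (cinner (A (B x)) x)"
      by (simp add: adjoint_pairD[OF AB] cinner_self norm_power)
    also have "\<dots> \<le> norm (A (B x)) * norm x" by (rule cmod_cinner_le)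
    also have "\<dots> \<le> K * norm (B x) * norm x" by (intro mult_right_mono K) simp
    finally have "norm (B x) * norm (B x) \<le> norm (B x) * (K * norm x)"
      by (simp add: power2_eq_square mult_ac)
    then show ?thesis using False by simp
  qed (use K in simp)
  then show ?thesis
    by (intro bounded_clinearI cinner_eqI)
       (simp_all add: adjoint_pairD[OF AB, symmetric] cinner_simps)
qed

lemma norm_normal:
  assumes AB: "adjoint_pair A B" and comm: "\<And>x. A (B x) = B (A x)"
  shows "norm (B x) = norm (A x)"
proof -
  have "cinner (B x) (B x) = cinner (A x) (A x)"
    using adjoint_pairD[OF AB, of "x" "A x"] adjoint_pairD[OF AB, of "B x" x] comm[of x]
      adjoint_pairD[OF adjoint_pair_sym[OF AB], of x "B x"] by simp
  then have "(norm (B x))\<^sup>2 = (norm (A x))\<^sup>2" by (simp only: cinner_self of_real_eq_iff)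
  then show ?thesis by simp
qed

section \<open>Polynomials in an operator\<close>

lemma poly_op_0: "poly_op 0 A x = 0"
  by (simp add: poly_op_def)

lemma poly_op_pCons:
  assumes A: "bounded_clinear A"
  shows "poly_op (pCons a p) A x = a *\<^sub>C x + A (poly_op p A x)"
proof (cases "p = 0")
  case True
  then show ?thesis by (simp add: poly_op_def bounded_clinear_zero[OF A])
next
  case False
  have "A (\<Sum>i\<le>degree p. coeff p i *\<^sub>C (A ^^ i) x) = (\<Sum>i\<le>degree p. coeff p i *\<^sub>C (A ^^ Suc i) x)"
    by (simp add: linear_sum[OF bounded_linear.linear[OF bounded_clinear_bounded_linear[OF A]]]
        bounded_clinear_scaleC[OF A])
  then show ?thesis
    using False by (simp add: poly_op_def sum.atMost_Suc_shift del: sum.atMost_Suc)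
qed

context
  fixes A :: "'a::complex_normed_vector \<Rightarrow> 'a"
  assumes A: "bounded_clinear A"
begin

lemma poly_op_const: "poly_op [:a:] A x = a *\<^sub>C x"
  by (simp add: poly_op_pCons[OF A] poly_op_0 bounded_clinear_zero[OF A])

lemma poly_op_linear_factor: "poly_op [:- z, 1:] A x = A x - z *\<^sub>C x"
  by (simp add: poly_op_pCons[OF A] poly_op_0 bounded_clinear_zero[OF A] scaleC_one)

lemma poly_op_add: "poly_op (p + q) A x = poly_op p A x + poly_op q A x"
proof (induction p q rule: poly_induct2)
  case (pCons a p b q)
  then show ?case by (simp add: poly_op_pCons[OF A] bounded_clinear_add[OF A] scaleC_simps)
qed (simp add: poly_op_0)

lemma poly_op_smult: "poly_op (smult c p) A x = c *\<^sub>C poly_op p A x"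
proof (induction p)
  case (pCons a p)
  then show ?case by (simp add: poly_op_pCons[OF A] bounded_clinear_scaleC[OF A] scaleC_simps)
qed (simp add: poly_op_0)

lemma poly_op_diff: "poly_op (p - q) A x = poly_op p A x - poly_op q A x"
  using poly_op_add[of "p - q" q x] by (simp add: algebra_simps)

lemma poly_op_mult: "poly_op (p * q) A x = poly_op p A (poly_op q A x)"
proof (induction p)
  case (pCons a p)
  then show ?case by (simp add: poly_op_pCons[OF A] poly_op_add poly_op_smult)
qed (simp add: poly_op_0)

lemma poly_op_commute:
  assumes "bounded_clinear B" "\<And>x. A (B x) = B (A x)"
  shows "poly_op p A (B x) = B (poly_op p A x)"
proof (induction p)
  case (pCons a p)
  then show ?case
    by (simp add: poly_op_pCons[OF A] bounded_clinear_add[OF assms(1)] bounded_clinear_scaleC[OF assms(1)] assms(2))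
qed (simp add: poly_op_0 bounded_clinear_zero[OF assms(1)])

lemma bounded_clinear_poly_op: "bounded_clinear (poly_op p A)"
proof (induction p)
  case 0
  have "poly_op 0 A = (\<lambda>x. 0)" by (rule ext) (rule poly_op_0)
  then show ?case by (simp add: bounded_clinear_const_zero)
next
  case (pCons a p)
  have "poly_op (pCons a p) A = (\<lambda>x. a *\<^sub>C x + A (poly_op p A x))"
    by (rule ext) (rule poly_op_pCons[OF A])
  then show ?case
    by (simp add: bounded_clinear_plus bounded_clinear_scaled bounded_clinear_id bounded_clinear_compose[OF A pCons(2)])
qed

end

section \<open>Invertibility and the spectrum\<close>

text \<open>The lower bound stands for boundedness of the inverse, so that products, factors and
  perturbations are treated without naming an inverse.\<close>

definition invertible_op :: "('a::complex_normed_vector \<Rightarrow> 'a) \<Rightarrow> bool" where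
  "invertible_op T \<longleftrightarrow> bij T \<and> (\<exists>c>0. \<forall>x. c * norm x \<le> norm (T x))"

lemma op_spectrum_iff:
  assumes A: "bounded_clinear A"
  shows "z \<in> op_spectrum A \<longleftrightarrow> \<not> invertible_op (\<lambda>x. A x - z *\<^sub>C x)"
proof -
  define T where "T = (\<lambda>x. A x - z *\<^sub>C x)"
  have T: "bounded_clinear T"
    unfolding T_def by (intro bounded_clinear_minus A bounded_clinear_scaled bounded_clinear_id)
  have "(\<exists>B. bounded_clinear B \<and> B \<circ> T = id \<and> T \<circ> B = id) \<longleftrightarrow> invertible_op T"
  proof
    assume "\<exists>B. bounded_clinear B \<and> B \<circ> T = id \<and> T \<circ> B = id"
    then obtain B where B: "bounded_clinear B" "B \<circ> T = id" "T \<circ> B = id" by blast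
    obtain K where K: "K > 0" "\<And>x. norm (B x) \<le> K * norm x" using bounded_clinear_bound[OF B(1)] by blast
    have "1 / K * norm x \<le> norm (T x)" for x
      using K(2)[of "T x"] K(1) fun_cong[OF B(2), of x] by (simp add: field_simps)
    moreover have "bij T" using B o_bij by blast
    ultimately show "invertible_op T" using K(1) unfolding invertible_op_def
      by (meson zero_less_divide_1_iff)
  next
    assume "invertible_op T"
    then obtain c where bij: "bij T" and c: "c > 0" "\<And>x. c * norm x \<le> norm (T x)"
      unfolding invertible_op_def by blast
    have inj: "inj T" and TB: "T (inv T y) = y" and BT: "inv T (T x) = x" for x y
      using bij by (simp_all add: bij_is_inj bij_is_surj surj_f_inv_f)
    have "bounded_clinear (inv T)"
    proof (rule bounded_clinearI[where K = "1 / c"])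
      show "inv T (x + y) = inv T x + inv T y" for x y
        by (rule injD[OF inj]) (simp add: TB bounded_clinear_add[OF T])
      show "inv T (a *\<^sub>C x) = a *\<^sub>C inv T x" for a x
        by (rule injD[OF inj]) (simp add: TB bounded_clinear_scaleC[OF T])
      show "norm (inv T x) \<le> 1 / c * norm x" for x
        using c(2)[of "inv T x"] c(1) by (simp add: TB field_simps)
    qed
    moreover have "inv T \<circ> T = id" "T \<circ> inv T = id" by (auto simp: TB BT)
    ultimately show "\<exists>B. bounded_clinear B \<and> B \<circ> T = id \<and> T \<circ> B = id" by blast
  qed
  then show ?thesis unfolding op_spectrum_def T_def by blast
qed

lemma invertible_op_compose:
  assumes "invertible_op S" "invertible_op T"
  shows "invertible_op (\<lambda>x. S (T x))"
proof -
  obtain a b where a: "a > 0" "\<And>x. a * norm x \<le> norm (S x)" and b: "b > 0" "\<And>x. b * norm x \<le> norm (T x)"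
    using assms unfolding invertible_op_def by blast
  have "(a * b) * norm x \<le> norm (S (T x))" for x
    unfolding mult.assoc using a(2)[of "T x"] mult_left_mono[OF b(2)[of x], of a] a(1) by linarith
  moreover have "bij (\<lambda>x. S (T x))"
    using assms bij_comp[of T S] unfolding invertible_op_def by (simp add: comp_def)
  moreover have "a * b > 0" using a b by simp
  ultimately show ?thesis unfolding invertible_op_def by blast
qed

text \<open>\<open>T\<close> gets injectivity from \<open>S T\<close> and surjectivity from
  \<open>T S\<close>, which is the same operator.\<close>

lemma invertible_op_factor:
  assumes S: "bounded_clinear S" and comm: "\<And>x. S (T x) = T (S x)" and ST: "invertible_op (\<lambda>x. S (T x))"
  shows "invertible_op T"
proof -
  obtain c where bij: "bij (\<lambda>x. S (T x))" and c: "c > 0" "\<And>x. c * norm x \<le> norm (S (T x))"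
    using ST unfolding invertible_op_def by blast
  obtain K where K: "K > 0" "\<And>x. norm (S x) \<le> K * norm x" using bounded_clinear_bound[OF S] by blast
  have "c / K * norm x \<le> norm (T x)" for x
    using c(2)[of x] K(2)[of "T x"] K(1) by (simp add: field_simps)
  moreover have "inj T" using bij by (auto simp: bij_def inj_def)
  moreover have "surj T" using bij comm unfolding bij_def surj_def by metis
  moreover have "c / K > 0" using c K by simp
  ultimately show ?thesis unfolding invertible_op_def bij_def by blast
qed

text \<open>Solving \<open>V x + E x = y\<close> means finding a fixed point of
  \<open>x \<mapsto> V\<^sup>-\<^sup>1 (y - E x)\<close>, which contracts by the factor
  \<open>e / c\<close>.\<close>

lemma invertible_op_perturb:
  fixes V E :: "'a::chilbert_space \<Rightarrow> 'a"
  assumes V: "bounded_clinear V" "surj V" "\<And>x. c * norm x \<le> norm (V x)"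
    and E: "bounded_clinear E" "\<And>x. norm (E x) \<le> e * norm x" and e: "0 \<le> e" "e < c"
  shows "invertible_op (\<lambda>x. V x + E x)"
proof -
  define T where "T = (\<lambda>x. V x + E x)"
  have T: "bounded_clinear T" unfolding T_def by (rule bounded_clinear_plus[OF V(1) E(1)])
  have low: "(c - e) * norm x \<le> norm (T x)" for x
    using norm_triangle_ineq2[of "V x" "- E x"] V(3)[of x] E(2)[of x] by (simp add: T_def left_diff_distrib)
  have "inj T"
  proof (rule injI)
    fix x y assume "T x = T y"
    then have "norm (T (x - y)) = 0" by (simp add: bounded_clinear_diff[OF T])
    then have "(c - e) * norm (x - y) \<le> 0" using low[of "x - y"] by simp
    then show "x = y" using e by (simp add: mult_le_0_iff)
  qed
  moreover have "surj T"
  proof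
    show "UNIV \<subseteq> range T"
    proof
      fix y
      define g where "g x = inv V (y - E x)" for x
      have Vg: "V (g x) = y - E x" for x unfolding g_def using V(2) by (rule surj_f_inv_f)
      have "\<exists>!x. g x = x"
      proof (rule banach_fix_type[of "e / c"])
        have "dist (g u) (g v) \<le> e / c * dist u v" for u v
        proof -
          have "c * norm (g u - g v) \<le> norm (V (g u - g v))" by (rule V(3))
          also have "V (g u - g v) = E (v - u)"
            by (simp add: bounded_clinear_diff[OF V(1)] bounded_clinear_diff[OF E(1)] Vg)
          also have "norm (E (v - u)) \<le> e * norm (v - u)" by (rule E(2))
          finally show ?thesis using e by (simp add: dist_norm norm_minus_commute field_simps)
        qed
        then show "\<forall>u v. dist (g u) (g v) \<le> e / c * dist u v" by blast
      qed (use e in auto)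
      then obtain x where "g x = x" by blast
      then have "T x = y" using Vg[of x] by (simp add: T_def)
      then show "y \<in> range T" by blast
    qed
  qed simp
  ultimately show ?thesis
    using low e unfolding invertible_op_def bij_def T_def[symmetric] by (meson diff_gt_0_iff_gt)
qed

lemma invertible_op_near_scalar:
  fixes A :: "'a::chilbert_space \<Rightarrow> 'a"
  assumes A: "bounded_clinear A" "\<And>x. norm (A x) \<le> K * norm x" and z: "0 \<le> K" "K < cmod z"
  shows "invertible_op (\<lambda>x. A x - z *\<^sub>C x)"
proof -
  have "invertible_op (\<lambda>x. (- z) *\<^sub>C x + A x)"
  proof (rule invertible_op_perturb[OF _ _ _ A z])
    show "bounded_clinear ((*\<^sub>C) (- z) :: 'a \<Rightarrow> 'a)"
      by (rule bounded_clinear_scaled[OF bounded_clinear_id])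
    show "surj ((*\<^sub>C) (- z) :: 'a \<Rightarrow> 'a)"
    proof (rule surjI)
      fix x :: 'a
      have "z \<noteq> 0" using z by auto
      then show "(- z) *\<^sub>C ((- 1 / z) *\<^sub>C x) = x" by (simp add: scaleC_scaleC scaleC_one)
    qed
    show "cmod z * norm x \<le> norm ((- z) *\<^sub>C x)" for x :: 'a by (simp add: norm_scaleC)
  qed
  then show ?thesis by simp
qed

lemma compact_op_spectrum:
  fixes A :: "'a::chilbert_space \<Rightarrow> 'a"
  assumes A: "bounded_clinear A"
  shows "compact (op_spectrum A)"
proof -
  obtain K where K: "K > 0" "\<And>x. norm (A x) \<le> K * norm x" using bounded_clinear_bound[OF A] by blast
  have "cmod z \<le> K" if "z \<in> op_spectrum A" for z
    using that invertible_op_near_scalar[OF A K(2), of z] K(1) unfolding op_spectrum_iff[OF A]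
    by (meson less_imp_le not_le)
  then have "bounded (op_spectrum A)" unfolding bounded_iff by auto
  moreover have "open (- op_spectrum A)"
    unfolding open_contains_ball
  proof
    fix z assume z: "z \<in> - op_spectrum A"
    define T where "T = (\<lambda>x. A x - z *\<^sub>C x)"
    have T: "bounded_clinear T"
      unfolding T_def by (intro bounded_clinear_minus A bounded_clinear_scaled bounded_clinear_id)
    have "invertible_op T" using z op_spectrum_iff[OF A] unfolding T_def by blast
    then obtain c where c: "c > 0" "\<And>x. c * norm x \<le> norm (T x)" and sur: "surj T"
      unfolding invertible_op_def bij_def by blast
    have "u \<notin> op_spectrum A" if u: "u \<in> ball z c" for u
    proof -
      have "invertible_op (\<lambda>x. T x + (z - u) *\<^sub>C x)"
      proof (rule invertible_op_perturb[OF T sur c(2)])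
        show "norm ((z - u) *\<^sub>C x) \<le> cmod (z - u) * norm x" for x :: 'a by (simp add: norm_scaleC)
        show "cmod (z - u) < c" using u by (simp add: dist_norm)
      qed (simp_all add: bounded_clinear_scaled bounded_clinear_id)
      then show ?thesis unfolding op_spectrum_iff[OF A] by (simp add: T_def scaleC_diff_left)
    qed
    then show "\<exists>e>0. ball z e \<subseteq> - op_spectrum A" using c(1) by blast
  qed
  ultimately show ?thesis by (simp add: compact_eq_bounded_closed closed_def)
qed

text \<open>One half of the spectral mapping theorem. If \<open>cmod (poly p z)\<close> exceeded the
  norm, \<open>p(A) - p(z)\<close> would be invertible, and with it the commuting factor
  \<open>A - z\<close>.\<close>

lemma cmod_poly_le_onorm:
  fixes A :: "'a::chilbert_space \<Rightarrow> 'a"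
  assumes A: "bounded_clinear A" and z: "z \<in> op_spectrum A"
  shows "cmod (poly p z) \<le> onorm (poly_op p A)"
proof (rule ccontr)
  assume "\<not> ?thesis"
  then have less: "onorm (poly_op p A) < cmod (poly p z)" by simp
  note P = bounded_clinear_poly_op[OF A]
  have inv: "invertible_op (\<lambda>x. poly_op p A x - poly p z *\<^sub>C x)"
    by (rule invertible_op_near_scalar[OF P norm_le_onorm[OF P] _ less])
       (rule onorm_pos_le[OF bounded_clinear_bounded_linear[OF P]])
  have "[:- z, 1:] dvd p - [:poly p z:]" by (simp add: poly_eq_0_iff_dvd[symmetric])
  then obtain q where q: "p - [:poly p z:] = [:- z, 1:] * q" by blast
  then have q': "p - [:poly p z:] = q * [:- z, 1:]" by (simp add: mult.commute)
  have "poly_op p A x - poly p z *\<^sub>C x = poly_op q A (A x - z *\<^sub>C x)" for x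
    by (metis q' poly_op_diff[OF A] poly_op_const[OF A] poly_op_mult[OF A] poly_op_linear_factor[OF A])
  then have "invertible_op (\<lambda>x. poly_op q A (A x - z *\<^sub>C x))" using inv by simp
  moreover have "poly_op q A (A x - z *\<^sub>C x) = A (poly_op q A x) - z *\<^sub>C poly_op q A x" for x
    by (metis mult.commute poly_op_mult[OF A] poly_op_linear_factor[OF A])
  ultimately have "invertible_op (\<lambda>x. A x - z *\<^sub>C x)"
    using invertible_op_factor[OF P[of q], of "\<lambda>x. A x - z *\<^sub>C x"] by simp
  then show False using z op_spectrum_iff[OF A] by blast
qed

text \<open>The other half: \<open>p\<close> splits into linear factors with roots off the spectrum,
  and products of invertible operators are invertible.\<close>

lemma invertible_poly_op:
  fixes A :: "'a::chilbert_space \<Rightarrow> 'a"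
  assumes A: "bounded_clinear A"
  shows "p \<noteq> 0 \<Longrightarrow> \<forall>z\<in>op_spectrum A. poly p z \<noteq> 0 \<Longrightarrow> invertible_op (poly_op p A)"
proof (induction "degree p" arbitrary: p)
  case 0
  then obtain a where p: "p = [:a:]" "a \<noteq> 0" by (metis degree_eq_zeroE pCons_0_0)
  have "poly_op p A = (\<lambda>x. (\<lambda>x. 0) x - (- a) *\<^sub>C x)" by (rule ext) (simp add: p poly_op_const[OF A])
  moreover have "invertible_op (\<lambda>x :: 'a. (\<lambda>x. 0) x - (- a) *\<^sub>C x)"
    by (rule invertible_op_near_scalar[where K = 0, OF bounded_clinear_const_zero]) (use p in auto)
  ultimately show ?case by simp
next
  case (Suc n)
  have "\<not> constant (poly p)" using Suc(2) by (simp add: constant_degree)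
  then obtain z where z: "poly p z = 0" using fundamental_theorem_of_algebra by blast
  then obtain q where q: "p = [:- z, 1:] * q" using poly_eq_0_iff_dvd by blast
  have q0: "q \<noteq> 0" using Suc(3) q by auto
  then have "degree p = degree [:- z, 1:] + degree q"
    unfolding q by (intro degree_mult_eq) auto
  then have "n = degree q" using Suc(2) by simp
  moreover have "\<forall>z\<in>op_spectrum A. poly q z \<noteq> 0" using Suc(4) q by auto
  ultimately have "invertible_op (poly_op q A)" using Suc(1) q0 by blast
  moreover have "invertible_op (\<lambda>x. A x - z *\<^sub>C x)" using Suc(4) z op_spectrum_iff[OF A] by blast
  ultimately have "invertible_op (\<lambda>x. (\<lambda>x. A x - z *\<^sub>C x) (poly_op q A x))"
    using invertible_op_compose by blast
  moreover have "poly_op p A = (\<lambda>x. (\<lambda>x. A x - z *\<^sub>C x) (poly_op q A x))"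
    by (rule ext) (simp only: q poly_op_mult[OF A] poly_op_linear_factor[OF A])
  ultimately show ?case by simp
qed

section \<open>Normal operators\<close>

lemma poly_op_adjoint:
  assumes N: "bounded_clinear N" and M: "bounded_clinear M" and adj: "adjoint_pair N M"
  shows "adjoint_pair (poly_op p N) (poly_op (map_poly cnj p) M)"
proof (induction p)
  case 0
  then show ?case by (simp add: adjoint_pair_def poly_op_0)
next
  case (pCons a p)
  have comm: "poly_op (map_poly cnj p) M (M x) = M (poly_op (map_poly cnj p) M x)" for x
    by (rule poly_op_commute[OF M M]) simp
  have "map_poly cnj (pCons a p) = pCons (cnj a) (map_poly cnj p)"
    by (simp add: map_poly_pCons)
  then show ?case
    unfolding adjoint_pair_def
    by (simp add: poly_op_pCons[OF N] poly_op_pCons[OF M] cinner_simps adjoint_pairD[OF adj]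
        adjoint_pairD[OF pCons(2)] comm)
qed

lemma poly_op_normal:
  assumes N: "bounded_clinear N" and M: "bounded_clinear M" and comm: "\<And>x. N (M x) = M (N x)"
  shows "poly_op p N (poly_op q M x) = poly_op q M (poly_op p N x)"
proof -
  have "M (poly_op p N x) = poly_op p N (M x)" for x
    using poly_op_commute[OF N M comm] by simp
  from poly_op_commute[OF M bounded_clinear_poly_op[OF N] this, of q x]
  show ?thesis by simp
qed

text \<open>The norms of the iterates are log-convex: \<open>(norm (A u))\<^sup>2\<close> equals
  \<open>cinner u (B (A u))\<close>, and by normality \<open>B (A u)\<close> is as long as
  \<open>A (A u)\<close>. So ratios of consecutive norms never drop below \<open>r\<close>.\<close>

lemma normal_power_growth:
  assumes AB: "adjoint_pair A B" and comm: "\<And>x. A (B x) = B (A x)"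
    and r: "0 \<le> r" "r * norm x \<le> norm (A x)"
  shows "r ^ n * norm x \<le> norm ((A ^^ n) x)"
proof -
  have key: "(norm (A u))\<^sup>2 \<le> norm u * norm (A (A u))" for u
  proof -
    have "cinner (A u) (A u) = cinner u (B (A u))" by (rule adjoint_pairD[OF AB])
    then have "cmod (cinner (A u) (A u)) \<le> norm u * norm (B (A u))"
      using cmod_cinner_le by metis
    then show ?thesis by (simp add: cinner_self norm_power norm_normal[OF AB comm])
  qed
  have step: "r * norm ((A ^^ n) x) \<le> norm ((A ^^ Suc n) x)" for n
  proof (induction n)
    case (Suc n)
    define a b c where "a = norm ((A ^^ n) x)" and "b = norm ((A ^^ Suc n) x)" and "c = norm ((A ^^ Suc (Suc n)) x)"
    have abc: "b * b \<le> a * c" using key[of "(A ^^ n) x"] by (simp add: a_def b_def c_def power2_eq_square)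
    have "r * a \<le> b" using Suc by (simp add: a_def b_def)
    have nn: "a \<ge> 0" "b \<ge> 0" "c \<ge> 0" by (auto simp: a_def b_def c_def)
    have "r * b \<le> c"
    proof (cases "b = 0")
      case False
      then have "a * c > 0" using abc nn by (metis less_le_trans mult_pos_pos order_less_le)
      then have "a > 0" using nn by (metis mult_zero_left order_less_le)
      have "a * (r * b) = (r * a) * b" by simp
      also have "\<dots> \<le> b * b" by (intro mult_right_mono \<open>r * a \<le> b\<close> nn)
      also have "\<dots> \<le> a * c" by (rule abc)
      finally show ?thesis using \<open>a > 0\<close> by simp
    qed (use nn in simp)
    then show ?case by (simp only: b_def c_def)
  qed (use r in simp)
  show ?thesis
  proof (induction n)
    case (Suc n)
    have "r ^ Suc n * norm x = r * (r ^ n * norm x)" by simp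
    also have "\<dots> \<le> r * norm ((A ^^ n) x)" by (intro mult_left_mono Suc r)
    also have "\<dots> \<le> norm ((A ^^ Suc n) x)" by (rule step)
    finally show ?case .
  qed simp
qed

text \<open>Cauchy's estimate for \<open>w \<mapsto> \<langle>y, (1 - w T)\<^sup>-\<^sup>1 x\<rangle>\<close>, whose Taylor
  coefficients are \<open>\<langle>y, T\<^sup>n x\<rangle>\<close>, with \<open>y = T\<^sup>n x\<close>.\<close>

lemma power_bound_of_resolvent:
  fixes T :: "'a::chilbert_space \<Rightarrow> 'a"
  assumes T: "bounded_clinear T" and C: "0 \<le> C" "C < r"
    and inv: "\<And>w. cmod w * C < 1 \<Longrightarrow> invertible_op (\<lambda>x. x - w *\<^sub>C T x)"
  shows "\<exists>M. \<forall>n. norm ((T ^^ n) x) \<le> M * r ^ n"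
proof -
  define \<Omega> where "\<Omega> = {w. cmod w * C < 1}"
  have "open \<Omega>" unfolding \<Omega>_def by (intro open_Collect_less continuous_intros)
  have \<Omega>0: "0 \<in> \<Omega>" by (simp add: \<Omega>_def)
  obtain K where K: "K > 0" "\<And>x. norm (T x) \<le> K * norm x" using bounded_clinear_bound[OF T] by blast
  define S where "S w x = x - w *\<^sub>C T x" for w x
  define R where "R w = inv (S w)" for w
  have Sl: "bounded_clinear (S w)" for w
    unfolding S_def by (intro bounded_clinear_minus bounded_clinear_scaled T bounded_clinear_id)
  have Sinv: "invertible_op (S w)" if "w \<in> \<Omega>" for w
    using inv[of w] that by (simp add: \<Omega>_def S_def[abs_def])
  have SR: "S w (R w v) = v" and RS: "R w (S w v) = v" if "w \<in> \<Omega>" for w v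
    using Sinv[OF that] unfolding invertible_op_def R_def
    by (simp_all add: bij_is_inj bij_is_surj surj_f_inv_f)
  have R0: "R 0 v = v" for v using RS[OF \<Omega>0, of v] by (simp add: S_def)
  \<comment> \<open>The resolvent identity. It yields continuity, then the derivative, and for
    \<open>u = 0\<close> the recursion for the Taylor coefficients.\<close>
  have res: "R w v - R u v = (w - u) *\<^sub>C R w (T (R u v))" if "w \<in> \<Omega>" "u \<in> \<Omega>" for w u v
  proof -
    have "S w (R w v - R u v) = S u (R u v) - S w (R u v)"
      by (simp add: bounded_clinear_diff[OF Sl] SR that)
    also have "\<dots> = (w - u) *\<^sub>C T (R u v)" by (simp add: S_def scaleC_diff_left)
    also have "\<dots> = S w ((w - u) *\<^sub>C R w (T (R u v)))"
      by (simp add: bounded_clinear_scaleC[OF Sl] SR that)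
    finally show ?thesis using RS[OF that(1)] by metis
  qed
  \<comment> \<open>The lower bound at \<open>u\<close> persists up to the factor 1/2 nearby, so the
    resolvents stay bounded and the identity makes the difference tend to 0.\<close>
  have cont: "((\<lambda>w. R w v) \<longlongrightarrow> R u v) (at u)" if u: "u \<in> \<Omega>" for u v
  proof -
    obtain c where c: "c > 0" "\<And>x. c * norm x \<le> norm (S u x)"
      using Sinv[OF u] unfolding invertible_op_def by blast
    define e where "e = c / (2 * K)"
    have e: "e > 0" using c K by (simp add: e_def)
    have low: "c / 2 * norm x \<le> norm (S w x)" if "dist w u < e" for w x
    proof -
      have "S w x = S u x - (w - u) *\<^sub>C T x" by (simp add: S_def scaleC_diff_left)
      moreover have "norm ((w - u) *\<^sub>C T x) \<le> e * (K * norm x)"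
        unfolding norm_scaleC using that K e by (intro mult_mono) (auto simp: dist_norm)
      moreover have "e * (K * norm x) = c / 2 * norm x" using K(1) by (simp add: e_def)
      ultimately show ?thesis using norm_triangle_ineq2[of "S u x" "(w - u) *\<^sub>C T x"] c(2)[of x] by simp
    qed
    have "\<forall>\<^sub>F w in at u. w \<in> \<Omega>" using \<open>open \<Omega>\<close> u by (simp add: eventually_at_in_open')
    moreover have "\<forall>\<^sub>F w in at u. dist w u < e" using e by (auto simp: eventually_at intro: exI[of _ e])
    ultimately have "\<forall>\<^sub>F w in at u. norm (R w v - R u v) \<le> cmod (w - u) * (2 / c * norm (T (R u v)))"
    proof eventually_elim
      case (elim w)
      have "c / 2 * norm (R w (T (R u v))) \<le> norm (T (R u v))"
        using low[OF elim(2), of "R w (T (R u v))"] SR[OF elim(1)] by simp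
      then have "norm (R w (T (R u v))) \<le> 2 / c * norm (T (R u v))"
        using c(1) by (simp add: field_simps)
      then show ?case unfolding res[OF elim(1) u] norm_scaleC by (intro mult_left_mono) auto
    qed
    moreover have "((\<lambda>w. cmod (w - u) * (2 / c * norm (T (R u v)))) \<longlongrightarrow> 0) (at u)"
      by (rule tendsto_eq_intros refl)+ simp
    ultimately have "((\<lambda>w. R w v - R u v) \<longlongrightarrow> 0) (at u)"
      by (rule Lim_null_comparison)
    then show ?thesis by (simp add: LIM_zero_iff)
  qed
  have hol: "(\<lambda>w. cinner y (R w v)) holomorphic_on \<Omega>" for y v
    unfolding holomorphic_on_open[OF \<open>open \<Omega>\<close>]
  proof
    fix u assume u: "u \<in> \<Omega>"
    have "((\<lambda>w. cinner y (R w (T (R u v)))) \<longlongrightarrow> cinner y (R u (T (R u v)))) (at u)"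
      by (intro tendsto_cinner tendsto_const cont u)
    moreover have "\<forall>\<^sub>F w in at u. w \<in> \<Omega>" using \<open>open \<Omega>\<close> u by (simp add: eventually_at_in_open')
    then have "\<forall>\<^sub>F w in at u. cinner y (R w (T (R u v))) = (cinner y (R w v) - cinner y (R u v)) / (w - u)"
      using eventually_neq_at_within[of u u UNIV]
    proof eventually_elim
      case (elim w)
      have "cinner y (R w v) - cinner y (R u v) = (w - u) * cinner y (R w (T (R u v)))"
        unfolding cinner_diff_right[symmetric] res[OF elim(1) u] by (rule cinner_scaleC_right)
      then show ?case using elim by simp
    qed
    ultimately have "((\<lambda>w. (cinner y (R w v) - cinner y (R u v)) / (w - u)) \<longlongrightarrow> cinner y (R u (T (R u v)))) (at u)"
      by (rule Lim_transform_eventually)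
    then show "\<exists>D. ((\<lambda>w. cinner y (R w v)) has_field_derivative D) (at u)"
      unfolding has_field_derivative_iff by blast
  qed
  have taylor: "(deriv ^^ n) (\<lambda>w. cinner y (R w x)) 0 = fact n * cinner y ((T ^^ n) x)" for y n
  proof -
    define h where "h n w = cinner y (R w ((T ^^ n) x))" for n w
    define F where "F n = fps_expansion (h n) 0" for n
    have F: "h n has_fps_expansion F n" for n
      unfolding F_def h_def by (rule has_fps_expansion_fps_expansion[OF \<open>open \<Omega>\<close> \<Omega>0 hol])
    \<comment> \<open>At the origin the identity reads
      \<open>h n w = h n 0 + w * h (Suc n) w\<close>: raising \<open>n\<close> by one shifts the
      coefficients by one.\<close>
    have "F n = fps_const (h n 0) + fps_X * F (Suc n)" for n
    proof (rule fps_expansion_unique_complex[OF F])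
      have "\<forall>\<^sub>F w in nhds 0. w \<in> \<Omega>" using \<open>open \<Omega>\<close> \<Omega>0 by (rule eventually_nhds_in_open)
      then have ev: "\<forall>\<^sub>F w in nhds 0. h n w = h n 0 + w * h (Suc n) w"
      proof eventually_elim
        case (elim w)
        have "h n w - h n 0 = cinner y (R w ((T ^^ n) x) - R 0 ((T ^^ n) x))"
          by (simp add: h_def cinner_diff_right)
        also have "\<dots> = w * h (Suc n) w"
          unfolding res[OF elim \<Omega>0] by (simp add: h_def cinner_scaleC_right R0)
        finally show ?case by (simp add: algebra_simps)
      qed
      have "(\<lambda>w. h n 0 + w * h (Suc n) w) has_fps_expansion fps_const (h n 0) + fps_X * F (Suc n)"
        by (intro fps_expansion_intros F)
      then show "h n has_fps_expansion fps_const (h n 0) + fps_X * F (Suc n)"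
        by (rule iffD2[OF has_fps_expansion_cong[OF ev refl]])
    qed
    from arg_cong[OF this, of "\<lambda>G. fps_nth G (Suc k)" for k]
    have shift: "fps_nth (F n) (Suc k) = fps_nth (F (Suc n)) k" for n k
      by simp
    have diag: "fps_nth (F m) n = fps_nth (F (m + n)) 0" for m n
      by (induction n arbitrary: m) (simp_all add: shift)
    have "fps_nth (F 0) n = h n 0"
      using diag[of 0 n] has_fps_expansion_imp_0_eq_fps_nth_0[OF F, of n] by simp
    moreover have "fps_nth (F 0) n = (deriv ^^ n) (h 0) 0 / fact n"
      by (rule fps_nth_fps_expansion[OF F])
    moreover have "h 0 = (\<lambda>w. cinner y (R w x))" "h n 0 = cinner y ((T ^^ n) x)"
      by (auto simp: h_def R0)
    ultimately show ?thesis by (simp add: field_simps)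
  qed
  \<comment> \<open>\<open>C < r\<close> places the closed disc of radius \<open>1 / r\<close>
    inside \<open>\<Omega>\<close>, and this radius gives \<open>r ^ n\<close> in Cauchy's
    estimate.\<close>
  define \<rho> where "\<rho> = 1 / r"
  have r: "r > 0" using C by simp
  then have \<rho>: "\<rho> > 0" by (simp add: \<rho>_def)
  have sub: "cball 0 \<rho> \<subseteq> \<Omega>"
  proof
    fix w :: complex assume "w \<in> cball 0 \<rho>"
    then have "cmod w * C \<le> \<rho> * C" using C by (intro mult_right_mono) auto
    also have "\<dots> < 1" using C r by (simp add: \<rho>_def)
    finally show "w \<in> \<Omega>" by (simp add: \<Omega>_def)
  qed
  have "continuous_on (cball 0 \<rho>) (\<lambda>w. R w x)"
    using cont sub by (auto simp: continuous_on_def intro: tendsto_within_subset)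
  then have "bounded ((\<lambda>w. R w x) ` cball 0 \<rho>)"
    by (intro compact_imp_bounded compact_continuous_image) auto
  then obtain M where M: "\<And>w. w \<in> cball 0 \<rho> \<Longrightarrow> norm (R w x) \<le> M"
    unfolding bounded_iff by blast
  have "norm ((T ^^ n) x) \<le> M * r ^ n" for n
  proof (cases "(T ^^ n) x = 0")
    case True
    have "0 \<le> M" using M[of 0] \<rho> norm_ge_zero order_trans by (metis centre_in_cball less_imp_le)
    then show ?thesis using True r by simp
  next
    case False
    define y where "y = (T ^^ n) x"
    have "norm ((deriv ^^ n) (\<lambda>w. cinner y (R w x)) 0) \<le> fact n * (norm y * M) / \<rho> ^ n"
    proof (rule Cauchy_inequality)
      show "(\<lambda>w. cinner y (R w x)) holomorphic_on ball 0 \<rho>"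
        by (rule holomorphic_on_subset[OF hol]) (use sub in auto)
      show "continuous_on (cball 0 \<rho>) (\<lambda>w. cinner y (R w x))"
        by (rule continuous_on_subset[OF holomorphic_on_imp_continuous_on[OF hol] sub])
      fix w :: complex assume "norm (0 - w) = \<rho>"
      then show "norm (cinner y (R w x)) \<le> norm y * M"
        using cmod_cinner_le[of y "R w x"] mult_left_mono[OF M[of w], of "norm y"] by simp
    qed (rule \<rho>)
    also have "norm ((deriv ^^ n) (\<lambda>w. cinner y (R w x)) 0) = fact n * (norm y)\<^sup>2"
      unfolding taylor y_def[symmetric] by (simp add: cinner_self norm_mult norm_power)
    finally have "fact n * (norm y)\<^sup>2 \<le> fact n * (norm y * M * r ^ n)"
      by (simp add: \<rho>_def power_divide mult.assoc)
    then have "norm y * norm y \<le> norm y * (M * r ^ n)" by (simp add: power2_eq_square mult.assoc)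
    then show ?thesis using False by (simp add: y_def)
  qed
  then show ?thesis by blast
qed

text \<open>The hypothesis on \<open>w\<close> places the spectrum of \<open>T\<close> in the closed
  disc of radius \<open>C\<close>. A violation at \<open>x\<close> would make the iterates grow at
  least like \<open>s ^ n\<close>, whereas the resolvent allows at most \<open>r ^ n\<close> for
  some \<open>r\<close> with \<open>C < r < s\<close>.\<close>

lemma normal_norm_bound:
  fixes T :: "'a::chilbert_space \<Rightarrow> 'a"
  assumes T: "bounded_clinear T" and adj: "adjoint_pair T T'" and comm: "\<And>x. T (T' x) = T' (T x)"
    and C: "0 \<le> C" and inv: "\<And>w. cmod w * C < 1 \<Longrightarrow> invertible_op (\<lambda>x. x - w *\<^sub>C T x)"
  shows "norm (T x) \<le> C * norm x"
proof (rule ccontr)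
  assume neg: "\<not> ?thesis"
  then have x: "norm x > 0" using bounded_clinear_zero[OF T] by auto
  define s where "s = norm (T x) / norm x"
  define r where "r = (C + s) / 2"
  have s: "C < s" "s * norm x = norm (T x)" using neg x by (auto simp: s_def field_simps)
  have r: "C < r" "r < s" "r > 0" using s C by (auto simp: r_def)
  obtain M where M: "\<And>n. norm ((T ^^ n) x) \<le> M * r ^ n"
    using power_bound_of_resolvent[OF T C r(1) inv] by blast
  have "1 < s / r" using r by simp
  then obtain n where n: "M / norm x < (s / r) ^ n" using real_arch_pow by blast
  have "s ^ n * norm x \<le> M * r ^ n"
    using normal_power_growth[OF adj comm, of s x n] s C M[of n] by simp
  then have "(s / r) ^ n \<le> M / norm x" using r x by (simp add: field_simps power_divide)
  then show False using n by simp
qed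

text \<open>With an empty spectrum the norm bound holds for \<open>C = 0\<close>, so
  \<open>N\<close> is the zero operator, whose spectrum contains 0.\<close>

lemma op_spectrum_normal_nonempty:
  fixes N :: "'a::chilbert_space \<Rightarrow> 'a" and v :: 'a
  assumes N: "bounded_clinear N" and adj: "adjoint_pair N M" and comm: "\<And>x. N (M x) = M (N x)"
    and v: "v \<noteq> 0"
  shows "op_spectrum N \<noteq> {}"
proof
  assume e: "op_spectrum N = {}"
  have "invertible_op (\<lambda>x. x - w *\<^sub>C N x)" for w
  proof -
    have "poly_op [:1, - w:] N = (\<lambda>x. x - w *\<^sub>C N x)"
      by (rule ext) (simp add: poly_op_pCons[OF N] poly_op_0 bounded_clinear_zero[OF N] scaleC_one
          bounded_clinear_scaleC[OF N] del: scaleC_minus_left, simp)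
    then show ?thesis using invertible_poly_op[OF N, of "[:1, - w:]"] e by simp
  qed
  then have "norm (N x) \<le> 0 * norm x" for x
    by (intro normal_norm_bound[OF N adj comm]) auto
  then have "N x = 0" for x by simp
  moreover have "invertible_op (\<lambda>x. N x - 0 *\<^sub>C x)" using e op_spectrum_iff[OF N] by blast
  ultimately have "inj (\<lambda>x :: 'a. 0 :: 'a)" by (simp add: invertible_op_def bij_def)
  then show False using v by (auto simp: inj_def)
qed

text \<open>For \<open>cmod w * C < 1\<close> the polynomial \<open>1 - w p\<close> has no zero on
  the spectrum, so \<open>1 - w p(N)\<close> is invertible. Together with
  \<open>cmod_poly_le_onorm\<close> this makes the norm of \<open>p(N)\<close> the supremum of
  \<open>|p|\<close> over the spectrum.\<close>

lemma onorm_poly_op_normal_le: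
  fixes N :: "'a::chilbert_space \<Rightarrow> 'a"
  assumes N: "bounded_clinear N" and adj: "adjoint_pair N M" and comm: "\<And>x. N (M x) = M (N x)"
    and ne: "op_spectrum N \<noteq> {}" and p: "\<And>z. z \<in> op_spectrum N \<Longrightarrow> cmod (poly p z) \<le> C"
  shows "onorm (poly_op p N) \<le> C"
proof (rule onorm_bound)
  show C: "0 \<le> C" using ne p norm_ge_zero order_trans by blast
  have M: "bounded_clinear M" by (rule bounded_clinear_adjoint[OF adj N])
  fix x
  show "norm (poly_op p N x) \<le> C * norm x"
  proof (rule normal_norm_bound[where T = "poly_op p N" and T' = "poly_op (map_poly cnj p) M"])
    show "poly_op p N (poly_op (map_poly cnj p) M u) = poly_op (map_poly cnj p) M (poly_op p N u)" for u
      by (rule poly_op_normal[OF N M comm])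
    fix w assume w: "cmod w * C < 1"
    define q where "q = [:1:] - smult w p"
    have nz: "poly q z \<noteq> 0" if "z \<in> op_spectrum N" for z
    proof
      assume "poly q z = 0"
      then have "1 = cmod w * cmod (poly p z)" by (simp add: q_def norm_mult[symmetric])
      also have "\<dots> \<le> cmod w * C" by (intro mult_left_mono p that) simp
      finally show False using w by simp
    qed
    then have "q \<noteq> 0" using ne by auto
    then have "invertible_op (poly_op q N)" using nz invertible_poly_op[OF N] by blast
    moreover have "poly_op q N = (\<lambda>x. x - w *\<^sub>C poly_op p N x)"
      by (rule ext) (simp only: q_def poly_op_diff[OF N] poly_op_const[OF N] poly_op_smult[OF N] scaleC_one)
    ultimately show "invertible_op (\<lambda>x. x - w *\<^sub>C poly_op p N x)" by simp
  qed (intro bounded_clinear_poly_op[OF N] poly_op_adjoint[OF N M adj] C)+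
qed

section \<open>From approximation of the conjugate to normality\<close>

text \<open>Polarization: a sesquilinear form that vanishes on the diagonal is zero.\<close>

lemma adjoint_pair_of_quadratic_form:
  fixes A B :: "'a::complex_inner \<Rightarrow> 'a"
  assumes A: "\<And>x y. A (x + y) = A x + A y" "\<And>c x. A (c *\<^sub>C x) = c *\<^sub>C A x"
    and B: "\<And>x y. B (x + y) = B x + B y" "\<And>c x. B (c *\<^sub>C x) = c *\<^sub>C B x"
    and q: "\<And>x. cinner (A x) x = cinner x (B x)"
  shows "adjoint_pair A B"
  unfolding adjoint_pair_def
proof (intro allI)
  fix x y
  define S where "S x y = cinner (A x) y - cinner x (B y)" for x y
  have S0: "S u u = 0" for u by (simp add: S_def q)
  have "S (x + y) (x + y) = S x x + S x y + S y x + S y y"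
    by (simp add: S_def A B cinner_simps)
  then have 1: "S x y + S y x = 0" by (simp add: S0)
  have "S (x + \<i> *\<^sub>C y) (x + \<i> *\<^sub>C y) = S x x + \<i> * S x y - \<i> * S y x + S y y"
    by (simp add: S_def A B cinner_simps algebra_simps)
  then have "\<i> * (S x y - S y x) = 0" by (simp add: S0 algebra_simps)
  then have "S x y = S y x" by simp
  then show "cinner (A x) y = cinner x (B y)" using 1 by (simp add: S_def)
qed

text \<open>\<open>K\<close> will be the spectrum of \<open>N\<close>, and \<open>bound\<close> is
  what the norm equalities say about \<open>A\<close>. Everything about \<open>A\<close> is drawn
  from this inequality, without its own spectrum.\<close>

lemma normal_op_of_cnj_approximation:
  fixes A :: "'a::chilbert_space \<Rightarrow> 'a"
  assumes A: "bounded_clinear A" and K: "compact K"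
    and cnj: "\<And>e. e > 0 \<Longrightarrow> \<exists>p. \<forall>z\<in>K. cmod (cnj z - poly p z) < e"
    and bound: "\<And>p C x. 0 \<le> C \<Longrightarrow> (\<And>z. z \<in> K \<Longrightarrow> cmod (poly p z) \<le> C) \<Longrightarrow>
       norm (poly_op p A x) \<le> C * norm x"
  shows "normal_op A"
proof -
  obtain M where M: "M > 0" "\<And>z. z \<in> K \<Longrightarrow> cmod z \<le> M"
    using compact_imp_bounded[OF K] by (auto simp: bounded_pos)
  define \<epsilon> where "\<epsilon> n = inverse (real (Suc n))" for n
  have \<epsilon>0: "\<epsilon> n > 0" for n by (simp add: \<epsilon>_def)
  have \<epsilon>lim: "\<epsilon> \<longlonglongrightarrow> 0" unfolding \<epsilon>_def by (rule LIMSEQ_inverse_real_of_nat)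
  have "\<exists>p. \<forall>z\<in>K. cmod (cnj z - poly p z) < \<epsilon> n" for n using cnj[OF \<epsilon>0] .
  then obtain P where P: "\<And>n z. z \<in> K \<Longrightarrow> cmod (cnj z - poly (P n) z) < \<epsilon> n" by metis
  define X where "X x n = poly_op (P n) A x" for x n
  have diff: "norm (X x i - X x j) \<le> (\<epsilon> i + \<epsilon> j) * norm x" for x i j
    unfolding X_def poly_op_diff[OF A, symmetric]
  proof (rule bound)
    show "0 \<le> \<epsilon> i + \<epsilon> j" using \<epsilon>0[of i] \<epsilon>0[of j] by simp
    show "cmod (poly (P i - P j) z) \<le> \<epsilon> i + \<epsilon> j" if "z \<in> K" for z
      using norm_triangle_ineq4[of "cnj z - poly (P j) z" "cnj z - poly (P i) z"]
        P[OF that, of i] P[OF that, of j] by simp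
  qed
  have "Cauchy (X x)" for x
  proof (rule metric_CauchyI)
    fix e :: real assume e: "e > 0"
    have "(\<lambda>n. 2 * norm x * \<epsilon> n) \<longlonglongrightarrow> 0" by (rule tendsto_mult_right_zero[OF \<epsilon>lim])
    then have "\<forall>\<^sub>F n in sequentially. 2 * norm x * \<epsilon> n < e" using e by (rule order_tendstoD)
    then obtain m where m: "2 * norm x * \<epsilon> m < e" using eventually_happens'[OF sequentially_bot] by blast
    show "\<exists>M. \<forall>i\<ge>M. \<forall>j\<ge>M. dist (X x i) (X x j) < e"
    proof (intro exI allI impI)
      fix i j assume "m \<le> i" "m \<le> j"
      then have "\<epsilon> i \<le> \<epsilon> m" "\<epsilon> j \<le> \<epsilon> m" by (auto simp: \<epsilon>_def)
      then have "(\<epsilon> i + \<epsilon> j) * norm x \<le> (\<epsilon> m + \<epsilon> m) * norm x" by (intro mult_right_mono) auto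
      then show "dist (X x i) (X x j) < e"
        using diff[of x i j] m by (simp add: dist_norm algebra_simps)
    qed
  qed
  then have "\<exists>y. X x \<longlonglongrightarrow> y" for x using Cauchy_convergent_iff convergent_def by blast
  then obtain B where B: "\<And>x. X x \<longlonglongrightarrow> B x" by metis
  note PA = bounded_clinear_poly_op[OF A]
  have Badd: "B (x + y) = B x + B y" for x y
  proof (rule LIMSEQ_unique[OF B])
    have "X (x + y) = (\<lambda>n. X x n + X y n)" by (rule ext) (simp add: X_def bounded_clinear_add[OF PA])
    then show "X (x + y) \<longlonglongrightarrow> B x + B y" using tendsto_add[OF B B] by simp
  qed
  have Bscale: "B (c *\<^sub>C x) = c *\<^sub>C B x" for c x
  proof (rule LIMSEQ_unique[OF B])
    have "X (c *\<^sub>C x) = (\<lambda>n. c *\<^sub>C X x n)" by (rule ext) (simp add: X_def bounded_clinear_scaleC[OF PA])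
    then show "X (c *\<^sub>C x) \<longlonglongrightarrow> c *\<^sub>C B x" using tendsto_scaleC[OF tendsto_const B] by simp
  qed
  have comm: "A (B x) = B (A x)" for x
  proof (rule LIMSEQ_unique[OF _ B])
    have "X (A x) = (\<lambda>n. A (X x n))" by (rule ext) (simp add: X_def poly_op_commute[OF A A])
    then show "X (A x) \<longlonglongrightarrow> A (B x)"
      using bounded_linear.tendsto[OF bounded_clinear_bounded_linear[OF A] B] by simp
  qed
  text \<open>On \<^term>\<open>K\<close> the function \<^term>\<open>\<lambda>z. c * z + cnj (c * z)\<close> is real, so
    \<^term>\<open>\<lambda>z. 1 + \<i> * t * (c * z + cnj (c * z))\<close> has norm \<open>1 + O(t\<^sup>2)\<close>; comparing the terms
    linear in \<^term>\<open>t\<close> makes the quadratic form of the limit operator real.\<close>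
  have real_form: "Im (cinner x (c *\<^sub>C A x + cnj c *\<^sub>C B x)) = 0" for c x
  proof -
    \<comment> \<open>\<open>2 * cmod c * M\<close> bounds the real function
      \<open>c * z + cnj (c * z)\<close> on \<open>K\<close>.\<close>
    define D where "D = (2 * cmod c * M)\<^sup>2"
    define q where "q = cinner x (c *\<^sub>C A x + cnj c *\<^sub>C B x)"
    have "0 \<le> t * (2 * Im q) + t\<^sup>2 * (D * (norm x)\<^sup>2)" for t :: real
    proof -
      \<comment> \<open>\<open>[:- 0, 1:]\<close> is the polynomial \<open>z\<close>, in the form
        that \<open>poly_op_linear_factor\<close> rewrites.\<close>
      define Q where "Q n = [:1:] + smult (\<i> * of_real t) (smult c [:- 0, 1:] + smult (cnj c) (P n))" for n
      define r where "r n = sqrt (1 + t\<^sup>2 * D) + \<bar>t\<bar> * cmod c * \<epsilon> n" for n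
      have "norm (poly_op (Q n) A x) \<le> r n * norm x" for n
      proof (rule bound)
        show "0 \<le> r n" unfolding r_def D_def using \<epsilon>0[of n] by (intro add_nonneg_nonneg) auto
        fix z assume z: "z \<in> K"
        define s where "s = 2 * Re (c * z)"
        have s: "c * z + cnj c * cnj z = of_real s"
          using complex_add_cnj[of "c * z"] by (simp add: s_def)
        have "poly (Q n) z = (1 + \<i> * of_real (t * s)) - \<i> * of_real t * cnj c * (cnj z - poly (P n) z)"
          unfolding of_real_mult s[symmetric] by (simp add: Q_def algebra_simps)
        then have "cmod (poly (Q n) z) \<le> cmod (1 + \<i> * of_real (t * s))
            + cmod (\<i> * of_real t * cnj c * (cnj z - poly (P n) z))"
          using norm_triangle_ineq4 by metis
        also have "cmod (1 + \<i> * of_real (t * s)) = sqrt (1 + (t * s)\<^sup>2)" by (simp add: cmod_def)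
        also have "\<dots> \<le> sqrt (1 + t\<^sup>2 * D)"
        proof -
          have "cmod z \<le> M" using M(2)[OF z] .
          then have "cmod c * cmod z \<le> cmod c * M" by (intro mult_left_mono) auto
          then have "\<bar>s\<bar> \<le> 2 * cmod c * M"
            using abs_Re_le_cmod[of "c * z"] by (simp add: s_def norm_mult)
          then have "\<bar>s\<bar>\<^sup>2 \<le> D" unfolding D_def by (intro power_mono) auto
          then have "t\<^sup>2 * s\<^sup>2 \<le> t\<^sup>2 * D" by (intro mult_left_mono) auto
          then show ?thesis by (simp add: power_mult_distrib)
        qed
        also have "cmod (\<i> * of_real t * cnj c * (cnj z - poly (P n) z)) \<le> \<bar>t\<bar> * cmod c * \<epsilon> n"
          unfolding norm_mult using P[OF z, of n] by (auto intro!: mult_left_mono)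
        finally show "cmod (poly (Q n) z) \<le> r n" by (simp add: r_def)
      qed
      moreover have "poly_op (Q n) A x = x + (\<i> * of_real t) *\<^sub>C (c *\<^sub>C A x + cnj c *\<^sub>C X x n)" for n
        unfolding Q_def poly_op_add[OF A] poly_op_smult[OF A] poly_op_const[OF A] poly_op_linear_factor[OF A]
        by (simp add: X_def scaleC_one)
      ultimately have le: "norm (x + (\<i> * of_real t) *\<^sub>C (c *\<^sub>C A x + cnj c *\<^sub>C X x n)) \<le> r n * norm x" for n
        by simp
      have "r \<longlonglongrightarrow> sqrt (1 + t\<^sup>2 * D) + \<bar>t\<bar> * cmod c * 0"
        unfolding r_def by (intro tendsto_intros \<epsilon>lim)
      then have rlim: "(\<lambda>n. r n * norm x) \<longlonglongrightarrow> sqrt (1 + t\<^sup>2 * D) * norm x"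
        by (intro tendsto_mult tendsto_const) simp
      define y where "y = c *\<^sub>C A x + cnj c *\<^sub>C B x"
      have "(\<lambda>n. norm (x + (\<i> * of_real t) *\<^sub>C (c *\<^sub>C A x + cnj c *\<^sub>C X x n)))
          \<longlonglongrightarrow> norm (x + (\<i> * of_real t) *\<^sub>C y)"
        unfolding y_def by (intro tendsto_norm tendsto_add tendsto_const tendsto_scaleC B)
      from LIMSEQ_le[OF this rlim] le
      have "norm (x + (\<i> * of_real t) *\<^sub>C y) \<le> sqrt (1 + t\<^sup>2 * D) * norm x" by blast
      then have "(norm (x + (\<i> * of_real t) *\<^sub>C y))\<^sup>2 \<le> (sqrt (1 + t\<^sup>2 * D) * norm x)\<^sup>2"
        by (intro power_mono) auto
      also have "\<dots> = (1 + t\<^sup>2 * D) * (norm x)\<^sup>2"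
        by (simp add: power_mult_distrib D_def)
      finally have "(norm x)\<^sup>2 + 2 * Re (cinner x ((\<i> * of_real t) *\<^sub>C y)) \<le> (1 + t\<^sup>2 * D) * (norm x)\<^sup>2"
        unfolding norm_add_sq using zero_le_power2[of "norm ((\<i> * of_real t) *\<^sub>C y)"] by linarith
      moreover have "Re (cinner x ((\<i> * of_real t) *\<^sub>C y)) = - t * Im q"
        by (simp add: cinner_scaleC_right q_def y_def)
      ultimately show ?thesis by (simp add: algebra_simps)
    qed
    then have "2 * Im q = 0" by (rule linear_term_zero) (simp add: D_def)
    then show ?thesis by (simp add: q_def)
  qed
  have "cinner (A x) x = cinner x (B x)" for x
  proof -
    define a b where "a = cinner x (A x)" and "b = cinner x (B x)"
    \<comment> \<open>\<open>c = 1\<close> makes the imaginary parts of \<open>a\<close> and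
      \<open>b\<close> opposite, \<open>c = \<i>\<close> makes the real parts equal.\<close>
    have "Im (a + b) = 0" using real_form[of x 1] by (simp add: scaleC_one cinner_add_right a_def b_def)
    moreover have "Im (\<i> * a - \<i> * b) = 0"
      using real_form[of x \<i>] by (simp add: cinner_simps a_def b_def)
    ultimately have "b = cnj a" by (simp add: complex_eq_iff)
    then show ?thesis unfolding a_def b_def by (metis cinner_commute)
  qed
  then have "adjoint_pair A B"
    by (intro adjoint_pair_of_quadratic_form bounded_clinear_add[OF A] bounded_clinear_scaleC[OF A] Badd Bscale)
  then have "cadjoint A = B" by (rule cadjoint_eq)
  then show ?thesis unfolding normal_op_def by (simp only:) (simp add: fun_eq_iff comm)
qed

section \<open>Spectra that are not Lavrentieff sets\<close>

text \<open>For a disc in a hole this is the maximum principle: the frontier of a component of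
  \<open>- K\<close> lies in \<open>K\<close>.\<close>

lemma not_lavrentieff_polynomial_bound:
  assumes K: "compact K" and nl: "\<not> lavrentieff K"
  shows "\<exists>a r. 0 < r \<and> (\<forall>p C. (\<forall>z\<in>K. cmod (poly p z) \<le> C) \<longrightarrow> (\<forall>z\<in>ball a r. cmod (poly p z) \<le> C))"
proof (cases "interior K = {}")
  case False
  then obtain a where "a \<in> interior K" by blast
  then obtain r where "r > 0" "ball a r \<subseteq> K" using mem_interior by blast
  then show ?thesis by blast
next
  case True
  then have "\<not> connected (- K)" using K nl by (simp add: lavrentieff_def)
  \<comment> \<open>In the plane the complement of a bounded set has only one unbounded component,
    so a disconnected complement has a bounded one.\<close>
  have "\<exists>x\<in>- K. bounded (connected_component_set (- K) x)"
  proof (rule ccontr)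
    assume unb: "\<not> ?thesis"
    have "connected_component_set (- K) x = connected_component_set (- K) y" if "x \<in> - K" "y \<in> - K" for x y
      by (rule cobounded_unique_unbounded_component) (use unb that K in \<open>auto simp: compact_imp_bounded\<close>)
    then have "connected (- K)"
      unfolding connected_iff_connected_component
      by (metis connected_component_refl mem_Collect_eq)
    then show False using \<open>\<not> connected (- K)\<close> by simp
  qed
  then obtain x where x: "x \<in> - K" and bd: "bounded (connected_component_set (- K) x)" by blast
  define U where "U = connected_component_set (- K) x"
  have "open (- K)" using K by (simp add: compact_imp_closed open_Compl)
  then have "open U" unfolding U_def by (rule open_connected_component)
  moreover have "x \<in> U" using x by (simp add: U_def)
  ultimately obtain r where r: "r > 0" "ball x r \<subseteq> U" using openE by blast
  have "frontier U \<subseteq> frontier (- K)" unfolding U_def by (rule frontier_of_connected_component_subset)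
  then have fr: "frontier U \<subseteq> K" using K by (simp add: frontier_complement frontier_subset_closed compact_imp_closed subset_trans)
  have "cmod (poly p z) \<le> C" if p: "\<forall>z\<in>K. cmod (poly p z) \<le> C" and z: "z \<in> ball x r" for p C z
  proof (rule maximum_modulus_frontier[where f = "poly p" and S = U])
    show "poly p holomorphic_on interior U" by (rule poly_holomorphic_on[OF holomorphic_on_ident])
    show "continuous_on (closure U) (poly p)" by (intro continuous_intros)
    show "bounded U" using bd by (simp add: U_def)
    show "cmod (poly p w) \<le> C" if "w \<in> frontier U" for w using p fr that by blast
    show "z \<in> U" using z r(2) by blast
  qed
  then show ?thesis using r(1) by blast
qed

text \<open>Scaled to a self-map \<open>g\<close> of the unit disc, \<open>f\<close> is followed by
  the Moebius map that sends \<open>g 0\<close> to 0; Schwarz's lemma bounds the derivative at 0.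
  Strictness of the bound by \<open>C\<close> keeps the denominator
  \<open>1 - cnj w * g \<zeta>\<close> nonzero, also for constant \<open>f\<close>.\<close>

lemma schwarz_pick_centre:
  assumes hol: "f holomorphic_on ball a r" and r: "0 < r" and C: "\<And>z. z \<in> ball a r \<Longrightarrow> cmod (f z) < C"
  shows "C * (r * cmod (deriv f a)) \<le> C\<^sup>2 - (cmod (f a))\<^sup>2"
proof -
  have C0: "C > 0" using C[of a] r norm_ge_zero[of "f a"] by (intro order_le_less_trans[of 0 "cmod (f a)" C]) auto
  define g where "g \<zeta> = f (a + of_real r * \<zeta>) / of_real C" for \<zeta>
  have inb: "a + of_real r * \<zeta> \<in> ball a r" if "cmod \<zeta> < 1" for \<zeta>
    using that r by (simp add: dist_norm norm_mult)
  have holg: "g holomorphic_on ball 0 1"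
    unfolding g_def
    by (intro holomorphic_intros holomorphic_on_compose_gen[OF _ hol, unfolded o_def]) (use inb C0 in auto)
  have g1: "cmod (g \<zeta>) < 1" if "cmod \<zeta> < 1" for \<zeta>
    using C[OF inb[OF that]] C0 by (simp add: g_def norm_divide)
  define w where "w = g 0"
  have w1: "cmod w < 1" unfolding w_def by (rule g1) simp
  have nz: "1 - cnj w * g \<zeta> \<noteq> 0" if "cmod \<zeta> < 1" for \<zeta>
  proof -
    have "cmod (cnj w * g \<zeta>) \<le> cmod w * 1"
      unfolding norm_mult using g1[OF that] by (intro mult_mono) auto
    then show ?thesis using w1 by auto
  qed
  define h where "h \<zeta> = (g \<zeta> - w) / (1 - cnj w * g \<zeta>)" for \<zeta>
  have holh: "h holomorphic_on ball 0 1"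
    unfolding h_def by (intro holomorphic_intros holg) (use nz in auto)
  have h0: "h 0 = 0" by (simp add: h_def w_def)
  have h1: "cmod (h \<zeta>) < 1" if "cmod \<zeta> < 1" for \<zeta>
    using Moebius_function_norm_lt_1[OF w1 g1[OF that], of 0]
    by (simp add: Moebius_function_def h_def)
  have "cmod (deriv h 0) \<le> 1"
    using Schwarz_Lemma(2)[OF holh h0 h1, of 0] by simp
  moreover have "deriv h 0 = deriv g 0 / (1 - cnj w * w)"
  proof -
    have dg: "(g has_field_derivative deriv g 0) (at 0)"
      using holomorphic_derivI[OF holg open_ball] by simp
    have n0: "1 - cnj w * g 0 \<noteq> 0" by (rule nz) simp
    have "(h has_field_derivative (deriv g 0 * (1 - cnj w * g 0) - (g 0 - w) * (0 - cnj w * deriv g 0)) /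
        ((1 - cnj w * g 0) * (1 - cnj w * g 0))) (at 0)"
      unfolding h_def by (rule derivative_eq_intros dg n0 refl | simp add: n0)+
    then have "deriv h 0 = (deriv g 0 * (1 - cnj w * w)) / ((1 - cnj w * w) * (1 - cnj w * w))"
      by (intro DERIV_imp_deriv) (simp add: w_def)
    then show ?thesis using n0 by (simp add: w_def)
  qed
  moreover have "1 - cnj w * w = of_real (1 - (cmod w)\<^sup>2)"
    unfolding of_real_diff of_real_1 complex_norm_square by simp
  moreover have w2: "1 - (cmod w)\<^sup>2 > 0" using w1 by (simp add: abs_square_less_1)
  ultimately have "cmod (deriv g 0) \<le> 1 - (cmod w)\<^sup>2"
    by (simp only: norm_divide norm_of_real) (simp add: divide_le_eq)
  moreover have "deriv g 0 = deriv f a * of_real r / of_real C"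
  proof -
    have "(f has_field_derivative deriv f a) (at (a + of_real r * 0))"
      using holomorphic_derivI[OF hol open_ball, of a] r by simp
    then have "(g has_field_derivative deriv f a * of_real r / of_real C) (at 0)"
      unfolding g_def using C0
      by (intro DERIV_cdivide DERIV_chain2[where g = "\<lambda>\<zeta>. a + of_real r * \<zeta>"])
         (auto intro!: derivative_eq_intros)
    then show ?thesis by (rule DERIV_imp_deriv)
  qed
  ultimately have "cmod (deriv f a) * r / C \<le> 1 - (cmod (f a) / C)\<^sup>2"
    using r C0 by (simp add: norm_mult norm_divide w_def g_def)
  then have "C\<^sup>2 * (cmod (deriv f a) * r / C) \<le> C\<^sup>2 * (1 - (cmod (f a) / C)\<^sup>2)"
    by (intro mult_left_mono) auto
  moreover have "C\<^sup>2 * (cmod (deriv f a) * r / C) = C * (r * cmod (deriv f a))"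
    using C0 by (simp add: power2_eq_square)
  moreover have "C\<^sup>2 * (1 - (cmod (f a) / C)\<^sup>2) = C\<^sup>2 - (cmod (f a))\<^sup>2"
    using C0 by (simp add: power_divide right_diff_distrib)
  ultimately show ?thesis by simp
qed

text \<open>The left-hand side is the squared length of the image of \<open>(u, v)\<close> under \<open>p\<close> of the
  Jordan block with eigenvalue \<^term>\<open>a\<close> and off-diagonal entry \<^term>\<open>r\<close>.\<close>

lemma jordan_block_bound:
  fixes \<alpha> \<beta> u v :: complex
  assumes \<beta>: "C * cmod \<beta> \<le> C\<^sup>2 - (cmod \<alpha>)\<^sup>2" and C: "0 < C"
  shows "(cmod (\<alpha> * u + \<beta> * v))\<^sup>2 + (cmod (\<alpha> * v))\<^sup>2 \<le> C\<^sup>2 * ((cmod u)\<^sup>2 + (cmod v)\<^sup>2)"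
proof -
  define s where "s = cmod \<alpha> / C"
  define b where "b = 1 - s\<^sup>2"
  have \<alpha>: "cmod \<alpha> = C * s" and s: "0 \<le> s" using C by (simp_all add: s_def)
  have "C * cmod \<beta> \<le> C * (C * b)" using \<beta> unfolding \<alpha> b_def
    by (simp add: power2_eq_square algebra_simps)
  then have \<beta>': "cmod \<beta> \<le> C * b" using C by simp
  then have b: "b \<ge> 0" using C norm_ge_zero[of \<beta>] by (metis order_trans zero_le_mult_iff not_less)
  define x y where "x = cmod u" and "y = cmod v"
  have "cmod (\<alpha> * u + \<beta> * v) \<le> cmod \<alpha> * cmod u + cmod \<beta> * cmod v"
    by (metis norm_mult norm_triangle_ineq)
  also have "\<dots> \<le> C * s * x + C * b * y"
    unfolding \<alpha> x_def y_def by (intro add_mono mult_right_mono \<beta>') (use s C in auto)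
  finally have "(cmod (\<alpha> * u + \<beta> * v))\<^sup>2 \<le> (C * s * x + C * b * y)\<^sup>2" by (rule power_mono) simp
  moreover have "(cmod (\<alpha> * v))\<^sup>2 = (C * s * y)\<^sup>2" by (simp add: norm_mult \<alpha> y_def)
  \<comment> \<open>With the extreme entry \<open>C * b\<close> the defect is a perfect square times
    \<open>b\<close>, because \<open>b = 1 - s\<^sup>2\<close>.\<close>
  moreover have "C\<^sup>2 * (x\<^sup>2 + y\<^sup>2) - ((C * s * x + C * b * y)\<^sup>2 + (C * s * y)\<^sup>2) = C\<^sup>2 * b * (x - s * y)\<^sup>2"
    by (simp add: b_def power2_eq_square algebra_simps)
  moreover have "C\<^sup>2 * b * (x - s * y)\<^sup>2 \<ge> 0" using b by simp
  ultimately show ?thesis by (simp add: x_def y_def)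
qed

text \<open>\<open>V\<close> maps the space unitarily onto the orthogonal complement of
  \<open>e0\<close> and \<open>e1\<close>; \<open>W\<close> inverts it there and kills both vectors.
  So \<open>V N W\<close> is a copy of \<open>N\<close> that leaves a plane free for the Jordan
  block.\<close>

context
  fixes V W :: "'a::chilbert_space \<Rightarrow> 'a" and e0 e1 :: 'a
  assumes V: "\<And>x y. V (x + y) = V x + V y" "\<And>c x. V (c *\<^sub>C x) = c *\<^sub>C V x" "\<And>x. norm (V x) = norm x"
    and WV: "\<And>x. W (V x) = x"
    and VW: "\<And>x. V (W x) = x - cinner e0 x *\<^sub>C e0 - cinner e1 x *\<^sub>C e1"
    and e: "cinner e0 e0 = 1" "cinner e1 e1 = 1" "cinner e0 e1 = 0" 
    and orth: "\<And>x. cinner e0 (V x) = 0" "\<And>x. cinner e1 (V x) = 0"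
begin

private lemma e10: "cinner e1 e0 = 0"
  using e(3) cinner_commute[of e1 e0] by simp

private lemma V_eqI: "V x = V y \<Longrightarrow> x = y"
  using WV by metis

private lemma bounded_clinear_V: "bounded_clinear V"
  by (rule bounded_clinearI[where K = 1]) (simp_all add: V)

private lemma norm_V_plus:
  "(norm (V x + (b *\<^sub>C e0 + c *\<^sub>C e1)))\<^sup>2 = (norm x)\<^sup>2 + ((cmod b)\<^sup>2 + (cmod c)\<^sup>2)"
proof -
  have n: "norm e0 = 1" "norm e1 = 1"
    using e by (simp_all add: norm_eq_sqrt_cinner)
  have "cinner (V x) e0 = 0" "cinner (V x) e1 = 0"
    using orth cinner_commute[of "V x"] by simp_all
  then have "cinner (V x) (b *\<^sub>C e0 + c *\<^sub>C e1) = 0" by (simp add: cinner_simps)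
  then have "(norm (V x + (b *\<^sub>C e0 + c *\<^sub>C e1)))\<^sup>2 = (norm (V x))\<^sup>2 + (norm (b *\<^sub>C e0 + c *\<^sub>C e1))\<^sup>2"
    by (rule norm_add_sq_orthogonal)
  also have "(norm (b *\<^sub>C e0 + c *\<^sub>C e1))\<^sup>2 = (norm (b *\<^sub>C e0))\<^sup>2 + (norm (c *\<^sub>C e1))\<^sup>2"
    by (rule norm_add_sq_orthogonal) (simp add: cinner_simps e)
  finally show ?thesis by (simp add: V norm_scaleC n)
qed

private lemma decompose: "x = V (W x) + (cinner e0 x *\<^sub>C e0 + cinner e1 x *\<^sub>C e1)"
  by (simp add: VW)

private lemma norm_decompose:
  "(norm x)\<^sup>2 = (norm (W x))\<^sup>2 + ((cmod (cinner e0 x))\<^sup>2 + (cmod (cinner e1 x))\<^sup>2)"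
  using norm_V_plus[of "W x" "cinner e0 x" "cinner e1 x"] decompose[of x] by simp

private lemma bounded_clinear_W: "bounded_clinear W"
proof (rule bounded_clinearI[where K = 1])
  show "W (x + y) = W x + W y" for x y
    by (rule V_eqI) (simp add: V VW cinner_simps scaleC_simps)
  show "W (c *\<^sub>C x) = c *\<^sub>C W x" for c x
    by (rule V_eqI) (simp add: V VW cinner_simps scaleC_simps)
  show "norm (W x) \<le> 1 * norm x" for x
  proof -
    have "(norm (W x))\<^sup>2 \<le> (norm x)\<^sup>2" unfolding norm_decompose[of x] by simp
    then show ?thesis by (simp add: power_mono_iff)
  qed
qed

private lemma W_e: "W e0 = 0" "W e1 = 0"
proof -
  have V0: "V 0 = 0" by (rule bounded_clinear_zero[OF bounded_clinear_V])
  show "W e0 = 0" by (rule V_eqI) (simp add: V0 VW e e10 scaleC_one)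
  show "W e1 = 0" by (rule V_eqI) (simp add: V0 VW e e10 scaleC_one)
qed

text \<open>\<open>p(A)\<close> is a copy of \<open>p(N)\<close> together with the triangular matrix
  that has \<open>p(a)\<close> on the diagonal and \<open>r * p'(a)\<close> above it. Schwarz-Pick
  gives exactly the entry bound that \<open>jordan_block_bound\<close> asks for; the reverse
  inequality comes from vectors in the range of \<open>V\<close>.\<close>

lemma exists_nonnormal_dilation:
  fixes N :: "'a \<Rightarrow> 'a"
  assumes N: "bounded_clinear N" and r: "0 < r"
    and disc: "\<And>p z. z \<in> ball a r \<Longrightarrow> cmod (poly p z) \<le> onorm (poly_op p N)"
  shows "\<exists>A :: 'a \<Rightarrow> 'a. bounded_clinear A \<and> (\<forall>p. onorm (poly_op p A) = onorm (poly_op p N)) \<and> \<not> normal_op A"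
proof -
  define A where "A x = V (N (W x)) + ((a * cinner e0 x + of_real r * cinner e1 x) *\<^sub>C e0
      + (a * cinner e1 x) *\<^sub>C e1)" for x
  have rank1: "bounded_clinear (\<lambda>x. cinner u x *\<^sub>C v)" for u v :: 'a
  proof (rule bounded_clinearI[where K = "norm u * norm v"])
    show "norm (cinner u x *\<^sub>C v) \<le> norm u * norm v * norm x" for x
      using mult_right_mono[OF cmod_cinner_le[of u x], of "norm v"] by (simp add: norm_scaleC mult_ac)
  qed (simp_all add: cinner_simps scaleC_simps)
  have A_eq: "A = (\<lambda>x. V (N (W x)) + (a *\<^sub>C (cinner e0 x *\<^sub>C e0) + of_real r *\<^sub>C (cinner e1 x *\<^sub>C e0)
      + a *\<^sub>C (cinner e1 x *\<^sub>C e1)))"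
    by (rule ext) (simp add: A_def scaleC_simps)
  have A: "bounded_clinear A"
    unfolding A_eq
    by (intro bounded_clinear_plus bounded_clinear_scaled rank1
        bounded_clinear_compose[OF bounded_clinear_V bounded_clinear_compose[OF N bounded_clinear_W]])
  have PA: "poly_op p A x = V (poly_op p N (W x)) +
      ((poly p a * cinner e0 x + of_real r * poly (pderiv p) a * cinner e1 x) *\<^sub>C e0 + (poly p a * cinner e1 x) *\<^sub>C e1)" for p x
  proof (induction p)
    case 0
    have "V 0 = 0" by (rule bounded_clinear_zero[OF bounded_clinear_V])
    then show ?case by (simp add: poly_op_0)
  next
    case (pCons c p)
    define y where "y = poly_op p N (W x)"
    define s where "s = poly p a * cinner e0 x + of_real r * poly (pderiv p) a * cinner e1 x"
    define t where "t = poly p a * cinner e1 x"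
    have y: "poly_op p A x = V y + (s *\<^sub>C e0 + t *\<^sub>C e1)"
      using pCons(2) by (simp add: y_def s_def t_def)
    have Wy: "W (V y + (s *\<^sub>C e0 + t *\<^sub>C e1)) = y"
      by (simp add: bounded_clinear_add[OF bounded_clinear_W] bounded_clinear_scaleC[OF bounded_clinear_W] WV W_e)
    have Ay: "A (poly_op p A x) = V (N y) + ((a * s + of_real r * t) *\<^sub>C e0 + (a * t) *\<^sub>C e1)"
      unfolding y A_def Wy by (simp add: cinner_simps e e10 orth)
    have cx: "c *\<^sub>C x = V (c *\<^sub>C W x) + ((c * cinner e0 x) *\<^sub>C e0 + (c * cinner e1 x) *\<^sub>C e1)"
      by (subst decompose[of x]) (simp add: V scaleC_simps)
    have "poly_op (pCons c p) A x = V (c *\<^sub>C W x + N y)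
        + ((c * cinner e0 x + (a * s + of_real r * t)) *\<^sub>C e0 + (c * cinner e1 x + a * t) *\<^sub>C e1)"
      unfolding poly_op_pCons[OF A] Ay by (subst cx) (simp add: V scaleC_simps)
    moreover have "c *\<^sub>C W x + N y = poly_op (pCons c p) N (W x)"
      by (simp add: poly_op_pCons[OF N] y_def)
    moreover have "c * cinner e0 x + (a * s + of_real r * t)
        = poly (pCons c p) a * cinner e0 x + of_real r * poly (pderiv (pCons c p)) a * cinner e1 x"
      by (simp add: s_def t_def pderiv_pCons algebra_simps)
    moreover have "c * cinner e1 x + a * t = poly (pCons c p) a * cinner e1 x"
      by (simp add: t_def algebra_simps)
    ultimately show ?case by simp
  qed
  have "onorm (poly_op p A) = onorm (poly_op p N)" for p
  proof (rule antisym)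
    define C where "C = onorm (poly_op p N)"
    note PN = bounded_clinear_poly_op[OF N]
    have C0: "C \<ge> 0" unfolding C_def by (rule onorm_pos_le[OF bounded_clinear_bounded_linear[OF PN]])
    show "onorm (poly_op p A) \<le> onorm (poly_op p N)"
    \<comment> \<open>Schwarz-Pick asks for a strict bound on the disc, but \<open>|p|\<close> can
      equal the norm there, for instance for constant \<open>p\<close>. Hence the slightly larger
      \<open>C'\<close>.\<close>
    proof (rule dense_ge)
      fix C' assume C': "onorm (poly_op p N) < C'"
      have C'0: "C' > 0" using C0 C' by (simp add: C_def)
      show "onorm (poly_op p A) \<le> C'"
      proof (rule onorm_bound)
        fix x
        define s where "s = poly p a * cinner e0 x + of_real r * poly (pderiv p) a * cinner e1 x"
        define t where "t = poly p a * cinner e1 x"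
        have "C' * (r * cmod (deriv (poly p) a)) \<le> C'\<^sup>2 - (cmod (poly p a))\<^sup>2"
          by (rule schwarz_pick_centre[OF poly_holomorphic_on[OF holomorphic_on_ident] r])
             (rule le_less_trans[OF disc C'])
        moreover have "deriv (poly p) a = poly (pderiv p) a" by (rule DERIV_imp_deriv[OF poly_DERIV])
        ultimately have "C' * cmod (of_real r * poly (pderiv p) a) \<le> C'\<^sup>2 - (cmod (poly p a))\<^sup>2"
          using r by (simp add: norm_mult)
        then have st: "(cmod s)\<^sup>2 + (cmod t)\<^sup>2 \<le> C'\<^sup>2 * ((cmod (cinner e0 x))\<^sup>2 + (cmod (cinner e1 x))\<^sup>2)"
          unfolding s_def t_def by (rule jordan_block_bound[OF _ C'0])
        have "norm (poly_op p N (W x)) \<le> C * norm (W x)"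
          unfolding C_def by (rule norm_le_onorm[OF PN])
        also have "\<dots> \<le> C' * norm (W x)" using C' by (intro mult_right_mono) (auto simp: C_def)
        finally have "(norm (poly_op p N (W x)))\<^sup>2 \<le> (C' * norm (W x))\<^sup>2" by (intro power_mono) auto
        then have "(norm (poly_op p A x))\<^sup>2 \<le> (C' * norm (W x))\<^sup>2
            + C'\<^sup>2 * ((cmod (cinner e0 x))\<^sup>2 + (cmod (cinner e1 x))\<^sup>2)"
          unfolding PA norm_V_plus using st by (simp add: s_def t_def)
        also have "\<dots> = (C' * norm x)\<^sup>2"
          unfolding power_mult_distrib norm_decompose[of x] by (simp add: algebra_simps)
        finally show "norm (poly_op p A x) \<le> C' * norm x"
          by (rule power2_le_imp_le) (use C'0 in simp)
      qed (use C'0 in simp)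
    qed
    show "onorm (poly_op p N) \<le> onorm (poly_op p A)"
    proof (rule onorm_bound)
      note PA' = bounded_clinear_poly_op[OF A]
      show "0 \<le> onorm (poly_op p A)" by (rule onorm_pos_le[OF bounded_clinear_bounded_linear[OF PA']])
      fix x
      have "poly_op p A (V x) = V (poly_op p N x)"
        unfolding PA by (simp add: WV orth)
      then show "norm (poly_op p N x) \<le> onorm (poly_op p A) * norm x"
        using norm_le_onorm[OF PA', of p "V x"] by (simp add: V)
    qed
  qed
  \<comment> \<open>A normal operator and its adjoint stretch \<open>e0\<close> equally. Here
    \<open>A e0\<close> has length \<open>cmod a\<close>, while the adjoint image has in addition
    the component \<open>r\<close> along \<open>e1\<close>.\<close>
  moreover have "\<not> normal_op A"
  proof
    assume nA: "normal_op A"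
    obtain B where B: "adjoint_pair A B" using exists_adjoint[OF A] by blast
    have "A (B x) = B (A x)" for x
      using nA unfolding normal_op_def cadjoint_eq[OF B] by (metis comp_apply)
    then have "norm (B e0) = norm (A e0)" by (rule norm_normal[OF B])
    moreover have "A e0 = a *\<^sub>C e0"
      using bounded_clinear_zero[OF N] bounded_clinear_zero[OF bounded_clinear_V]
      by (simp add: A_def W_e e e10)
    moreover have "norm e0 = 1" using e by (simp add: norm_eq_sqrt_cinner)
    ultimately have nB: "(norm (B e0))\<^sup>2 = (cmod a)\<^sup>2" by (simp add: norm_scaleC)
    have "A e1 = of_real r *\<^sub>C e0 + a *\<^sub>C e1"
      using bounded_clinear_zero[OF N] bounded_clinear_zero[OF bounded_clinear_V]
      by (simp add: A_def W_e e e10)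
    then have "cinner e1 (B e0) = of_real r"
      unfolding adjoint_pairD[OF B, symmetric] by (simp add: cinner_simps e e10)
    moreover have "cinner e0 (B e0) = cnj a"
      unfolding adjoint_pairD[OF B, symmetric] \<open>A e0 = a *\<^sub>C e0\<close> by (simp add: cinner_simps e)
    ultimately have "(norm (B e0))\<^sup>2 \<ge> (cmod a)\<^sup>2 + r\<^sup>2"
      unfolding norm_decompose[of "B e0"] by simp
    then show False using nB r by simp
  qed
  ultimately have "bounded_clinear A \<and> (\<forall>p. onorm (poly_op p A) = onorm (poly_op p N)) \<and> \<not> normal_op A"
    using A by simp
  then show ?thesis by (rule exI[of _ A])
qed

end

section \<open>Orthonormal sequences and the double shift\<close>

text \<open>One Gram-Schmidt step, applied to a vector outside the span of \<open>F\<close>.\<close>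

lemma exists_unit_vector_orthogonal:
  fixes F :: "'a::complex_inner set"
  assumes inf: "infinite_dimensional TYPE('a)" and F: "finite F"
    and on: "\<And>x y. x \<in> F \<Longrightarrow> y \<in> F \<Longrightarrow> cinner x y = (if x = y then 1 else 0)"
  shows "\<exists>z. cinner z z = 1 \<and> (\<forall>x\<in>F. cinner x z = 0)"
proof -
  have "cspan F \<noteq> UNIV" using inf F unfolding infinite_dimensional_def by blast
  then obtain y where y: "y \<notin> cspan F" by blast
  define s where "s = (\<Sum>x\<in>F. cinner x y *\<^sub>C x)"
  have "s \<in> cspan F"
    unfolding cspan_def s_def mem_Collect_eq
    by (intro exI[of _ F] exI[of _ "\<lambda>x. cinner x y"]) (simp add: F)
  then have ne: "norm (y - s) \<noteq> 0" using y by auto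
  have orth: "cinner x (y - s) = 0" if "x \<in> F" for x
  proof -
    have "cinner x s = (\<Sum>u\<in>F. cinner x (cinner u y *\<^sub>C u))"
      unfolding s_def using bounded_linear.linear[OF bounded_bilinear.bounded_linear_right[OF bounded_bilinear_cinner]]
      by (rule linear_sum)
    also have "\<dots> = (\<Sum>u\<in>F. if u = x then cinner x y else 0)"
      by (rule sum.cong) (use on that in \<open>auto simp: cinner_scaleC_right\<close>)
    also have "\<dots> = cinner x y" using F that by simp
    finally show ?thesis by (simp add: cinner_diff_right)
  qed
  define z where "z = (1 / norm (y - s)) *\<^sub>R (y - s)"
  have "cinner z z = 1"
    using ne unfolding z_def cinner_self by (simp add: power_divide)
  moreover have "\<forall>x\<in>F. cinner x z = 0"
    unfolding z_def cinner_scaleR_right using orth by simp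
  ultimately show ?thesis by blast
qed

lemma exists_orthonormal_sequence:
  assumes inf: "infinite_dimensional TYPE('a::complex_inner)"
  shows "\<exists>e :: nat \<Rightarrow> 'a. \<forall>m n. cinner (e m) (e n) = (if m = n then 1 else 0)"
proof -
  define ons :: "'a set \<Rightarrow> bool" where
    "ons F \<longleftrightarrow> finite F \<and> (\<forall>x\<in>F. \<forall>y\<in>F. cinner x y = (if x = y then 1 else 0))" for F
  \<comment> \<open>The condition on \<open>F\<close> stands inside the existential so that a single
    choice function serves all sets.\<close>
  have "\<exists>z. ons F \<longrightarrow> cinner z z = 1 \<and> (\<forall>x\<in>F. cinner x z = 0)" for F
    using exists_unit_vector_orthogonal[OF inf, of F] unfolding ons_def by blast
  then obtain step where step: "\<And>F. ons F \<Longrightarrow> cinner (step F) (step F) = 1"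
      "\<And>F x. ons F \<Longrightarrow> x \<in> F \<Longrightarrow> cinner x (step F) = 0"
    by metis
  define G where "G = rec_nat {} (\<lambda>_ F. insert (step F) F)"
  have G: "G 0 = {}" "G (Suc n) = insert (step (G n)) (G n)" for n by (simp_all add: G_def)
  have ons: "ons (G n)" for n
  proof (induction n)
    case 0
    show ?case by (simp add: G ons_def)
  next
    case (Suc n)
    have "cinner (step (G n)) x = 0" if "x \<in> G n" for x
      using step(2)[OF Suc that] cinner_commute[of "step (G n)" x] by simp
    then show ?case
      using Suc step[OF Suc] unfolding G ons_def by (auto simp: cinner_eq_zero_iff)
  qed
  define e where "e n = step (G n)" for n
  have eG: "e m \<in> G n" if "m < n" for m n
    using that by (induction n) (auto simp: G e_def less_Suc_eq)
  have less: "cinner (e m) (e n) = 0" if "m < n" for m n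
    using step(2)[OF ons eG[OF that]] by (simp add: e_def)
  have "cinner (e m) (e n) = (if m = n then 1 else 0)" for m n
  proof (cases m n rule: linorder_cases)
    case less
    then show ?thesis using \<open>\<And>m n. m < n \<Longrightarrow> cinner (e m) (e n) = 0\<close> by simp
  next
    case equal
    then show ?thesis using step(1)[OF ons] by (simp add: e_def)
  next
    case greater
    then show ?thesis using \<open>\<And>m n. m < n \<Longrightarrow> cinner (e m) (e n) = 0\<close>[of n m] cinner_commute[of "e m" "e n"] by simp
  qed
  then show ?thesis by blast
qed

context
  fixes e :: "nat \<Rightarrow> 'a::chilbert_space"
  assumes e: "\<And>m n. cinner (e m) (e n) = (if m = n then 1 else 0)"
begin

lemma norm_sum_orthonormal:
  assumes "finite F"
  shows "(norm (\<Sum>n\<in>F. c n *\<^sub>C e n))\<^sup>2 = (\<Sum>n\<in>F. (cmod (c n))\<^sup>2)"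
  using assms
proof (induction F rule: finite_induct)
  case (insert k F)
  have "cinner (c k *\<^sub>C e k) (\<Sum>n\<in>F. c n *\<^sub>C e n) = (\<Sum>n\<in>F. cinner (c k *\<^sub>C e k) (c n *\<^sub>C e n))"
    using bounded_linear.linear[OF bounded_bilinear.bounded_linear_right[OF bounded_bilinear_cinner]]
    by (rule linear_sum)
  also have "\<dots> = 0" by (rule sum.neutral) (use insert in \<open>auto simp: cinner_simps e\<close>)
  finally have "(norm (c k *\<^sub>C e k + (\<Sum>n\<in>F. c n *\<^sub>C e n)))\<^sup>2
      = (norm (c k *\<^sub>C e k))\<^sup>2 + (norm (\<Sum>n\<in>F. c n *\<^sub>C e n))\<^sup>2"
    by (rule norm_add_sq_orthogonal)
  moreover have "norm (e k) = 1" by (simp add: norm_eq_sqrt_cinner e)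
  ultimately show ?case using insert by (simp add: norm_scaleC)
qed simp

text \<open>By Pythagoras the squared norm of a block of the series is a block of the series of
  squares, so Cauchy's criterion carries over.\<close>

lemma summable_orthonormal:
  assumes "summable (\<lambda>n. (cmod (c n))\<^sup>2)"
  shows "summable (\<lambda>n. c n *\<^sub>C e n)"
  unfolding summable_Cauchy
proof (intro allI impI)
  fix \<epsilon> :: real assume \<epsilon>: "\<epsilon> > 0"
  then have "\<epsilon>\<^sup>2 > 0" by simp
  then obtain N where N: "\<And>m n. m \<ge> N \<Longrightarrow> norm (\<Sum>k\<in>{m..<n}. (cmod (c k))\<^sup>2) < \<epsilon>\<^sup>2"
    using assms unfolding summable_Cauchy by blast
  have "norm (\<Sum>k\<in>{m..<n}. c k *\<^sub>C e k) < \<epsilon>" if "m \<ge> N" for m n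
  proof -
    have "(norm (\<Sum>k\<in>{m..<n}. c k *\<^sub>C e k))\<^sup>2 < \<epsilon>\<^sup>2"
      using N[OF that, of n] by (simp add: norm_sum_orthonormal)
    then show ?thesis using \<epsilon> by (simp add: power2_less_imp_less)
  qed
  then show "\<exists>N. \<forall>m\<ge>N. \<forall>n. norm (\<Sum>k\<in>{m..<n}. c k *\<^sub>C e k) < \<epsilon>" by blast
qed

lemma norm_suminf_orthonormal:
  assumes "summable (\<lambda>n. (cmod (c n))\<^sup>2)"
  shows "(norm (\<Sum>n. c n *\<^sub>C e n))\<^sup>2 = (\<Sum>n. (cmod (c n))\<^sup>2)"
proof (rule LIMSEQ_unique)
  show "(\<lambda>k. (norm (\<Sum>n<k. c n *\<^sub>C e n))\<^sup>2) \<longlonglongrightarrow> (norm (\<Sum>n. c n *\<^sub>C e n))\<^sup>2"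
    by (intro tendsto_power tendsto_norm summable_LIMSEQ summable_orthonormal assms)
  show "(\<lambda>k. (norm (\<Sum>n<k. c n *\<^sub>C e n))\<^sup>2) \<longlonglongrightarrow> (\<Sum>n. (cmod (c n))\<^sup>2)"
    unfolding norm_sum_orthonormal[OF finite_lessThan] by (rule summable_LIMSEQ[OF assms])
qed

lemma cinner_suminf_right:
  assumes "summable f"
  shows "cinner x (suminf f) = (\<Sum>n. cinner x (f n))"
  using bounded_linear.suminf[OF bounded_bilinear.bounded_linear_right[OF bounded_bilinear_cinner] assms]
  by simp

lemma cinner_orthonormal_suminf:
  assumes "summable (\<lambda>n. (cmod (c n))\<^sup>2)"
  shows "cinner (e m) (\<Sum>n. c n *\<^sub>C e n) = c m"
proof -
  have "cinner (e m) (\<Sum>n. c n *\<^sub>C e n) = (\<Sum>n. if n = m then c n else 0)"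
    unfolding cinner_suminf_right[OF summable_orthonormal[OF assms]]
    by (rule suminf_cong) (simp add: cinner_scaleC_right e)
  also have "\<dots> = c m" by (subst suminf_finite[of "{m}"]) auto
  finally show ?thesis .
qed

text \<open>Bessel's inequality: the squared distance from \<open>x\<close> to its projection
  \<open>s\<close> is nonnegative.\<close>

lemma summable_bessel: "summable (\<lambda>n. (cmod (cinner (e n) x))\<^sup>2)"
proof (rule summableI_nonneg_bounded)
  fix k
  define s where "s = (\<Sum>n<k. cinner (e n) x *\<^sub>C e n)"
  have "cinner x s = (\<Sum>n<k. cinner x (cinner (e n) x *\<^sub>C e n))"
    unfolding s_def using bounded_linear.linear[OF bounded_bilinear.bounded_linear_right[OF bounded_bilinear_cinner]]
    by (rule linear_sum)
  also have "\<dots> = (\<Sum>n<k. of_real ((cmod (cinner (e n) x))\<^sup>2))"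
    by (rule sum.cong) (simp_all add: cinner_scaleC_right cinner_commute[of x] complex_norm_square del: of_real_power)
  finally have "Re (cinner x s) = (\<Sum>n<k. (cmod (cinner (e n) x))\<^sup>2)" by simp
  moreover have "(norm s)\<^sup>2 = (\<Sum>n<k. (cmod (cinner (e n) x))\<^sup>2)"
    unfolding s_def by (rule norm_sum_orthonormal) simp
  moreover have "0 \<le> (norm (x - s))\<^sup>2" by simp
  ultimately show "(\<Sum>n<k. (cmod (cinner (e n) x))\<^sup>2) \<le> (norm x)\<^sup>2"
    unfolding norm_diff_sq by simp
qed simp

text \<open>The unilateral double shift on the closed span of the sequence, extended by the identity
  on its orthogonal complement: a unitary map of the space onto the complement of the first two
  basis vectors.\<close>

lemma exists_double_shift:
  "\<exists>V W :: 'a \<Rightarrow> 'a. (\<forall>x y. V (x + y) = V x + V y) \<and> (\<forall>c x. V (c *\<^sub>C x) = c *\<^sub>C V x) \<and>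
     (\<forall>x. norm (V x) = norm x) \<and> (\<forall>x. W (V x) = x) \<and>
     (\<forall>x. V (W x) = x - cinner (e 0) x *\<^sub>C e 0 - cinner (e 1) x *\<^sub>C e 1) \<and>
     (\<forall>x. cinner (e 0) (V x) = 0) \<and> (\<forall>x. cinner (e 1) (V x) = 0)"
proof -
  define a where "a n x = cinner (e n) x" for n x
  \<comment> \<open>\<open>P\<close> rebuilds a vector from coefficients, so
    \<open>P (\<lambda>n. a n x)\<close> is the projection of \<open>x\<close> onto the closed
    span.\<close>
  define P where "P c = (\<Sum>n. c n *\<^sub>C e n)" for c
  define sh where "sh c n = (if n < 2 then 0 else c (n - 2))" for c :: "nat \<Rightarrow> complex" and n
  define l2 where "l2 c \<longleftrightarrow> summable (\<lambda>n. (cmod (c n))\<^sup>2)" for c :: "nat \<Rightarrow> complex"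
  have l2a: "l2 (\<lambda>n. a n x)" for x unfolding l2_def a_def by (rule summable_bessel)
  have sh2: "(\<lambda>n. (cmod (sh c (n + 2)))\<^sup>2) = (\<lambda>n. (cmod (c n))\<^sup>2)" for c by (simp add: sh_def)
  have l2sh: "l2 (sh c)" if "l2 c" for c
    using that summable_iff_shift[of "\<lambda>n. (cmod (sh c n))\<^sup>2" 2] unfolding l2_def sh2 by simp
  have l2sub: "l2 (\<lambda>n. c (n + 2))" if "l2 c" for c
    using that summable_iff_shift[of "\<lambda>n. (cmod (c n))\<^sup>2" 2] unfolding l2_def by simp
  have aP: "a m (P c) = c m" if "l2 c" for m c
    using cinner_orthonormal_suminf that unfolding l2_def a_def P_def .
  have aadd: "a n (x + y) = a n x + a n y" and adiff: "a n (x - y) = a n x - a n y"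
    and ascale: "a n (c *\<^sub>C x) = c * a n x" for n x y c
    by (simp_all add: a_def cinner_simps)
  have sumP: "summable (\<lambda>n. c n *\<^sub>C e n)" if "l2 c" for c
    using summable_orthonormal that unfolding l2_def .
  have Padd: "P (\<lambda>n. c n + d n) = P c + P d" if "l2 c" "l2 d" for c d
    unfolding P_def by (simp add: scaleC_add_left suminf_add[OF sumP[OF that(1)] sumP[OF that(2)]])
  have Pscale: "P (\<lambda>n. k * c n) = k *\<^sub>C P c" if "l2 c" for c k
    using bounded_linear.suminf[OF bounded_bilinear.bounded_linear_right[OF bounded_bilinear_scaleC] sumP[OF that], of k]
    unfolding P_def by (simp add: scaleC_scaleC)
  have Psplit: "P c = P (sh (\<lambda>n. c (n + 2))) + c 0 *\<^sub>C e 0 + c 1 *\<^sub>C e 1" if "l2 c" for c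
  proof -
    have "P c = (\<Sum>n. c (n + 2) *\<^sub>C e (n + 2)) + (\<Sum>n<2. c n *\<^sub>C e n)"
      unfolding P_def by (rule suminf_split_initial_segment[OF sumP[OF that]])
    moreover have "P (sh (\<lambda>n. c (n + 2))) = (\<Sum>n. sh (\<lambda>n. c (n + 2)) (n + 2) *\<^sub>C e (n + 2))
        + (\<Sum>n<2. sh (\<lambda>n. c (n + 2)) n *\<^sub>C e n)"
      unfolding P_def by (rule suminf_split_initial_segment[OF sumP[OF l2sh[OF l2sub[OF that]]]])
    ultimately show ?thesis by (simp add: sh_def numeral_2_eq_2)
  qed
  define V where "V x = x - P (\<lambda>n. a n x) + P (sh (\<lambda>n. a n x))" for x
  define W where "W x = x - P (\<lambda>n. a n x) + P (\<lambda>n. a (n + 2) x)" for x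
  have aV: "a n (V x) = sh (\<lambda>n. a n x) n" for n x
    unfolding V_def aadd adiff aP[OF l2a] aP[OF l2sh[OF l2a]] by simp
  have aW: "a n (W x) = a (n + 2) x" for n x
    unfolding W_def aadd adiff aP[OF l2a] aP[OF l2sub[OF l2a]] by simp
  have "V (x + y) = V x + V y" for x y
  proof -
    have "sh (\<lambda>n. a n (x + y)) = (\<lambda>n. sh (\<lambda>n. a n x) n + sh (\<lambda>n. a n y) n)"
      by (rule ext) (simp add: sh_def aadd)
    then show ?thesis
      unfolding V_def by (simp add: aadd Padd[OF l2a l2a] Padd[OF l2sh[OF l2a] l2sh[OF l2a]])
  qed
  moreover have "V (c *\<^sub>C x) = c *\<^sub>C V x" for c x
  proof -
    have "sh (\<lambda>n. a n (c *\<^sub>C x)) = (\<lambda>n. c * sh (\<lambda>n. a n x) n)"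
      by (rule ext) (simp add: sh_def ascale)
    then show ?thesis
      unfolding V_def by (simp add: ascale Pscale[OF l2a] Pscale[OF l2sh[OF l2a]] scaleC_simps)
  qed
  moreover have "norm (V x) = norm x" for x
  proof -
    \<comment> \<open>The part that \<open>V\<close> leaves alone. It is orthogonal to every
      \<open>P c\<close>, so only the norms of the coefficient sequences have to be
      compared.\<close>
    define u where "u = x - P (\<lambda>n. a n x)"
    have orth: "cinner u (P c) = 0" if "l2 c" for c
    proof -
      have "a n u = 0" for n unfolding u_def adiff aP[OF l2a] by simp
      then have "cinner u (e n) = 0" for n using cinner_commute[of u "e n"] by (simp add: a_def)
      then show ?thesis unfolding P_def cinner_suminf_right[OF sumP[OF that]] by (simp add: cinner_scaleC_right)
    qed
    have "(norm (V x))\<^sup>2 = (norm u)\<^sup>2 + (norm (P (sh (\<lambda>n. a n x))))\<^sup>2"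
      unfolding V_def u_def[symmetric] by (rule norm_add_sq_orthogonal[OF orth[OF l2sh[OF l2a]]])
    moreover have "(norm (u + P (\<lambda>n. a n x)))\<^sup>2 = (norm u)\<^sup>2 + (norm (P (\<lambda>n. a n x)))\<^sup>2"
      by (rule norm_add_sq_orthogonal[OF orth[OF l2a]])
    moreover have "(norm (P (sh (\<lambda>n. a n x))))\<^sup>2 = (norm (P (\<lambda>n. a n x)))\<^sup>2"
    proof -
      have "(norm (P (sh (\<lambda>n. a n x))))\<^sup>2 = (\<Sum>n. (cmod (sh (\<lambda>n. a n x) n))\<^sup>2)"
        unfolding P_def by (rule norm_suminf_orthonormal) (use l2sh[OF l2a] in \<open>simp add: l2_def\<close>)
      also have "\<dots> = (\<Sum>n. (cmod (sh (\<lambda>n. a n x) (n + 2)))\<^sup>2) + (\<Sum>n<2. (cmod (sh (\<lambda>n. a n x) n))\<^sup>2)"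
        by (rule suminf_split_initial_segment) (use l2sh[OF l2a] in \<open>simp add: l2_def\<close>)
      also have "\<dots> = (\<Sum>n. (cmod (a n x))\<^sup>2)" unfolding sh2 by (simp add: sh_def)
      also have "\<dots> = (norm (P (\<lambda>n. a n x)))\<^sup>2"
        unfolding P_def by (rule norm_suminf_orthonormal[symmetric]) (use l2a in \<open>simp add: l2_def\<close>)
      finally show ?thesis .
    qed
    ultimately have "(norm (V x))\<^sup>2 = (norm x)\<^sup>2" by (simp add: u_def)
    then show ?thesis by simp
  qed
  moreover have "W (V x) = x" for x
  proof -
    have 1: "(\<lambda>n. a n (V x)) = sh (\<lambda>n. a n x)" by (rule ext) (rule aV)
    have 2: "(\<lambda>n. a (n + 2) (V x)) = (\<lambda>n. a n x)" by (rule ext) (simp add: aV sh_def)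
    show ?thesis unfolding W_def[of "V x"] 1 2 by (simp add: V_def)
  qed
  moreover have "V (W x) = x - cinner (e 0) x *\<^sub>C e 0 - cinner (e 1) x *\<^sub>C e 1" for x
  proof -
    have 1: "(\<lambda>n. a n (W x)) = (\<lambda>n. a (n + 2) x)" by (rule ext) (rule aW)
    have "V (W x) = x - P (\<lambda>n. a n x) + P (sh (\<lambda>n. a (n + 2) x))"
      unfolding V_def[of "W x"] 1 by (simp add: W_def)
    also have "\<dots> = x - a 0 x *\<^sub>C e 0 - a 1 x *\<^sub>C e 1"
      by (subst Psplit[OF l2a]) simp
    finally show ?thesis by (simp only: a_def)
  qed
  moreover have "cinner (e 0) (V x) = 0" "cinner (e 1) (V x) = 0" for x
    using aV[of 0 x] aV[of 1 x] by (simp_all add: a_def sh_def)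
  ultimately show ?thesis by (intro exI[of _ V] exI[of _ W]) simp
qed

end

theorem theorem3p5:
  fixes N :: "'a::chilbert_space \<Rightarrow> 'a"
  assumes "separable (UNIV :: 'a set)"
    and "infinite_dimensional TYPE('a)"
    and "bounded_clinear N"
    and "normal_op N"
  shows "lavrentieff (op_spectrum N) \<longleftrightarrow>
           (\<forall>A :: 'a \<Rightarrow> 'a. bounded_clinear A \<and>
               (\<forall>p :: complex poly. onorm (poly_op p A) = onorm (poly_op p N))
             \<longrightarrow> normal_op A)"
proof -
  obtain M where adj: "adjoint_pair N M" using exists_adjoint[OF assms(3)] by blast
  have comm: "N (M x) = M (N x)" for x
    using assms(4) unfolding normal_op_def cadjoint_eq[OF adj] by (metis comp_apply)
  obtain e :: "nat \<Rightarrow> 'a" where e: "\<And>m n. cinner (e m) (e n) = (if m = n then 1 else 0)"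
    using exists_orthonormal_sequence[OF assms(2)] by blast
  \<comment> \<open>A nonzero vector makes the spectrum nonempty, and then every bound for
    \<open>|p|\<close> on the spectrum is nonnegative, as a bound for an operator norm must
    be.\<close>
  have "e 0 \<noteq> 0" using e[of 0 0] by auto
  then have ne: "op_spectrum N \<noteq> {}" by (rule op_spectrum_normal_nonempty[OF assms(3) adj comm])
  have K: "compact (op_spectrum N)" by (rule compact_op_spectrum[OF assms(3)])
  show ?thesis
  proof
    assume lav: "lavrentieff (op_spectrum N)"
    show "\<forall>A :: 'a \<Rightarrow> 'a. bounded_clinear A \<and>
               (\<forall>p :: complex poly. onorm (poly_op p A) = onorm (poly_op p N)) \<longrightarrow> normal_op A"
    proof (intro allI impI, elim conjE)
      fix A :: "'a \<Rightarrow> 'a"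
      assume A: "bounded_clinear A" and eq: "\<forall>p :: complex poly. onorm (poly_op p A) = onorm (poly_op p N)"
      show "normal_op A"
      proof (rule normal_op_of_cnj_approximation[OF A K])
        show "\<exists>p. \<forall>z\<in>op_spectrum N. cmod (cnj z - poly p z) < \<epsilon>" if "\<epsilon> > 0" for \<epsilon>
          by (rule papproxD[OF lavrentieff_papprox_cnj[OF lav] that])
        fix p C and x :: 'a
        assume "\<And>z. z \<in> op_spectrum N \<Longrightarrow> cmod (poly p z) \<le> C"
        then have "onorm (poly_op p A) \<le> C"
          using onorm_poly_op_normal_le[OF assms(3) adj comm ne] eq by simp
        then have "onorm (poly_op p A) * norm x \<le> C * norm x" by (intro mult_right_mono) auto
        then show "norm (poly_op p A x) \<le> C * norm x"
          using norm_le_onorm[OF bounded_clinear_poly_op[OF A], of p x] by linarith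
      qed
    qed
  next
    assume normal: "\<forall>A :: 'a \<Rightarrow> 'a. bounded_clinear A \<and>
               (\<forall>p :: complex poly. onorm (poly_op p A) = onorm (poly_op p N)) \<longrightarrow> normal_op A"
    show "lavrentieff (op_spectrum N)"
    proof (rule ccontr)
      assume "\<not> lavrentieff (op_spectrum N)"
      then obtain a r where r: "0 < r" and disc: "\<And>p C z. \<forall>z\<in>op_spectrum N. cmod (poly p z) \<le> C \<Longrightarrow>
          z \<in> ball a r \<Longrightarrow> cmod (poly p z) \<le> C"
        using not_lavrentieff_polynomial_bound[OF K] by blast
      obtain V W :: "'a \<Rightarrow> 'a" where VW: "\<And>x y. V (x + y) = V x + V y" "\<And>c x. V (c *\<^sub>C x) = c *\<^sub>C V x"
        "\<And>x. norm (V x) = norm x" "\<And>x. W (V x) = x"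
        "\<And>x. V (W x) = x - cinner (e 0) x *\<^sub>C e 0 - cinner (e 1) x *\<^sub>C e 1"
        "\<And>x. cinner (e 0) (V x) = 0" "\<And>x. cinner (e 1) (V x) = 0"
        using exists_double_shift[OF e] by blast
      have bound: "cmod (poly p z) \<le> onorm (poly_op p N)" if "z \<in> ball a r" for p z
        using disc[OF _ that] cmod_poly_le_onorm[OF assms(3)] by blast
      have "cinner (e 0) (e 0) = 1" "cinner (e 1) (e 1) = 1" "cinner (e 0) (e 1) = 0"
        using e by simp_all
      from exists_nonnormal_dilation[OF VW(1-5) this VW(6,7) assms(3) r bound]
      obtain A :: "'a \<Rightarrow> 'a" where "bounded_clinear A"
        "\<And>p. onorm (poly_op p A) = onorm (poly_op p N)" "\<not> normal_op A" by blast
      then show False using normal by blast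
    qed
  qed
qed

end
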